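(* Let $1/3<\beta\le 1/2$ and $\gamma>1/\beta$. Let $\omega$ be a control function on $[0,T]$ and let $\mathbf{X}=(X,\mathbb{X})$ be an $(\omega,\beta)$-H\"older rough path on $\mathbb{R}^d$. Let $\sigma\in \mathrm{Lip}^{\gamma-1}(\mathbb{R}^n\times\mathbb{R}^n,\mathcal{L}(\mathbb{R}^d,\mathbb{R}^n))$ and $\xi\in\mathbb{R}^n$. Let $A:\mathcal{C}^{\beta}([0,T],\mathbb{R}^n\,|\,x_0=\xi)\to C([0,T],\mathbb{R}^n)$ be a mapping satisfying the following. (a) (Adaptedness) For all $0\le t\le T$, $(A(x)_s)_{0\le s\le t}$ depends only on $(x_s)_{0\le s\le t}$. (b) (Continuity) There exists $\beta_0$ with $1/3<\beta_0<\beta$ such that $A$ extends to a continuous mapping (still denoted $A$) from $\mathcal{C}^{\beta_0}([0,T],\mathbb{R}^n\,|\,x_0=\xi)$ to $(C([0,T],\mathbb{R}^n),\|\cdot\|_{\infty,[0,T]})$. (c) There exists a non-decreasing positive continuous function $F$ on $[0,\infty)$ such that for all $x\in\mathcal{C}^{\beta_0}([0,T],\mathbb{R}^n\,|\,x_0=\xi)$ and all $0\le s\le t\le T$, $$\|A(x)\|_{1\text{-}var,[s,t]}\le F\big(\|x\|_{(1/\beta_0)\text{-}var,[s,t]}\big)\,\|x\|_{\infty\text{-}var,[s,t]}.$$ Then the following hold. (1) There exists a controlled path $(Z,Z')\in\mathscr{D}^{2\beta}_X(\mathbb{R}^n)$ such that $$Z_t=\xi+\int_0^t\sigma(Z_s,A(Z)_s)\,d\mathbf{X}_s,\qquad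 Z'_t=\sigma(Z_t,A(Z)_t),\qquad 0\le t\le T.\qquad( * )$$ (2) There exist positive constants $K,\kappa_1,\kappa_2,\kappa_3$, depending only on $\sigma,\beta,\gamma,F$, such that all solutions $(Z,Z')$ of $( * )$ satisfy $$\|Z\|_{\beta}+\|Z'\|_{\beta}+\|A(Z)\|_{1\text{-}var,\beta}+\|R^Z\|_{2\beta}\le K\left\{1+\big(1+\widetilde{|||\mathbf{X}|||}_{\beta}\big)^{\kappa_1}\omega(0,T)\right\}^{\kappa_2}\widetilde{|||\mathbf{X}|||}_{\beta}^{\kappa_3}.$$
   Context: Fix $T>0$. A control function is a continuous map $(s,t)\mapsto\omega(s,t)\in[0,\infty)$, $0\le s\le t\le T$, with $\omega(s,u)+\omega(u,t)\le\omega(s,t)$ for $s\le u\le t$. For a continuous path $x$ with values in a finite-dimensional normed space $E$ write $x_{s,t}=x_t-x_s$, $\|x\|_{\infty,[s,t]}=\max_{s\le u\le t}|x_u|$, $\|x\|_{\infty\text{-}var,[s,t]}=\max_{s\le u\le v\le t}|x_{u,v}|$, $\|x\|_{p\text{-}var,[s,t]}=\{\sup_{\mathcal P}\sum_k|x_{t_{k-1},t_k}|^p\}^{1/p}$ (sup over partitions of $[s,t]$), $\|x\|_{\theta,[s,t]}=\inf\{C>0: |x_{u,v}|\le C\omega(u,v)^{\theta},\ s\le u\le v\le t\}$, $\|x\|_{q\text{-}var,\theta,[s,t]}=\inf\{C>0:\|x\|_{q\text{-}var,[u,v]}\le C\omega(u,v)^\theta,\ s\le u\le v\le t\}$ (with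 $\inf\emptyset=+\infty$). The interval is omitted when it is $[0,T]$. For two-parameter functions $F_{s,t}$, $\|F\|_\theta$ is defined similarly. $\mathcal{C}^\theta([0,T],E)$ is the Banach space of continuous $x$ with $\|x\|_\theta<\infty$, with norm $|x_0|+\|x\|_\theta$; $\mathcal{C}^{\theta}([0,T],E\,|\,x_0=\xi)$ is the subset of paths starting at $\xi$. For $\gamma=m+\theta$ with $m\in\mathbb{N}\cup\{0\}$, $0<\theta\le1$, $\mathrm{Lip}^\gamma(E,F)$ is the set of bounded functions $f:E\to F$ that are $m$ times continuously differentiable with bounded derivatives up to order $m$ and $D^mf$ $\theta$-H\"older continuous. An $(\omega,\beta)$-H\"older rough path $\mathbf{X}_{s,t}=(X_{s,t},\mathbb{X}_{s,t})$ on $\mathbb{R}^d$ satisfies Chen's relation and $|X_{s,t}|\le\|X\|_\beta\omega(s,t)^\beta$, $|\mathbb{X}_{s,t}|\le\|\mathbb{X}\|_{2\beta}\omega(s,t)^{2\beta}$ with finite $\|X\|_\beta,\|\mathbb X\|_{2\beta}$. Put $|||\mathbf{X}|||_\beta=\|X\|_\beta+\sqrt{\|\mathbb{X}\|_{2\beta}}$ and $\widetilde{|||\mathbf{X}|||}_\beta=\sum_{i=1}^3|||\mathbf{X}|||_\beta^i$. $\mathscr{D}^{2\theta}_X(\mathbb{R}^n)$ ($1/3<\theta\le\beta$) is the set of controlled paths: pairs $(Z,Z')\in\mathcal{C}^\theta([0,T],\mathbb{R}^n)\times\mathcal{C}^\theta([0,T],\mathcal{L}(\mathbb{R}^d,\mathbb{R}^n))$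 such that $R^Z_{s,t}=Z_t-Z_s-Z'_sX_{s,t}$ satisfies $\|R^Z\|_{2\theta}<\infty$. For $(Z,Z')\in\mathscr{D}^{2\theta}_X(\mathbb{R}^n)$ and a continuous bounded variation path $\Psi$, the integral is $$\int_s^t\sigma(Z_u,\Psi_u)d\mathbf{X}_u=\lim_{|\mathcal P|\to0}\sum_i\Xi_{t_{i-1},t_i},\quad \Xi_{s,t}=\sigma(Z_s,\Psi_s)X_{s,t}+(D_1\sigma)(Z_s,\Psi_s)Z'_s\mathbb{X}_{s,t}+(D_2\sigma)(Z_s,\Psi_s)\int_s^t\Psi_{s,r}\otimes dX_r,$$ over partitions of $[s,t]$ with mesh $|\mathcal P|\to0$, where $D_1\sigma,D_2\sigma$ are the derivatives in the first and second variables and the last integral is a Young integral (dropping the last term does not change the limit). *)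

theory Defs
  imports "HOL-Analysis.Analysis"
begin

text \<open>
  Paths on \<open>[0, T]\<close> are functions on \<^typ>\<open>real\<close> of which only the values on \<open>{0..T}\<close> matter,
  two-parameter functions are used only for \<open>0 \<le> s \<le> t \<le> T\<close>.  All norms that may be infinite
  take values in \<^typ>\<open>ennreal\<close>, where \<open>Inf {} = top\<close>.
\<close>

definition control_fun :: "real \<Rightarrow> (real \<Rightarrow> real \<Rightarrow> real) \<Rightarrow> bool" where
  "control_fun T \<omega> \<longleftrightarrow>
     continuous_on {(s, t). 0 \<le> s \<and> s \<le> t \<and> t \<le> T} (\<lambda>(s, t). \<omega> s t) \<and>
     (\<forall>s t. 0 \<le> s \<and> s \<le> t \<and> t \<le> T \<longrightarrow> 0 \<le> \<omega> s t) \<and>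
     (\<forall>s u t. 0 \<le> s \<and> s \<le> u \<and> u \<le> t \<and> t \<le> T \<longrightarrow> \<omega> s u + \<omega> u t \<le> \<omega> s t)"


subsection \<open>Partitions and limits of partition sums\<close>

definition partitions :: "real \<Rightarrow> real \<Rightarrow> real list set" where
  "partitions s t = {ts. ts \<noteq> [] \<and> sorted_wrt (<) ts \<and> hd ts = s \<and> last ts = t}"

definition partition_sum :: "(real \<Rightarrow> real \<Rightarrow> 'a::comm_monoid_add) \<Rightarrow> real list \<Rightarrow> 'a" where
  "partition_sum G ts = (\<Sum>i<length ts - 1. G (ts ! i) (ts ! Suc i))"

definition mesh_less :: "real list \<Rightarrow> real \<Rightarrow> bool" where
  "mesh_less ts \<delta> \<longleftrightarrow> (\<forall>i<length ts - 1. ts ! Suc i - ts ! i < \<delta>)"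

definition has_partition_limit ::
    "(real \<Rightarrow> real \<Rightarrow> 'a::real_normed_vector) \<Rightarrow> real \<Rightarrow> real \<Rightarrow> 'a \<Rightarrow> bool" where
  "has_partition_limit G s t I \<longleftrightarrow>
     (\<forall>\<epsilon>>0. \<exists>\<delta>>0. \<forall>ts\<in>partitions s t. mesh_less ts \<delta> \<longrightarrow> norm (partition_sum G ts - I) < \<epsilon>)"


subsection \<open>Norms of paths and of two-parameter functions\<close>

definition sup_norm :: "real \<Rightarrow> real \<Rightarrow> (real \<Rightarrow> 'a::real_normed_vector) \<Rightarrow> ennreal" where
  "sup_norm s t x = (SUP u\<in>{s..t}. ennreal (norm (x u)))"

definition inf_var :: "real \<Rightarrow> real \<Rightarrow> (real \<Rightarrow> 'a::real_normed_vector) \<Rightarrow> ennreal" where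
  "inf_var s t x = (SUP (u, v)\<in>{(u, v). s \<le> u \<and> u \<le> v \<and> v \<le> t}. ennreal (norm (x v - x u)))"

definition p_var :: "real \<Rightarrow> real \<Rightarrow> real \<Rightarrow> (real \<Rightarrow> 'a::real_normed_vector) \<Rightarrow> ennreal" where
  "p_var p s t x =
     (let S = (SUP ts\<in>partitions s t. ennreal (partition_sum (\<lambda>u v. norm (x v - x u) powr p) ts))
      in if S = top then top else ennreal (enn2real S powr (1 / p)))"

definition holder_norm2 ::
    "(real \<Rightarrow> real \<Rightarrow> real) \<Rightarrow> real \<Rightarrow> real \<Rightarrow> real \<Rightarrow> (real \<Rightarrow> real \<Rightarrow> 'a::real_normed_vector) \<Rightarrow> ennreal" where
  "holder_norm2 \<omega> \<theta> s t G =
     Inf {ennreal C |C. 0 < C \<and>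
            (\<forall>u v. s \<le> u \<and> u \<le> v \<and> v \<le> t \<longrightarrow> norm (G u v) \<le> C * \<omega> u v powr \<theta>)}"

definition holder_norm ::
    "(real \<Rightarrow> real \<Rightarrow> real) \<Rightarrow> real \<Rightarrow> real \<Rightarrow> real \<Rightarrow> (real \<Rightarrow> 'a::real_normed_vector) \<Rightarrow> ennreal" where
  "holder_norm \<omega> \<theta> s t x = holder_norm2 \<omega> \<theta> s t (\<lambda>u v. x v - x u)"

definition var_holder_norm ::
    "(real \<Rightarrow> real \<Rightarrow> real) \<Rightarrow> real \<Rightarrow> real \<Rightarrow> real \<Rightarrow> real \<Rightarrow> (real \<Rightarrow> 'a::real_normed_vector) \<Rightarrow> ennreal" where
  "var_holder_norm \<omega> q \<theta> s t x =
     Inf {ennreal C |C. 0 < C \<and>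
            (\<forall>u v. s \<le> u \<and> u \<le> v \<and> v \<le> t \<longrightarrow> p_var q u v x \<le> ennreal (C * \<omega> u v powr \<theta>))}"

definition holder_space ::
    "real \<Rightarrow> (real \<Rightarrow> real \<Rightarrow> real) \<Rightarrow> real \<Rightarrow> (real \<Rightarrow> 'a::real_normed_vector) set" where
  "holder_space T \<omega> \<theta> = {x. continuous_on {0..T} x \<and> holder_norm \<omega> \<theta> 0 T x < top}"

definition holder_space_from ::
    "real \<Rightarrow> (real \<Rightarrow> real \<Rightarrow> real) \<Rightarrow> real \<Rightarrow> 'a \<Rightarrow> (real \<Rightarrow> 'a::real_normed_vector) set" where
  "holder_space_from T \<omega> \<theta> \<xi> = {x \<in> holder_space T \<omega> \<theta>. x 0 = \<xi>}"

definition holder_space_norm ::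
    "real \<Rightarrow> (real \<Rightarrow> real \<Rightarrow> real) \<Rightarrow> real \<Rightarrow> (real \<Rightarrow> 'a::real_normed_vector) \<Rightarrow> ennreal" where
  "holder_space_norm T \<omega> \<theta> x = ennreal (norm (x 0)) + holder_norm \<omega> \<theta> 0 T x"


subsection \<open>The classes \<open>Lip\<^sup>\<gamma>\<close>\<close>

text \<open>
  \<open>iterated_deriv f [v\<^sub>k, \<dots>, v\<^sub>1] x\<close> is the \<open>k\<close>-linear form \<open>D\<^sup>k f(x)\<close> evaluated at
  \<open>v\<^sub>1, \<dots>, v\<^sub>k\<close>.  As the domain is finite-dimensional, differentiability and continuity of
  \<open>D\<^sup>k f\<close> in the norm of multilinear maps are the same as those of all its evaluations;
  the bounds below are in the multilinear operator norm.
\<close>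
fun iterated_deriv ::
    "('a::euclidean_space \<Rightarrow> 'b::real_normed_vector) \<Rightarrow> 'a list \<Rightarrow> 'a \<Rightarrow> 'b" where
  "iterated_deriv f [] x = f x"
| "iterated_deriv f (v # vs) x = frechet_derivative (iterated_deriv f vs) (at x) v"

definition lip_class :: "real \<Rightarrow> ('a::euclidean_space \<Rightarrow> 'b::real_normed_vector) \<Rightarrow> bool" where
  "lip_class \<gamma> f \<longleftrightarrow>
     (\<exists>m \<theta>. \<gamma> = real m + \<theta> \<and> 0 < \<theta> \<and> \<theta> \<le> 1 \<and>
        (\<forall>vs x. length vs < m \<longrightarrow> iterated_deriv f vs differentiable (at x)) \<and>
        (\<forall>vs. length vs \<le> m \<longrightarrow> continuous_on UNIV (iterated_deriv f vs)) \<and>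
        (\<forall>k\<le>m. \<exists>B. \<forall>vs x. length vs = k \<longrightarrow>
            norm (iterated_deriv f vs x) \<le> B * prod_list (map norm vs)) \<and>
        (\<exists>C. \<forall>vs x y. length vs = m \<longrightarrow>
            norm (iterated_deriv f vs x - iterated_deriv f vs y)
              \<le> C * norm (x - y) powr \<theta> * prod_list (map norm vs)))"


subsection \<open>Rough paths, controlled paths, integrals\<close>

text \<open>
  The tensor product of \<open>\<real>\<^sup>k\<close> and \<open>\<real>\<^sup>d\<close> is represented by \<open>k \<times> d\<close> matrices, with the Euclidean
  norm.  The convention is that of \<open>\<bbbX>\<^bsub>s,t\<^esub> = \<integral>\<^sub>s\<^sup>t X\<^bsub>s,r\<^esub> \<otimes> dX\<^sub>r\<close>: the second
  factor is the one of the integrator.  \<open>tensor_apply B\<close> is the linear map on tensors induced by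
  the bilinear map \<open>B\<close>.
\<close>
definition tensor :: "real^'k \<Rightarrow> real^'d \<Rightarrow> real^'d^'k" where
  "tensor x y = (\<chi> i j. x $ i * y $ j)"

definition tensor_apply ::
    "(real^'k \<Rightarrow> real^'d \<Rightarrow> 'b::real_vector) \<Rightarrow> real^'d^'k \<Rightarrow> 'b" where
  "tensor_apply B M = (\<Sum>i\<in>UNIV. \<Sum>j\<in>UNIV. (M $ i $ j) *\<^sub>R B (axis i 1) (axis j 1))"

definition rough_path ::
    "real \<Rightarrow> (real \<Rightarrow> real \<Rightarrow> real) \<Rightarrow> real \<Rightarrow> (real \<Rightarrow> real \<Rightarrow> real^'d) \<Rightarrow> (real \<Rightarrow> real \<Rightarrow> real^'d^'d) \<Rightarrow> bool" where
  "rough_path T \<omega> \<beta> X XX \<longleftrightarrow>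
     (\<forall>s u t. 0 \<le> s \<and> s \<le> u \<and> u \<le> t \<and> t \<le> T \<longrightarrow>
        X s t = X s u + X u t \<and> XX s t = XX s u + XX u t + tensor (X s u) (X u t)) \<and>
     holder_norm2 \<omega> \<beta> 0 T X < top \<and> holder_norm2 \<omega> (2 * \<beta>) 0 T XX < top"

text \<open>The conversions to \<^typ>\<open>real\<close> are harmless: both norms of a rough path are finite.\<close>
definition rough_norm ::
    "real \<Rightarrow> (real \<Rightarrow> real \<Rightarrow> real) \<Rightarrow> real \<Rightarrow> (real \<Rightarrow> real \<Rightarrow> real^'d) \<Rightarrow> (real \<Rightarrow> real \<Rightarrow> real^'d^'d) \<Rightarrow> real" where
  "rough_norm T \<omega> \<beta> X XX =
     enn2real (holder_norm2 \<omega> \<beta> 0 T X) + sqrt (enn2real (holder_norm2 \<omega> (2 * \<beta>) 0 T XX))"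

definition rough_norm_tilde ::
    "real \<Rightarrow> (real \<Rightarrow> real \<Rightarrow> real) \<Rightarrow> real \<Rightarrow> (real \<Rightarrow> real \<Rightarrow> real^'d) \<Rightarrow> (real \<Rightarrow> real \<Rightarrow> real^'d^'d) \<Rightarrow> real" where
  "rough_norm_tilde T \<omega> \<beta> X XX = (\<Sum>i=1..3. rough_norm T \<omega> \<beta> X XX ^ i)"

definition remainder ::
    "(real \<Rightarrow> real \<Rightarrow> real^'d) \<Rightarrow> (real \<Rightarrow> real^'n) \<Rightarrow> (real \<Rightarrow> (real^'d) \<Rightarrow>\<^sub>L (real^'n)) \<Rightarrow> real \<Rightarrow> real \<Rightarrow> real^'n" where
  "remainder X Z Z' s t = Z t - Z s - blinfun_apply (Z' s) (X s t)"

definition controlled_paths ::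
    "real \<Rightarrow> (real \<Rightarrow> real \<Rightarrow> real) \<Rightarrow> real \<Rightarrow> (real \<Rightarrow> real \<Rightarrow> real^'d) \<Rightarrow>
      ((real \<Rightarrow> real^'n) \<times> (real \<Rightarrow> (real^'d) \<Rightarrow>\<^sub>L (real^'n))) set" where
  "controlled_paths T \<omega> \<theta> X =
     {(Z, Z'). Z \<in> holder_space T \<omega> \<theta> \<and> Z' \<in> holder_space T \<omega> \<theta> \<and>
               holder_norm2 \<omega> (2 * \<theta>) 0 T (remainder X Z Z') < top}"

text \<open>\<open>young_integral \<Psi> X s t\<close> is \<open>\<integral>\<^sub>s\<^sup>t \<Psi>\<^bsub>s,r\<^esub> \<otimes> dX\<^sub>r\<close>.\<close>
definition young_integral ::
    "(real \<Rightarrow> real^'n) \<Rightarrow> (real \<Rightarrow> real \<Rightarrow> real^'d) \<Rightarrow> real \<Rightarrow> real \<Rightarrow> real^'d^'n" where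
  "young_integral \<Psi> X s t =
     (THE I. has_partition_limit (\<lambda>u v. tensor (\<Psi> u - \<Psi> s) (X u v)) s t I)"

definition partial1 :: "('a::real_normed_vector \<times> 'b::real_normed_vector \<Rightarrow> 'c::real_normed_vector) \<Rightarrow> 'a \<Rightarrow> 'b \<Rightarrow> 'a \<Rightarrow> 'c" where
  "partial1 \<sigma> z w = frechet_derivative (\<lambda>z. \<sigma> (z, w)) (at z)"

definition partial2 :: "('a::real_normed_vector \<times> 'b::real_normed_vector \<Rightarrow> 'c::real_normed_vector) \<Rightarrow> 'a \<Rightarrow> 'b \<Rightarrow> 'b \<Rightarrow> 'c" where
  "partial2 \<sigma> z w = frechet_derivative (\<lambda>w. \<sigma> (z, w)) (at w)"

definition rough_germ ::
    "((real^'n) \<times> (real^'n) \<Rightarrow> (real^'d) \<Rightarrow>\<^sub>L (real^'n)) \<Rightarrow>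
     (real \<Rightarrow> real \<Rightarrow> real^'d) \<Rightarrow> (real \<Rightarrow> real \<Rightarrow> real^'d^'d) \<Rightarrow>
     (real \<Rightarrow> real^'n) \<Rightarrow> (real \<Rightarrow> (real^'d) \<Rightarrow>\<^sub>L (real^'n)) \<Rightarrow> (real \<Rightarrow> real^'n) \<Rightarrow>
     real \<Rightarrow> real \<Rightarrow> real^'n" where
  "rough_germ \<sigma> X XX Z Z' \<Psi> s t =
     blinfun_apply (\<sigma> (Z s, \<Psi> s)) (X s t)
     + tensor_apply (\<lambda>v. blinfun_apply (partial1 \<sigma> (Z s) (\<Psi> s) (blinfun_apply (Z' s) v))) (XX s t)
     + tensor_apply (\<lambda>v. blinfun_apply (partial2 \<sigma> (Z s) (\<Psi> s) v)) (young_integral \<Psi> X s t)"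

definition has_rough_integral ::
    "((real^'n) \<times> (real^'n) \<Rightarrow> (real^'d) \<Rightarrow>\<^sub>L (real^'n)) \<Rightarrow>
     (real \<Rightarrow> real \<Rightarrow> real^'d) \<Rightarrow> (real \<Rightarrow> real \<Rightarrow> real^'d^'d) \<Rightarrow>
     (real \<Rightarrow> real^'n) \<Rightarrow> (real \<Rightarrow> (real^'d) \<Rightarrow>\<^sub>L (real^'n)) \<Rightarrow> (real \<Rightarrow> real^'n) \<Rightarrow>
     real \<Rightarrow> real \<Rightarrow> real^'n \<Rightarrow> bool" where
  "has_rough_integral \<sigma> X XX Z Z' \<Psi> s t I \<longleftrightarrow>
     has_partition_limit (rough_germ \<sigma> X XX Z Z' \<Psi>) s t I"


subsection \<open>The path-dependent rough differential equation\<close>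

definition adapted_map ::
    "real \<Rightarrow> (real \<Rightarrow> 'a) set \<Rightarrow> ((real \<Rightarrow> 'a) \<Rightarrow> real \<Rightarrow> 'b) \<Rightarrow> bool" where
  "adapted_map T S A \<longleftrightarrow>
     (\<forall>t\<in>{0..T}. \<forall>x\<in>S. \<forall>y\<in>S. (\<forall>s\<in>{0..t}. x s = y s) \<longrightarrow> (\<forall>s\<in>{0..t}. A x s = A y s))"

definition continuous_holder_to_sup ::
    "real \<Rightarrow> (real \<Rightarrow> real \<Rightarrow> real) \<Rightarrow> real \<Rightarrow> (real \<Rightarrow> 'a::real_normed_vector) set \<Rightarrow>
     ((real \<Rightarrow> 'a) \<Rightarrow> real \<Rightarrow> 'b::real_normed_vector) \<Rightarrow> bool" where
  "continuous_holder_to_sup T \<omega> \<theta> S A \<longleftrightarrow>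
     (\<forall>x\<in>S. \<forall>\<epsilon>>0. \<exists>\<delta>>0. \<forall>y\<in>S. holder_space_norm T \<omega> \<theta> (\<lambda>t. y t - x t) < ennreal \<delta> \<longrightarrow>
        sup_norm 0 T (\<lambda>t. A y t - A x t) < ennreal \<epsilon>)"

text \<open>
  The hypotheses on \<open>A\<close>, which is a map on \<open>\<C>\<^sup>\<beta>\<close>; \<open>A0\<close> is its extension to \<open>\<C>\<^bsup>\<beta>0\<^esup>\<close>.
  In the last clause the conversion to \<^typ>\<open>real\<close> is harmless, since paths in \<open>\<C>\<^bsup>\<beta>0\<^esup>\<close> have
  finite \<open>1/\<beta>0\<close>-variation.
\<close>
definition admissible_map ::
    "real \<Rightarrow> (real \<Rightarrow> real \<Rightarrow> real) \<Rightarrow> real \<Rightarrow> (real \<Rightarrow> real) \<Rightarrow> real^'n \<Rightarrow>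
     ((real \<Rightarrow> real^'n) \<Rightarrow> real \<Rightarrow> real^'n) \<Rightarrow> bool" where
  "admissible_map T \<omega> \<beta> F \<xi> A \<longleftrightarrow>
     (\<forall>x\<in>holder_space_from T \<omega> \<beta> \<xi>. continuous_on {0..T} (A x)) \<and>
     adapted_map T (holder_space_from T \<omega> \<beta> \<xi>) A \<and>
     (\<exists>\<beta>0 A0. 1/3 < \<beta>0 \<and> \<beta>0 < \<beta> \<and>
        (\<forall>x\<in>holder_space_from T \<omega> \<beta> \<xi>. \<forall>t\<in>{0..T}. A0 x t = A x t) \<and>
        (\<forall>x\<in>holder_space_from T \<omega> \<beta>0 \<xi>. continuous_on {0..T} (A0 x)) \<and>
        continuous_holder_to_sup T \<omega> \<beta>0 (holder_space_from T \<omega> \<beta>0 \<xi>) A0 \<and>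
        (\<forall>x\<in>holder_space_from T \<omega> \<beta>0 \<xi>. \<forall>s t. 0 \<le> s \<and> s \<le> t \<and> t \<le> T \<longrightarrow>
           p_var 1 s t (A0 x) \<le> ennreal (F (enn2real (p_var (1 / \<beta>0) s t x))) * inf_var s t x))"

definition rde_solution ::
    "real \<Rightarrow> (real \<Rightarrow> real \<Rightarrow> real) \<Rightarrow> real \<Rightarrow>
     ((real^'n) \<times> (real^'n) \<Rightarrow> (real^'d) \<Rightarrow>\<^sub>L (real^'n)) \<Rightarrow>
     (real \<Rightarrow> real \<Rightarrow> real^'d) \<Rightarrow> (real \<Rightarrow> real \<Rightarrow> real^'d^'d) \<Rightarrow> real^'n \<Rightarrow>
     ((real \<Rightarrow> real^'n) \<Rightarrow> real \<Rightarrow> real^'n) \<Rightarrow>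
     (real \<Rightarrow> real^'n) \<Rightarrow> (real \<Rightarrow> (real^'d) \<Rightarrow>\<^sub>L (real^'n)) \<Rightarrow> bool" where
  "rde_solution T \<omega> \<beta> \<sigma> X XX \<xi> A Z Z' \<longleftrightarrow>
     (Z, Z') \<in> controlled_paths T \<omega> \<beta> X \<and>
     (\<forall>t\<in>{0..T}. (\<exists>I. has_rough_integral \<sigma> X XX Z Z' (A Z) 0 t I \<and> Z t = \<xi> + I) \<and>
                  Z' t = \<sigma> (Z t, A Z t))"

end

theory Submission
  imports Defs "HOL-Complex_Analysis.Great_Picard"
begin

text \<open>
  Rescaling the control by the norm of \<open>\<bbbX>\<close> normalises the driver, so that constants
  depend on \<open>\<sigma>, \<beta>, \<gamma>, F\<close> only.  Since \<open>A(Z)\<close> has bounded variation, the germ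
  \<open>\<sigma>(Z, A(Z)) X + (D\<^sub>1\<sigma>) \<sigma> \<bbbX>\<close> (without the Young integral) has a defect bounded by
  \<open>\<omega>\<^sup>q + V \<omega>\<^sup>\<beta>\<close> with \<open>q > 1\<close> and \<open>V\<close> the variation of \<open>A(Z)\<close>, and Young's point removal argument
  applies.  If the remainder of \<open>Z\<close> is of order \<open>\<omega>\<^bsup>2\<beta>\<^esup>\<close> on scale \<open>h\<close>, sewing replaces its constant by a
  universal one, and this universal bound can be propagated from scale \<open>h\<close> to \<open>2h\<close> as long as \<open>h\<close>
  stays below a universal threshold.  Halving intervals then gives the bound on \<open>[0, T]\<close>: on large
  intervals \<open>V\<close> is controlled by its subadditivity, so \<open>F\<close> is only evaluated at bounded arguments.

  The argument works verbatim on a grid, hence the Euler schemes, which are well defined because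
  \<open>A\<close> is adapted, are bounded in \<open>\<C>\<^sup>\<beta>\<close> uniformly in the mesh.  By Arzela-Ascoli and interpolation a
  subsequence converges in \<open>\<C>\<^bsup>\<beta>0\<^esup>\<close>, where \<open>A\<close> is continuous, and the limit is a solution.
\<close>

section \<open>Controls and the sewing estimate\<close>

text \<open>\<open>A\<close> has no Lipschitz property, so neither contraction nor uniqueness is at
  hand, and the estimate must hold for every solution and every scheme, of which only finiteness is
  known beforehand. The difficulty is circular: sewing needs a constant \<open>r\<close> for the
  remainder of \<open>Z\<close> in order to produce one. It is resolved because the constant
  produced at scale \<open>h\<close> depends on \<open>r\<close> only through
  \<open>r * h powr \<beta>\<close>. A finite \<open>r\<close> of any size is thus forgotten after
  one sewing at a tiny scale. Doubling the scale by the triangle inequality spoils \<open>r\<close>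
  to a multiple of \<open>h powr (- \<beta>)\<close>, which is again admissible: nothing is lost,
  however many doublings are made. A second obstacle is that bounding the variation of A(Z) by
  w^\<beta> gives its share of the defect the order 2\<beta> \<le> 1, which cannot be sewn. The
  variation is therefore carried along as a second control and compared with \<open>w\<close> only
  after sewing. Controls live on arbitrary sets of times, so that a grid is treated like an
  interval; where a grid lacks midpoints or intermediate times, the explicit form of the scheme
  within one cell takes over.\<close>

definition superadditive_on :: "real set \<Rightarrow> (real \<Rightarrow> real \<Rightarrow> real) \<Rightarrow> bool" where
  "superadditive_on D f \<longleftrightarrow>
     (\<forall>u\<in>D. \<forall>v\<in>D. u \<le> v \<longrightarrow> 0 \<le> f u v) \<and>
     (\<forall>u\<in>D. \<forall>w\<in>D. \<forall>v\<in>D. u \<le> w \<and> w \<le> v \<longrightarrow> f u w + f w v \<le> f u v)"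

text \<open>Repeated points are allowed, since rounding the points of a partition down to a grid may
  identify some of them.\<close>

definition chain :: "real set \<Rightarrow> (nat \<Rightarrow> real) \<Rightarrow> nat \<Rightarrow> bool" where
  "chain D t n \<longleftrightarrow> (\<forall>i\<le>n. t i \<in> D) \<and> (\<forall>i<n. t i \<le> t (Suc i))"

lemma superadditive_on_subset:
  "superadditive_on D f \<Longrightarrow> D' \<subseteq> D \<Longrightarrow> superadditive_on D' f"
  unfolding superadditive_on_def by (meson subsetD)

lemma superadditive_on_nonneg:
  "superadditive_on D f \<Longrightarrow> u \<in> D \<Longrightarrow> v \<in> D \<Longrightarrow> u \<le> v \<Longrightarrow> 0 \<le> f u v"
  unfolding superadditive_on_def by blast

lemma superadditive_onD:
  "superadditive_on D f \<Longrightarrow> u \<in> D \<Longrightarrow> w \<in> D \<Longrightarrow> v \<in> D \<Longrightarrow> u \<le> w \<Longrightarrow> w \<le> v \<Longrightarrow> f u w + f w v \<le> f u v"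
  unfolding superadditive_on_def by blast

lemma superadditive_on_mono:
  assumes "superadditive_on D f" "u \<in> D" "u' \<in> D" "v' \<in> D" "v \<in> D" "u \<le> u'" "u' \<le> v'" "v' \<le> v"
  shows "f u' v' \<le> f u v"
  using superadditive_onD[OF assms(1,2,3,5)] superadditive_onD[OF assms(1,3,4,5)]
    superadditive_on_nonneg[OF assms(1,2,3)] superadditive_on_nonneg[OF assms(1,4,5)] assms
  by linarith

lemma superadditive_on_refl:
  assumes "superadditive_on D f" "u \<in> D"
  shows "f u u = 0"
  using superadditive_onD[OF assms(1) assms(2) assms(2) assms(2)]
    superadditive_on_nonneg[OF assms(1) assms(2) assms(2)] by linarith

lemma superadditive_on_linear:
  assumes "superadditive_on D f" "superadditive_on D g" "0 \<le> a" "0 \<le> b"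
  shows "superadditive_on D (\<lambda>u v. a * f u v + b * g u v)"
proof -
  have "a * f u w + b * g u w + (a * f w v + b * g w v) \<le> a * f u v + b * g u v"
    if "u \<in> D" "w \<in> D" "v \<in> D" "u \<le> w" "w \<le> v" for u w v
    using mult_left_mono[OF superadditive_onD[OF assms(1) that] assms(3)]
      mult_left_mono[OF superadditive_onD[OF assms(2) that] assms(4)]
    by (simp add: algebra_simps)
  then show ?thesis
    using superadditive_on_nonneg[OF assms(1)] superadditive_on_nonneg[OF assms(2)] assms(3,4)
    unfolding superadditive_on_def by (metis add_nonneg_nonneg mult_nonneg_nonneg)
qed

lemma chain_mono:
  assumes "chain D t n" "i \<le> j" "j \<le> n"
  shows "t i \<le> t j"
  using assms(2,3)
proof (induction j rule: dec_induct)
  case (step k)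
  then have "t i \<le> t k" "t k \<le> t (Suc k)" using assms(1) by (auto simp: chain_def)
  then show ?case by simp
qed simp

lemma chain_in: "chain D t n \<Longrightarrow> i \<le> n \<Longrightarrow> t i \<in> D"
  by (simp add: chain_def)

lemma sum_superadditive_chain:
  assumes "superadditive_on D f" "chain D t n"
  shows "(\<Sum>i<n. f (t i) (t (Suc i))) \<le> f (t 0) (t n)"
  using assms(2)
proof (induction n)
  case 0
  then show ?case using superadditive_on_nonneg[OF assms(1)] by (simp add: chain_def)
next
  case (Suc n)
  have "chain D t n" using Suc.prems by (simp add: chain_def)
  moreover have "f (t 0) (t n) + f (t n) (t (Suc n)) \<le> f (t 0) (t (Suc n))"
    by (rule superadditive_onD[OF assms(1)]) (use Suc.prems chain_mono[OF Suc.prems] in \<open>auto simp: chain_in\<close>)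
  ultimately show ?case using Suc.IH by simp
qed

lemma sum_superadditive_overlapping:
  assumes "superadditive_on D f" "chain D t (Suc n)"
  shows "(\<Sum>i<n. f (t i) (t (Suc (Suc i)))) \<le> 2 * f (t 0) (t (Suc n))"
proof -
  \<comment> \<open>The intervals of even and of odd index form two chains of adjacent intervals,
    ending at \<open>t n\<close> and \<open>t (Suc n)\<close>; in the induction the new interval
    extends the chain that ended at \<open>t n\<close>.\<close>
  have "(\<Sum>i<n. f (t i) (t (Suc (Suc i)))) \<le> f (t 0) (t n) + f (t 0) (t (Suc n))"
    using assms(2)
  proof (induction n)
    case 0
    then show ?case
      using superadditive_on_nonneg[OF assms(1)] by (simp add: chain_def)
  next
    case (Suc n)
    have "chain D t (Suc n)" using Suc.prems by (simp add: chain_def)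
    moreover have "f (t 0) (t n) + f (t n) (t (Suc (Suc n))) \<le> f (t 0) (t (Suc (Suc n)))"
      by (rule superadditive_onD[OF assms(1)]) (use Suc.prems chain_mono[OF Suc.prems] in \<open>auto simp: chain_in\<close>)
    ultimately show ?case using Suc.IH by simp
  qed
  moreover have "f (t 0) (t n) \<le> f (t 0) (t (Suc n))"
    by (rule superadditive_on_mono[OF assms(1)]) (use chain_mono[OF assms(2)] chain_in[OF assms(2)] in auto)
  ultimately show ?thesis by linarith
qed

text \<open>With \<open>x / 0 = 0\<close> the sum of the two normalised controls is a control of total mass at most 2.\<close>
lemma small_consecutive_pair:
  assumes \<omega>: "superadditive_on D \<omega>" and V: "superadditive_on D V" and t: "chain D t (Suc (Suc n))"
  obtains k where "k < Suc n"
    "\<omega> (t k) (t (Suc (Suc k))) \<le> 4 / real (Suc n) * \<omega> (t 0) (t (Suc (Suc n)))"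
    "V (t k) (t (Suc (Suc k))) \<le> 4 / real (Suc n) * V (t 0) (t (Suc (Suc n)))"
proof -
  define W where "W = \<omega> (t 0) (t (Suc (Suc n)))"
  define U where "U = V (t 0) (t (Suc (Suc n)))"
  define \<phi> where "\<phi> u v = (1 / W) * \<omega> u v + (1 / U) * V u v" for u v
  have 0: "t 0 \<in> D" "t (Suc (Suc n)) \<in> D" "t 0 \<le> t (Suc (Suc n))"
    using chain_mono[OF t] chain_in[OF t] by auto
  then have nn: "0 \<le> W" "0 \<le> U"
    using superadditive_on_nonneg[OF \<omega>] superadditive_on_nonneg[OF V] by (auto simp: W_def U_def)
  have \<phi>: "superadditive_on D \<phi>"
    unfolding \<phi>_def by (rule superadditive_on_linear[OF \<omega> V]) (use nn in auto)
  have "\<phi> (t 0) (t (Suc (Suc n))) \<le> 2"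
    by (simp add: \<phi>_def W_def[symmetric] U_def[symmetric])
  then have le: "(\<Sum>i<Suc n. \<phi> (t i) (t (Suc (Suc i)))) \<le> 4"
    using sum_superadditive_overlapping[OF \<phi> t] by linarith
  have "\<exists>k<Suc n. \<phi> (t k) (t (Suc (Suc k))) \<le> 4 / real (Suc n)"
  proof (rule ccontr)
    assume "\<not> ?thesis"
    then have "(\<Sum>i<Suc n. 4 / real (Suc n)) < (\<Sum>i<Suc n. \<phi> (t i) (t (Suc (Suc i))))"
      by (intro sum_strict_mono) (auto simp: not_le)
    moreover have "(\<Sum>i<Suc n. 4 / real (Suc n)) = 4"
      by (simp del: of_nat_Suc sum.lessThan_Suc)
    ultimately show False using le by linarith
  qed
  then obtain k where k: "k < Suc n" "\<phi> (t k) (t (Suc (Suc k))) \<le> 4 / real (Suc n)" by blast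
  have tk: "t k \<in> D" "t (Suc (Suc k)) \<in> D" "t 0 \<le> t k" "t k \<le> t (Suc (Suc k))"
    "t (Suc (Suc k)) \<le> t (Suc (Suc n))"
    using chain_mono[OF t] chain_in[OF t] k(1) by auto
  have wk: "0 \<le> \<omega> (t k) (t (Suc (Suc k)))" "\<omega> (t k) (t (Suc (Suc k))) \<le> W"
    using tk 0 superadditive_on_nonneg[OF \<omega>] superadditive_on_mono[OF \<omega>] by (auto simp: W_def)
  have vk: "0 \<le> V (t k) (t (Suc (Suc k)))" "V (t k) (t (Suc (Suc k))) \<le> U"
    using tk 0 superadditive_on_nonneg[OF V] superadditive_on_mono[OF V] by (auto simp: U_def)
  have *: "a \<le> 4 / real (Suc n) * b" if "0 \<le> a" "a \<le> b" "1 / b * a \<le> 4 / real (Suc n)" for a b :: real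
  proof (cases "b = 0")
    case False
    then have "0 < b" using that by linarith
    then show ?thesis using that(3) by (simp add: divide_le_eq mult.commute)
  qed (use that in auto)
  have "1 / W * \<omega> (t k) (t (Suc (Suc k))) \<le> 4 / real (Suc n)" "1 / U * V (t k) (t (Suc (Suc k))) \<le> 4 / real (Suc n)"
    using k(2) nn wk(1) vk(1) unfolding \<phi>_def
    by (smt (verit) divide_nonneg_nonneg mult_nonneg_nonneg)+
  then show ?thesis
    using *[OF wk] *[OF vk] k(1) that by (simp add: W_def U_def)
qed

text \<open>This is 4^q \<zeta>(q). The 4 is the multiplicity 2 of overlapping pairs of intervals
  times the total mass, at most 2, of the sum of two normalised controls.\<close>

definition sew_const :: "real \<Rightarrow> real" where
  "sew_const q = (\<Sum>n. (4 / real (Suc n)) powr q)"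

lemma summable_sew_const: "1 < q \<Longrightarrow> summable (\<lambda>n. (4 / real (Suc n)) powr q)"
proof -
  assume q: "1 < q"
  have "summable (\<lambda>n. 4 powr q * (real (Suc n)) powr (- q))"
    by (intro summable_mult) (use q summable_real_powr_iff[of "-q"] summable_Suc_iff[of "\<lambda>n. real n powr (-q)"] in simp)
  then show ?thesis
    by (rule summable_cong[THEN iffD1, rotated])
       (auto intro!: always_eventually simp: powr_divide powr_minus_divide)
qed

lemma sum_le_sew_const: "1 < q \<Longrightarrow> (\<Sum>k<n. (4 / real (Suc k)) powr q) \<le> sew_const q"
  unfolding sew_const_def by (rule sum_le_suminf[OF summable_sew_const]) auto

lemma sew_const_nonneg: "1 < q \<Longrightarrow> 0 \<le> sew_const q"
  using sum_le_sew_const[of q 0] by simp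

lemma sum_remove_point:
  fixes G :: "real \<Rightarrow> real \<Rightarrow> 'a::ab_group_add"
  assumes "k \<le> n" "t' = (\<lambda>i. if i \<le> k then t i else t (Suc i))"
  shows "(\<Sum>i<Suc (Suc n). G (t i) (t (Suc i))) =
    (\<Sum>i<Suc n. G (t' i) (t' (Suc i))) +
      (G (t k) (t (Suc k)) + G (t (Suc k)) (t (Suc (Suc k))) - G (t k) (t (Suc (Suc k))))"
  using assms(1)
proof (induction n rule: dec_induct)
  case base
  have "(\<Sum>i<k. G (t' i) (t' (Suc i))) = (\<Sum>i<k. G (t i) (t (Suc i)))"
    by (intro sum.cong) (auto simp: assms(2))
  then show ?case by (simp add: assms(2))
next
  case (step n)
  then show ?case by (simp add: assms(2))
qed

lemma chain_remove_point:
  assumes "chain D t (Suc n)" "k < n"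
  shows "chain D (\<lambda>i. if i \<le> k then t i else t (Suc i)) n"
proof -
  have "t i \<le> t j" if "i \<le> j" "j \<le> Suc n" for i j
    using chain_mono[OF assms(1) that] .
  then show ?thesis using assms unfolding chain_def by auto
qed

text \<open>Removing an interior point changes the sum by one defect, and the point is chosen where
  both controls are small at once. Passing from n + 2 to n + 1 intervals costs a factor (4/(n+1))^q
  on the pure term and, as \<open>V\<close> and \<open>\<omega>\<close> shrink together,
  (4/(n+1))^(1+b) on the mixed one. The end points never move, so all costs are measured against the
  same total masses.\<close>

lemma sewing_finite:
  fixes G :: "real \<Rightarrow> real \<Rightarrow> 'a::real_normed_vector"
  assumes \<omega>: "superadditive_on D \<omega>" and V: "superadditive_on D V"
    and K: "0 \<le> K1" "0 \<le> K2" and q: "0 \<le> q" and b: "0 \<le> b"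
    and G: "\<And>u w v. u \<in> D \<Longrightarrow> w \<in> D \<Longrightarrow> v \<in> D \<Longrightarrow> u \<le> w \<Longrightarrow> w \<le> v \<Longrightarrow>
       norm (G u v - G u w - G w v) \<le> K1 * \<omega> u v powr q + K2 * (V u v * \<omega> u v powr b)"
    and t: "chain D t (Suc n)"
  shows "norm ((\<Sum>i<Suc n. G (t i) (t (Suc i))) - G (t 0) (t (Suc n)))
    \<le> (\<Sum>k<n. (4 / real (Suc k)) powr q) * (K1 * \<omega> (t 0) (t (Suc n)) powr q)
      + (\<Sum>k<n. (4 / real (Suc k)) powr (1 + b)) * (K2 * (V (t 0) (t (Suc n)) * \<omega> (t 0) (t (Suc n)) powr b))"
  using t
proof (induction n arbitrary: t)
  case 0
  then show ?case by simp
next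
  case (Suc n)
  define W where "W = \<omega> (t 0) (t (Suc (Suc n)))"
  define U where "U = V (t 0) (t (Suc (Suc n)))"
  obtain k where k: "k < Suc n" "\<omega> (t k) (t (Suc (Suc k))) \<le> 4 / real (Suc n) * W"
    "V (t k) (t (Suc (Suc k))) \<le> 4 / real (Suc n) * U"
    using small_consecutive_pair[OF \<omega> V Suc.prems] unfolding W_def U_def by blast
  have tk: "t k \<in> D" "t (Suc k) \<in> D" "t (Suc (Suc k)) \<in> D" "t k \<le> t (Suc k)" "t (Suc k) \<le> t (Suc (Suc k))"
    using chain_mono[OF Suc.prems] chain_in[OF Suc.prems] k(1) by auto
  have WU: "0 \<le> W" "0 \<le> U"
    using chain_mono[OF Suc.prems] chain_in[OF Suc.prems] superadditive_on_nonneg[OF \<omega>] superadditive_on_nonneg[OF V]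
    by (auto simp: W_def U_def)
  have nn: "0 \<le> \<omega> (t k) (t (Suc (Suc k)))" "0 \<le> V (t k) (t (Suc (Suc k)))"
    using tk superadditive_on_nonneg[OF \<omega>] superadditive_on_nonneg[OF V] by auto
  define t' where "t' = (\<lambda>i. if i \<le> k then t i else t (Suc i))"
  have t': "chain D t' (Suc n)" unfolding t'_def by (rule chain_remove_point[OF Suc.prems k(1)])
  have ends: "t' 0 = t 0" "t' (Suc n) = t (Suc (Suc n))" using k(1) by (auto simp: t'_def)
  let ?d = "G (t k) (t (Suc (Suc k))) - G (t k) (t (Suc k)) - G (t (Suc k)) (t (Suc (Suc k)))"
  have "norm ?d \<le> K1 * \<omega> (t k) (t (Suc (Suc k))) powr q
      + K2 * (V (t k) (t (Suc (Suc k))) * \<omega> (t k) (t (Suc (Suc k))) powr b)"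
    by (rule G) (use tk in auto)
  also have "\<dots> \<le> K1 * (4 / real (Suc n) * W) powr q
      + K2 * ((4 / real (Suc n) * U) * (4 / real (Suc n) * W) powr b)"
  proof -
    have "\<omega> (t k) (t (Suc (Suc k))) powr q \<le> (4 / real (Suc n) * W) powr q"
      "\<omega> (t k) (t (Suc (Suc k))) powr b \<le> (4 / real (Suc n) * W) powr b"
      using powr_mono2[OF q nn(1) k(2)] powr_mono2[OF b nn(1) k(2)] .
    moreover have "V (t k) (t (Suc (Suc k))) * \<omega> (t k) (t (Suc (Suc k))) powr b
        \<le> (4 / real (Suc n) * U) * (4 / real (Suc n) * W) powr b"
      by (rule mult_mono[OF k(3) calculation(2)]) (use WU in auto)
    ultimately show ?thesis
      by (intro add_mono mult_left_mono K)
  qed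
  also have "\<dots> = (4 / real (Suc n)) powr q * (K1 * W powr q)
      + (4 / real (Suc n)) powr (1 + b) * (K2 * (U * W powr b))"
  proof -
    have *: "K1 * (c * W) powr q + K2 * ((c * U) * (c * W) powr b)
      = c powr q * (K1 * W powr q) + c powr (1 + b) * (K2 * (U * W powr b))" if "0 < c" for c
      using that WU(1) by (simp add: powr_mult powr_add algebra_simps)
    show ?thesis by (rule *) simp
  qed
  finally have d: "norm ?d \<le> \<dots>" .
  have "(\<Sum>i<Suc (Suc n). G (t i) (t (Suc i))) - G (t 0) (t (Suc (Suc n))) =
     ((\<Sum>i<Suc n. G (t' i) (t' (Suc i))) - G (t' 0) (t' (Suc n))) - ?d"
    unfolding ends using sum_remove_point[OF _ t'_def, of n G] k(1) by simp
  then have "norm ((\<Sum>i<Suc (Suc n). G (t i) (t (Suc i))) - G (t 0) (t (Suc (Suc n)))) \<le>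
     norm ((\<Sum>i<Suc n. G (t' i) (t' (Suc i))) - G (t' 0) (t' (Suc n))) + norm ?d"
    by (simp only: norm_triangle_ineq4)
  also note add_mono[OF Suc.IH[OF t'] d]
  finally show ?case
    unfolding ends W_def[symmetric] U_def[symmetric]
      sum.lessThan_Suc[of "\<lambda>k. (4 / real (Suc k)) powr q" n]
      sum.lessThan_Suc[of "\<lambda>k. (4 / real (Suc k)) powr (1 + b)" n] distrib_right
    by linarith
qed

lemma sewing_estimate:
  fixes G :: "real \<Rightarrow> real \<Rightarrow> 'a::real_normed_vector"
  assumes \<omega>: "superadditive_on D \<omega>" and V: "superadditive_on D V"
    and K: "0 \<le> K1" "0 \<le> K2" and q: "1 < q" and b: "0 < b"
    and G: "\<And>u w v. u \<in> D \<Longrightarrow> w \<in> D \<Longrightarrow> v \<in> D \<Longrightarrow> u \<le> w \<Longrightarrow> w \<le> v \<Longrightarrow>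
       norm (G u v - G u w - G w v) \<le> K1 * \<omega> u v powr q + K2 * (V u v * \<omega> u v powr b)"
    and G0: "\<And>u. u \<in> D \<Longrightarrow> G u u = 0"
    and t: "chain D t n"
  shows "norm ((\<Sum>i<n. G (t i) (t (Suc i))) - G (t 0) (t n))
    \<le> sew_const q * (K1 * \<omega> (t 0) (t n) powr q)
      + sew_const (1 + b) * (K2 * (V (t 0) (t n) * \<omega> (t 0) (t n) powr b))"
proof -
  have nn: "0 \<le> V (t 0) (t n)"
    using chain_mono[OF t] chain_in[OF t] superadditive_on_nonneg[OF V] by auto
  show ?thesis
  proof (cases n)
    \<comment> \<open>With a single point the sum is empty and the claim concerns
      \<open>G (t 0) (t 0)\<close>, which \<open>G0\<close> makes 0.\<close>
    case 0
    then show ?thesis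
      using G0 chain_in[OF t] nn K sew_const_nonneg[of q] sew_const_nonneg[of "1+b"] q b by simp
  next
    case (Suc m)
    have "norm ((\<Sum>i<n. G (t i) (t (Suc i))) - G (t 0) (t n))
      \<le> (\<Sum>k<m. (4 / real (Suc k)) powr q) * (K1 * \<omega> (t 0) (t n) powr q)
      + (\<Sum>k<m. (4 / real (Suc k)) powr (1 + b)) * (K2 * (V (t 0) (t n) * \<omega> (t 0) (t n) powr b))"
      unfolding Suc by (rule sewing_finite[OF \<omega> V K]) (use q b G t in \<open>auto simp: Suc\<close>)
    also have "\<dots> \<le> sew_const q * (K1 * \<omega> (t 0) (t n) powr q)
      + sew_const (1 + b) * (K2 * (V (t 0) (t n) * \<omega> (t 0) (t n) powr b))"
      using nn K q b by (intro add_mono mult_right_mono sum_le_sew_const) auto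
    finally show ?thesis .
  qed
qed

section \<open>Partitions\<close>

lemma partition_sum_Nil [simp]: "partition_sum G [] = 0"
  and partition_sum_single [simp]: "partition_sum G [a] = 0"
  by (simp_all add: partition_sum_def)

lemma partition_sum_Cons [simp]:
  "partition_sum G (a # b # xs) = G a b + partition_sum G (b # xs)"
  unfolding partition_sum_def by (simp add: sum.lessThan_Suc_shift del: sum.lessThan_Suc)

lemma partition_sum_append:
  "partition_sum G (xs @ b # ys) = partition_sum G (xs @ [b]) + partition_sum G (b # ys)"
proof (induction xs)
  case (Cons a xs)
  then show ?case by (cases xs) (auto simp: add.assoc)
qed simp

lemma mesh_less_Nil [simp]: "mesh_less [] \<delta>" and mesh_less_single [simp]: "mesh_less [a] \<delta>"
  by (simp_all add: mesh_less_def)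

lemma mesh_less_Cons [simp]:
  "mesh_less (a # b # xs) \<delta> \<longleftrightarrow> b - a < \<delta> \<and> mesh_less (b # xs) \<delta>"
  unfolding mesh_less_def by (auto simp: less_Suc_eq_0_disj)

lemma mesh_less_append:
  "mesh_less (xs @ b # ys) \<delta> \<longleftrightarrow> mesh_less (xs @ [b]) \<delta> \<and> mesh_less (b # ys) \<delta>"
proof (induction xs)
  case (Cons a xs)
  then show ?case by (cases xs) auto
qed simp

lemma mesh_less_mono: "mesh_less ts \<delta> \<Longrightarrow> \<delta> \<le> \<delta>' \<Longrightarrow> mesh_less ts \<delta>'"
  unfolding mesh_less_def by fastforce

lemma partitions_le: "ts \<in> partitions s t \<Longrightarrow> s \<le> t"
  unfolding partitions_def by (cases ts) (auto simp: less_imp_le)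

lemma partitions_set:
  assumes "ts \<in> partitions s t"
  shows "set ts \<subseteq> {s..t}"
proof
  fix x assume x: "x \<in> set ts"
  have *: "sorted_wrt (<) ts" "hd ts = s" "last ts = t" "ts \<noteq> []" using assms by (auto simp: partitions_def)
  obtain ys zs where ts: "ts = ys @ x # zs" using x by (meson split_list)
  have "s \<le> x" using * unfolding ts by (cases ys) (auto simp: sorted_wrt_append less_imp_le)
  moreover have "x \<le> t" using * unfolding ts
    by (cases zs rule: rev_cases) (auto simp: sorted_wrt_append less_imp_le)
  ultimately show "x \<in> {s..t}" by simp
qed

lemma partitions_nonempty:
  assumes "s \<le> t"
  shows "\<exists>ts\<in>partitions s t. True"
proof (cases "s = t")
  case True
  then have "[s] \<in> partitions s t" by (simp add: partitions_def)
  then show ?thesis by blast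
next
  case False
  then have "[s, t] \<in> partitions s t" using assms by (simp add: partitions_def)
  then show ?thesis by blast
qed

lemma partitions_append:
  assumes "ts \<in> partitions s u" "us \<in> partitions u t"
  shows "ts @ tl us \<in> partitions s t"
    and "partition_sum G (ts @ tl us) = partition_sum G ts + partition_sum G us"
    and "mesh_less (ts @ tl us) \<delta> \<longleftrightarrow> mesh_less ts \<delta> \<and> mesh_less us \<delta>"
proof -
  obtain xs where ts: "ts = xs @ [u]" using assms(1) unfolding partitions_def
    by (metis (mono_tags, lifting) append_butlast_last_id mem_Collect_eq)
  obtain ys where us: "us = u # ys" using assms(2) unfolding partitions_def
    by (cases us) auto
  have eq: "ts @ tl us = xs @ u # ys" by (simp add: ts us)
  have "sorted_wrt (<) (xs @ u # ys)"
    using assms unfolding partitions_def ts us by (auto simp: sorted_wrt_append) force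
  moreover have "hd (xs @ u # ys) = s" "last (xs @ u # ys) = t"
    using assms unfolding partitions_def ts us by (auto simp: hd_append)
  ultimately show "ts @ tl us \<in> partitions s t" unfolding eq partitions_def by auto
  show "partition_sum G (ts @ tl us) = partition_sum G ts + partition_sum G us"
    unfolding eq by (subst partition_sum_append) (simp add: ts us)
  show "mesh_less (ts @ tl us) \<delta> \<longleftrightarrow> mesh_less ts \<delta> \<and> mesh_less us \<delta>"
    unfolding eq by (subst mesh_less_append) (simp add: ts us)
qed

lemma partitions_fine:
  assumes "s \<le> t" "0 < \<delta>"
  shows "\<exists>ts\<in>partitions s t. mesh_less ts \<delta>"
proof (cases "s = t")
  case True
  then have "[s] \<in> partitions s t" by (simp add: partitions_def)
  then show ?thesis by force
next
  case False
  obtain n where n: "(t - s) / \<delta> < real n" using reals_Archimedean2 by blast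
  have "0 \<le> (t - s) / \<delta>" using assms by simp
  then have "0 < real n" using n by linarith
  then have pos: "0 < n" by simp
  define p where "p i = s + real i * ((t - s) / real n)" for i
  define ts where "ts = map p [0..<Suc n]"
  have "0 < (t - s) / real n" using False assms pos by simp
  then have "p i < p j" if "i < j" for i j using that mult_strict_right_mono[of "real i" "real j" "(t - s) / real n"] unfolding p_def by (simp del: times_divide_eq_right)
  then have "sorted_wrt (<) ts" unfolding ts_def sorted_wrt_map by (simp add: sorted_wrt_iff_nth_less del: upt_Suc)
  moreover have "hd ts = s" "last ts = t" "ts \<noteq> []"
    using pos by (auto simp: ts_def p_def hd_map last_map simp del: upt_Suc)
  ultimately have "ts \<in> partitions s t" unfolding partitions_def by blast
  moreover have "p (Suc i) - p i < \<delta>" for i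
  proof -
    have "p (Suc i) - p i = (t - s) / real n" by (simp add: p_def algebra_simps flip: add_divide_distrib diff_divide_distrib)
    also have "\<dots> < \<delta>" using n pos assms by (simp add: divide_less_eq mult.commute)
    finally show ?thesis .
  qed
  then have "mesh_less ts \<delta>" unfolding mesh_less_def ts_def by (auto simp del: upt_Suc)
  ultimately show ?thesis by blast
qed

lemma partition_chain:
  assumes "ts \<in> partitions s t"
  shows "chain {s..t} (\<lambda>i. ts ! i) (length ts - 1)" "ts ! 0 = s" "ts ! (length ts - 1) = t"
proof -
  have *: "sorted_wrt (<) ts" "hd ts = s" "last ts = t" "ts \<noteq> []" using assms by (auto simp: partitions_def)
  show "ts ! 0 = s" "ts ! (length ts - 1) = t" using * by (auto simp: hd_conv_nth last_conv_nth)
  have "ts ! i \<in> {s..t}" if "i \<le> length ts - 1" for i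
  proof -
    have "i < length ts" using that *(4) by (cases ts) auto
    then have "ts ! i \<in> set ts" by simp
    then show ?thesis using partitions_set[OF assms] by blast
  qed
  moreover have "ts ! i \<le> ts ! Suc i" if "i < length ts - 1" for i
    using * that by (intro less_imp_le) (simp add: sorted_wrt_iff_nth_less)
  ultimately show "chain {s..t} (\<lambda>i. ts ! i) (length ts - 1)" unfolding chain_def by blast
qed

lemma partition_cases2:
  assumes "a # P \<in> partitions s t" "P = b # P'"
  shows "a = s" "s < b" "P \<in> partitions b t"
  using assms unfolding partitions_def by auto

text \<open>Cutting \<open>Q\<close> at the points of \<open>P\<close> gives a partition of each
  interval of \<open>P\<close>, so the difference is a sum of local ones; \<open>P\<close> is peeled
  off interval by interval.\<close>

lemma norm_partition_sum_refine:
  fixes G :: "real \<Rightarrow> real \<Rightarrow> 'a::real_normed_vector"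
  assumes "P \<in> partitions s t" "Q \<in> partitions s t" "set P \<subseteq> set Q"
    and "\<And>a b Q'. s \<le> a \<Longrightarrow> b \<le> t \<Longrightarrow> Q' \<in> partitions a b \<Longrightarrow> norm (partition_sum G Q' - G a b) \<le> e a b"
  shows "norm (partition_sum G Q - partition_sum G P) \<le> partition_sum e P"
  using assms
proof (induction P arbitrary: Q s)
  case Nil
  then show ?case by (simp add: partitions_def)
next
  case (Cons a P)
  show ?case
  proof (cases P)
    case Nil
    then have "s = t" using Cons.prems(1) by (auto simp: partitions_def)
    then have "set Q \<subseteq> {s}" using partitions_set[OF Cons.prems(2)] by simp
    moreover have "distinct Q" "Q \<noteq> []"
      using Cons.prems(2) by (auto simp: partitions_def strict_sorted_iff)
    ultimately have "length Q \<le> 1" using card_mono[of "{s}" "set Q"] by (simp add: distinct_card)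
    then have "partition_sum G Q = 0" by (simp add: partition_sum_def)
    then show ?thesis using Nil by simp
  next
    case (Cons b P')
    note P = partition_cases2[OF Cons.prems(1) Cons]
    have bQ: "b \<in> set Q" using Cons.prems(3) Cons by simp
    then obtain ys zs where Q: "Q = ys @ b # zs" by (meson split_list)
    have ys: "ys \<noteq> []" using Cons.prems(2) P(2) Q by (cases ys) (auto simp: partitions_def)
    have Q1: "ys @ [b] \<in> partitions s b" and Q2: "b # zs \<in> partitions b t"
      using Cons.prems(2) ys unfolding Q partitions_def by (auto simp: sorted_wrt_append)
    have "set P \<subseteq> set (b # zs)"
    proof
      fix x assume x: "x \<in> set P"
      then have "x \<in> set Q" "b \<le> x" using Cons.prems(3) partitions_set[OF P(3)] by auto
      moreover have "y < b" if "y \<in> set ys" for y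
        using Cons.prems(2) that unfolding Q partitions_def by (auto simp: sorted_wrt_append)
      ultimately show "x \<in> set (b # zs)" unfolding Q by force
    qed
    then have "norm (partition_sum G (b # zs) - partition_sum G P) \<le> partition_sum e P"
      using Cons.IH[OF P(3) Q2] Cons.prems(4) P(2) by fastforce
    moreover have "norm (partition_sum G (ys @ [b]) - G s b) \<le> e s b"
      using Cons.prems(4)[OF _ _ Q1] partitions_le[OF P(3)] by simp
    moreover have "partition_sum G Q - partition_sum G (a # P) =
      (partition_sum G (ys @ [b]) - G s b) + (partition_sum G (b # zs) - partition_sum G P)"
      unfolding Q using P(1) Cons by (subst partition_sum_append) simp
    ultimately have "norm (partition_sum G Q - partition_sum G (a # P)) \<le> e s b + partition_sum e P"
      by (metis add_mono norm_triangle_le)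
    then show ?thesis using P(1) Cons by simp
  qed
qed

lemma partitions_common_refinement:
  assumes "P \<in> partitions s t" "P' \<in> partitions s t"
  obtains Q where "Q \<in> partitions s t" "set P \<subseteq> set Q" "set P' \<subseteq> set Q"
proof -
  define Q where "Q = sorted_list_of_set (set P \<union> set P')"
  have set: "set Q = set P \<union> set P'" by (simp add: Q_def)
  have sorted: "sorted_wrt (<) Q" unfolding Q_def by simp
  have in_Q: "s \<in> set Q" "t \<in> set Q"
    using assms(1) unfolding set partitions_def by (auto intro: hd_in_set last_in_set)
  have sub: "set Q \<subseteq> {s..t}" using partitions_set[OF assms(1)] partitions_set[OF assms(2)] set by auto
  have ne: "Q \<noteq> []" using in_Q by auto
  have "hd Q \<le> s" using in_Q(1) sorted by (cases Q) auto
  moreover have "s \<le> hd Q" using sub ne hd_in_set by fastforce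
  moreover have "t \<le> last Q" using in_Q(2) sorted by (cases Q rule: rev_cases) (auto simp: sorted_wrt_append)
  moreover have "last Q \<le> t" using sub ne last_in_set by fastforce
  ultimately have "Q \<in> partitions s t" using sorted ne by (auto simp: partitions_def)
  then show ?thesis using that set by blast
qed

section \<open>Limits of partition sums\<close>

lemma has_partition_limit_unique:
  assumes "has_partition_limit G s t I" "has_partition_limit G s t J" "s \<le> t"
  shows "I = J"
proof (rule ccontr)
  assume "I \<noteq> J"
  then have e: "0 < norm (I - J) / 2" by simp
  obtain d where d: "0 < d" "\<And>ts. ts \<in> partitions s t \<Longrightarrow> mesh_less ts d \<Longrightarrow> norm (partition_sum G ts - I) < norm (I - J) / 2"
    using assms(1) e unfolding has_partition_limit_def by meson
  obtain d' where d': "0 < d'" "\<And>ts. ts \<in> partitions s t \<Longrightarrow> mesh_less ts d' \<Longrightarrow> norm (partition_sum G ts - J) < norm (I - J) / 2"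
    using assms(2) e unfolding has_partition_limit_def by meson
  obtain ts where ts: "ts \<in> partitions s t" "mesh_less ts (min d d')"
    using partitions_fine[OF assms(3), of "min d d'"] d d' by auto
  have "norm (partition_sum G ts - I) < norm (I - J) / 2" "norm (partition_sum G ts - J) < norm (I - J) / 2"
    using ts d(2) d'(2) mesh_less_mono by (meson min.cobounded1 min.cobounded2)+
  moreover have "norm (I - J) \<le> norm (partition_sum G ts - I) + norm (partition_sum G ts - J)"
    by (metis norm_minus_commute norm_diff_triangle_le order_refl)
  ultimately show False by linarith
qed

lemma has_partition_limit_perturb:
  assumes G: "has_partition_limit G s t I"
    and H: "\<And>\<epsilon>. 0 < \<epsilon> \<Longrightarrow> \<exists>\<delta>>0. \<forall>ts\<in>partitions s t. mesh_less ts \<delta> \<longrightarrow> norm (partition_sum G' ts - partition_sum G ts) < \<epsilon>"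
  shows "has_partition_limit G' s t I"
  unfolding has_partition_limit_def
proof (intro allI impI)
  fix \<epsilon> :: real assume \<epsilon>: "0 < \<epsilon>"
  obtain \<delta> where \<delta>: "0 < \<delta>" "\<And>ts. ts \<in> partitions s t \<Longrightarrow> mesh_less ts \<delta> \<Longrightarrow> norm (partition_sum G ts - I) < \<epsilon> / 2"
    using G \<epsilon> unfolding has_partition_limit_def by (meson half_gt_zero)
  obtain \<delta>' where \<delta>': "0 < \<delta>'" "\<And>ts. ts \<in> partitions s t \<Longrightarrow> mesh_less ts \<delta>' \<Longrightarrow> norm (partition_sum G' ts - partition_sum G ts) < \<epsilon> / 2"
    using H[of "\<epsilon> / 2"] \<epsilon> by auto
  have "norm (partition_sum G' ts - I) < \<epsilon>" if "ts \<in> partitions s t" "mesh_less ts (min \<delta> \<delta>')" for ts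
    using \<delta>(2)[OF that(1) mesh_less_mono[OF that(2)]] \<delta>'(2)[OF that(1) mesh_less_mono[OF that(2)]]
      norm_triangle_ineq[of "partition_sum G' ts - partition_sum G ts" "partition_sum G ts - I"] by simp
  then show "\<exists>\<delta>>0. \<forall>ts\<in>partitions s t. mesh_less ts \<delta> \<longrightarrow> norm (partition_sum G' ts - I) < \<epsilon>"
    using \<delta>(1) \<delta>'(1) by (intro exI[of _ "min \<delta> \<delta>'"]) auto
qed

text \<open>Both terms have degree above 1 in the controls: pulling out the smallness of
  \<open>\<omega>\<close> leaves degree 1, where superadditivity sums up. The factors pulled out
  tend to 0 with \<open>\<eta>\<close>, which makes fine partition sums of such terms small.\<close>

lemma sum_controls_le:
  assumes \<omega>: "superadditive_on D \<omega>" and V: "superadditive_on D V" and t: "chain D t n"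
    and c: "0 \<le> c1" "0 \<le> c2" "1 < q" "0 < b" and small: "\<And>i. i < n \<Longrightarrow> \<omega> (t i) (t (Suc i)) \<le> \<eta>"
  shows "(\<Sum>i<n. c1 * \<omega> (t i) (t (Suc i)) powr q + c2 * (V (t i) (t (Suc i)) * \<omega> (t i) (t (Suc i)) powr b))
    \<le> c1 * \<eta> powr (q - 1) * \<omega> (t 0) (t n) + c2 * \<eta> powr b * V (t 0) (t n)"
proof -
  have "c1 * \<omega> (t i) (t (Suc i)) powr q + c2 * (V (t i) (t (Suc i)) * \<omega> (t i) (t (Suc i)) powr b)
     \<le> c1 * \<eta> powr (q - 1) * \<omega> (t i) (t (Suc i)) + c2 * \<eta> powr b * V (t i) (t (Suc i))" if i: "i < n" for i
  proof -
    have nn: "0 \<le> \<omega> (t i) (t (Suc i))" "0 \<le> V (t i) (t (Suc i))"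
      using t i superadditive_on_nonneg[OF \<omega>] superadditive_on_nonneg[OF V] by (auto simp: chain_def)
    have "\<omega> (t i) (t (Suc i)) powr q = \<omega> (t i) (t (Suc i)) powr (q - 1) * \<omega> (t i) (t (Suc i))"
      using nn(1) by (cases "\<omega> (t i) (t (Suc i)) = 0") (auto simp: powr_diff)
    also have "\<dots> \<le> \<eta> powr (q - 1) * \<omega> (t i) (t (Suc i))"
      using small[OF i] nn c by (intro mult_right_mono powr_mono2) auto
    finally have "\<omega> (t i) (t (Suc i)) powr q \<le> \<eta> powr (q - 1) * \<omega> (t i) (t (Suc i))" .
    moreover have "V (t i) (t (Suc i)) * \<omega> (t i) (t (Suc i)) powr b \<le> V (t i) (t (Suc i)) * \<eta> powr b"
      using small[OF i] nn c by (intro mult_left_mono powr_mono2) auto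
    ultimately show ?thesis
      using mult_left_mono[OF _ c(1)] mult_left_mono[OF _ c(2)] by (smt (verit) mult.assoc mult.commute)
  qed
  then have "(\<Sum>i<n. c1 * \<omega> (t i) (t (Suc i)) powr q + c2 * (V (t i) (t (Suc i)) * \<omega> (t i) (t (Suc i)) powr b))
    \<le> (\<Sum>i<n. c1 * \<eta> powr (q - 1) * \<omega> (t i) (t (Suc i)) + c2 * \<eta> powr b * V (t i) (t (Suc i)))"
    by (intro sum_mono) simp
  also have "\<dots> = c1 * \<eta> powr (q - 1) * (\<Sum>i<n. \<omega> (t i) (t (Suc i))) + c2 * \<eta> powr b * (\<Sum>i<n. V (t i) (t (Suc i)))"
    by (simp add: sum.distrib sum_distrib_left)
  also have "\<dots> \<le> c1 * \<eta> powr (q - 1) * \<omega> (t 0) (t n) + c2 * \<eta> powr b * V (t 0) (t n)"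
    using c sum_superadditive_chain[OF \<omega> t] sum_superadditive_chain[OF V t]
    by (intro add_mono mult_left_mono) auto
  finally show ?thesis .
qed

text \<open>Uniform smallness near the diagonal, the form in which continuity of a control enters
  the existence of partition limits.\<close>

definition vanishing_on :: "real set \<Rightarrow> (real \<Rightarrow> real \<Rightarrow> real) \<Rightarrow> bool" where
  "vanishing_on D \<omega> \<longleftrightarrow> (\<forall>\<epsilon>>0. \<exists>\<delta>>0. \<forall>u\<in>D. \<forall>v\<in>D. u \<le> v \<and> v - u < \<delta> \<longrightarrow> \<omega> u v < \<epsilon>)"

lemma vanishing_on_subset: "vanishing_on D f \<Longrightarrow> D' \<subseteq> D \<Longrightarrow> vanishing_on D' f"
  unfolding vanishing_on_def by (meson subsetD)

lemma small_scale_exists: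
  fixes c1 c2 :: real
  assumes "1 < q" "0 < b" "0 < e" "0 < h"
  obtains \<eta> where "0 < \<eta>" "\<eta> < h" "c1 * \<eta> powr (q - 1) + c2 * \<eta> powr b < e"
proof -
  have "((\<lambda>\<eta>. c1 * \<eta> powr (q - 1) + c2 * \<eta> powr b) \<longlongrightarrow> c1 * 0 powr (q - 1) + c2 * 0 powr b) (at_right 0)"
    using assms by (intro tendsto_intros) (auto simp: eventually_at_right_less intro!: eventually_at_rightI[of 0 1])
  then have "eventually (\<lambda>\<eta>. c1 * \<eta> powr (q - 1) + c2 * \<eta> powr b < e) (at_right 0)"
    using assms by (intro order_tendstoD) auto
  moreover have "eventually (\<lambda>\<eta>. \<eta> < h) (at_right 0)"
    using assms(4) by (intro eventually_at_rightI[of 0 h]) auto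
  ultimately have "eventually (\<lambda>\<eta>. 0 < \<eta> \<and> \<eta> < h \<and> c1 * \<eta> powr (q - 1) + c2 * \<eta> powr b < e) (at_right 0)"
    using eventually_at_right_less[of "0::real"] by eventually_elim auto
  then show ?thesis
    using that eventually_happens' trivial_limit_at_right_real by (metis (no_types, lifting))
qed

lemma partition_sum_controls_small:
  assumes \<omega>: "superadditive_on {s..t} \<omega>" "vanishing_on {s..t} \<omega>" and V: "superadditive_on {s..t} V"
    and c: "0 \<le> c1" "0 \<le> c2" "1 < q" "0 < b" and e: "0 < e"
  shows "\<exists>\<delta>>0. \<forall>ts\<in>partitions s t. mesh_less ts \<delta> \<longrightarrow>
    partition_sum (\<lambda>u v. c1 * \<omega> u v powr q + c2 * (V u v * \<omega> u v powr b)) ts < e"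
proof -
  obtain \<eta> where \<eta>: "0 < \<eta>" "c1 * \<eta> powr (q - 1) * \<omega> s t + c2 * \<eta> powr b * V s t < e"
    using small_scale_exists[OF c(3,4) e zero_less_one, of "c1 * \<omega> s t" "c2 * V s t"]
    by (auto simp: mult_ac)
  obtain \<delta> where \<delta>: "0 < \<delta>" "\<And>u v. u \<in> {s..t} \<Longrightarrow> v \<in> {s..t} \<Longrightarrow> u \<le> v \<Longrightarrow> v - u < \<delta> \<Longrightarrow> \<omega> u v < \<eta>"
    using \<omega>(2) \<eta>(1) unfolding vanishing_on_def by meson
  have "partition_sum (\<lambda>u v. c1 * \<omega> u v powr q + c2 * (V u v * \<omega> u v powr b)) ts < e"
    if ts: "ts \<in> partitions s t" "mesh_less ts \<delta>" for ts
  proof -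
    note ch = partition_chain[OF ts(1)]
    have "partition_sum (\<lambda>u v. c1 * \<omega> u v powr q + c2 * (V u v * \<omega> u v powr b)) ts
       \<le> c1 * \<eta> powr (q - 1) * \<omega> (ts ! 0) (ts ! (length ts - 1)) + c2 * \<eta> powr b * V (ts ! 0) (ts ! (length ts - 1))"
      unfolding partition_sum_def
    proof (rule sum_controls_le[OF \<omega>(1) V ch(1) c])
      fix i assume i: "i < length ts - 1"
      show "\<omega> (ts ! i) (ts ! Suc i) \<le> \<eta>"
      proof (rule less_imp_le, rule \<delta>(2))
        show "ts ! i \<in> {s..t}" "ts ! Suc i \<in> {s..t}" "ts ! i \<le> ts ! Suc i"
          using ch(1) i by (auto simp: chain_def simp del: atLeastAtMost_iff)
        show "ts ! Suc i - ts ! i < \<delta>" using ts(2) i by (simp add: mesh_less_def)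
      qed
    qed
    then show ?thesis using \<eta>(2) ch by simp
  qed
  then show ?thesis using \<delta>(1) by blast
qed

text \<open>Two fine partitions are compared through a common refinement: by the sewing estimate on
  each of their intervals the difference is bounded by partition sums of terms of degree above 1,
  which are small with the mesh. The final bound is the sewing estimate on the whole interval,
  passed to the limit.\<close>

lemma partition_limit_exists:
  fixes G :: "real \<Rightarrow> real \<Rightarrow> 'a::banach"
  assumes \<omega>: "superadditive_on {s..t} \<omega>" "vanishing_on {s..t} \<omega>" and V: "superadditive_on {s..t} V"
    and K: "0 \<le> K1" "0 \<le> K2" and q: "1 < q" and b: "0 < b"
    and G: "\<And>u w v. s \<le> u \<Longrightarrow> u \<le> w \<Longrightarrow> w \<le> v \<Longrightarrow> v \<le> t \<Longrightarrow>
       norm (G u v - G u w - G w v) \<le> K1 * \<omega> u v powr q + K2 * (V u v * \<omega> u v powr b)"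
    and G0: "\<And>u. s \<le> u \<Longrightarrow> u \<le> t \<Longrightarrow> G u u = 0" and st: "s \<le> t"
  obtains I where "has_partition_limit G s t I"
    "norm (I - G s t) \<le> sew_const q * K1 * \<omega> s t powr q + sew_const (1 + b) * K2 * (V s t * \<omega> s t powr b)"
proof -
  define e where "e u v = sew_const q * K1 * \<omega> u v powr q + sew_const (1 + b) * K2 * (V u v * \<omega> u v powr b)" for u v
  have sew: "norm (partition_sum G Q' - G a b') \<le> e a b'"
    if "s \<le> a" "b' \<le> t" "Q' \<in> partitions a b'" for a b' Q'
  proof -
    have sub: "{a..b'} \<subseteq> {s..t}" using that by auto
    show ?thesis
      using sewing_estimate[OF superadditive_on_subset[OF \<omega>(1) sub] superadditive_on_subset[OF V sub] K q b _ _ partition_chain(1)[OF that(3)], of G]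
        that partition_chain(2,3)[OF that(3)] G G0
      by (simp add: partition_sum_def e_def)
  qed
  have fine: "\<exists>\<delta>>0. \<forall>P\<in>partitions s t. \<forall>P'\<in>partitions s t. mesh_less P \<delta> \<longrightarrow> mesh_less P' \<delta> \<longrightarrow>
     norm (partition_sum G P - partition_sum G P') < \<epsilon>" if \<epsilon>: "0 < \<epsilon>" for \<epsilon>
  proof -
    obtain \<delta> where \<delta>: "0 < \<delta>" "\<And>P. P \<in> partitions s t \<Longrightarrow> mesh_less P \<delta> \<Longrightarrow> partition_sum e P < \<epsilon> / 2"
      using partition_sum_controls_small[OF \<omega> V, of "sew_const q * K1" "sew_const (1 + b) * K2" q b "\<epsilon>/2"]
        K q b \<epsilon> sew_const_nonneg[of q] sew_const_nonneg[of "1 + b"] unfolding e_def by auto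
    have "norm (partition_sum G P - partition_sum G P') < \<epsilon>"
      if P: "P \<in> partitions s t" "P' \<in> partitions s t" "mesh_less P \<delta>" "mesh_less P' \<delta>" for P P'
    proof -
      obtain Q where Q: "Q \<in> partitions s t" "set P \<subseteq> set Q" "set P' \<subseteq> set Q"
        using partitions_common_refinement[OF P(1,2)] .
      have "norm (partition_sum G Q - partition_sum G P) < \<epsilon> / 2" "norm (partition_sum G Q - partition_sum G P') < \<epsilon> / 2"
        using norm_partition_sum_refine[OF P(1) Q(1,2) sew] norm_partition_sum_refine[OF P(2) Q(1,3) sew]
          \<delta>(2)[OF P(1,3)] \<delta>(2)[OF P(2,4)] by fastforce+
      then show ?thesis
        by (metis dist_commute dist_norm dist_triangle_half_l)
    qed
    then show ?thesis using \<delta>(1) by blast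
  qed
  \<comment> \<open>One sequence of partitions with mesh tending to 0 yields the candidate
    \<open>I\<close>; the Cauchy property over all fine partitions then makes it a limit in the
    mesh.\<close>
  have "\<exists>P. P \<in> partitions s t \<and> mesh_less P (1 / real (Suc n))" for n
    using partitions_fine[OF st, of "1 / real (Suc n)"] by auto
  then obtain P where P: "\<And>n. P n \<in> partitions s t" "\<And>n. mesh_less (P n) (1 / real (Suc n))" by metis
  have mesh: "\<exists>N. \<forall>n\<ge>N. mesh_less (P n) \<delta>" if "0 < \<delta>" for \<delta>
  proof -
    obtain N where N: "1 / real (Suc N) < \<delta>" using \<open>0 < \<delta>\<close> nat_approx_posE by blast
    have "mesh_less (P n) \<delta>" if "N \<le> n" for n
    proof (rule mesh_less_mono[OF P(2)])
      have "1 / real (Suc n) \<le> 1 / real (Suc N)" using that by (simp add: frac_le)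
      then show "1 / real (Suc n) \<le> \<delta>" using N by linarith
    qed
    then show ?thesis by blast
  qed
  have "Cauchy (\<lambda>n. partition_sum G (P n))"
    unfolding Cauchy_def dist_norm
  proof (intro allI impI)
    fix \<epsilon> :: real assume "0 < \<epsilon>"
    then show "\<exists>M. \<forall>m\<ge>M. \<forall>n\<ge>M. norm (partition_sum G (P m) - partition_sum G (P n)) < \<epsilon>"
      using fine[of \<epsilon>] mesh P(1) by meson
  qed
  then obtain I where I: "(\<lambda>n. partition_sum G (P n)) \<longlonglongrightarrow> I"
    using Cauchy_convergent_iff convergent_def by blast
  have lim: "has_partition_limit G s t I"
    unfolding has_partition_limit_def
  proof (intro allI impI)
    fix \<epsilon> :: real assume \<epsilon>: "0 < \<epsilon>"
    then obtain \<delta> where \<delta>: "0 < \<delta>" "\<And>P P'. P \<in> partitions s t \<Longrightarrow> P' \<in> partitions s t \<Longrightarrow> mesh_less P \<delta> \<Longrightarrow> mesh_less P' \<delta> \<Longrightarrow>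
       norm (partition_sum G P - partition_sum G P') < \<epsilon> / 2"
      using fine[of "\<epsilon> / 2"] by (metis half_gt_zero)
    obtain N where N: "\<And>n. n \<ge> N \<Longrightarrow> mesh_less (P n) \<delta>" using mesh[OF \<delta>(1)] by blast
    obtain N' where N': "\<And>n. n \<ge> N' \<Longrightarrow> norm (partition_sum G (P n) - I) < \<epsilon> / 2"
      using LIMSEQ_D[OF I, of "\<epsilon> / 2"] \<epsilon> by auto
    have "norm (partition_sum G ts - I) < \<epsilon>" if "ts \<in> partitions s t" "mesh_less ts \<delta>" for ts
    proof -
      have "norm (partition_sum G ts - partition_sum G (P (max N N'))) < \<epsilon> / 2"
        using \<delta>(2)[OF that(1) P(1) that(2) N] by simp
      moreover have "norm (partition_sum G (P (max N N')) - I) < \<epsilon> / 2" using N' by simp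
      ultimately show ?thesis
        using norm_diff_triangle_less by fastforce
    qed
    then show "\<exists>\<delta>>0. \<forall>ts\<in>partitions s t. mesh_less ts \<delta> \<longrightarrow> norm (partition_sum G ts - I) < \<epsilon>"
      using \<delta>(1) by blast
  qed
  have "(\<lambda>n. norm (partition_sum G (P n) - G s t)) \<longlonglongrightarrow> norm (I - G s t)"
    by (intro tendsto_intros I)
  then have "norm (I - G s t) \<le> e s t"
    by (rule LIMSEQ_le_const2) (use sew[OF _ _ P(1)] in auto)
  then show ?thesis using that lim by (simp add: e_def)
qed

section \<open>Total variation and Young integrals\<close>

text \<open>A real number, for arithmetic. Through \<open>enn2real\<close> an infinite variation
  becomes 0, so bounds of path increments by \<open>var1\<close> carry a finiteness
  hypothesis.\<close>

definition var1 :: "real \<Rightarrow> real \<Rightarrow> (real \<Rightarrow> 'a::real_normed_vector) \<Rightarrow> real" where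
  "var1 s t x = enn2real (p_var 1 s t x)"

abbreviation var_sum :: "(real \<Rightarrow> 'a::real_normed_vector) \<Rightarrow> real list \<Rightarrow> real" where
  "var_sum x \<equiv> partition_sum (\<lambda>u v. norm (x v - x u))"

lemma partition_sum_nonneg:
  assumes "\<And>u v. 0 \<le> (G u v :: real)"
  shows "0 \<le> partition_sum G ts"
  unfolding partition_sum_def by (intro sum_nonneg assms)

lemma p_var_1: "p_var 1 s t x = (SUP ts\<in>partitions s t. ennreal (var_sum x ts))"
proof -
  have *: "(if S = top then top else ennreal (enn2real S powr (1 / 1))) = S" for S
    by (auto simp: less_top)
  show ?thesis unfolding p_var_def Let_def * by simp
qed

lemma p_var_le:
  assumes "0 < p" "0 \<le> C"
    and "\<And>ts. ts \<in> partitions s t \<Longrightarrow> partition_sum (\<lambda>u v. norm (x v - x u) powr p) ts \<le> C powr p"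
  shows "p_var p s t x \<le> ennreal C"
proof -
  define S where "S = (SUP ts\<in>partitions s t. ennreal (partition_sum (\<lambda>u v. norm (x v - x u) powr p) ts))"
  have S: "S \<le> ennreal (C powr p)" unfolding S_def by (intro SUP_least ennreal_leI assms)
  then have "S \<noteq> top" using le_less_trans[OF S ennreal_less_top] by auto
  moreover have "enn2real S powr (1 / p) \<le> C"
  proof -
    have "enn2real S \<le> C powr p" using S by (simp add: enn2real_leI)
    then have "enn2real S powr (1 / p) \<le> (C powr p) powr (1 / p)"
      using assms(1) by (intro powr_mono2) auto
    then show ?thesis using assms(1,2) by (simp add: powr_powr)
  qed
  ultimately show ?thesis
    unfolding p_var_def Let_def S_def[symmetric] by (simp add: ennreal_leI)
qed

lemma var_sum_le_var1:
  assumes "p_var 1 s t x < top" "ts \<in> partitions s t"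
  shows "var_sum x ts \<le> var1 s t x"
proof -
  have "ennreal (var_sum x ts) \<le> p_var 1 s t x"
    unfolding p_var_1 using assms(2) by (rule SUP_upper)
  also have "\<dots> = ennreal (var1 s t x)" using assms(1) by (simp add: var1_def)
  finally show ?thesis by (simp add: var1_def)
qed

lemma var1_nonneg: "0 \<le> var1 s t x"
  by (simp add: var1_def)

lemma var1_least:
  assumes "\<And>ts. ts \<in> partitions s t \<Longrightarrow> var_sum x ts \<le> C" "0 \<le> C"
  shows "var1 s t x \<le> C"
proof -
  have "p_var 1 s t x \<le> ennreal C" unfolding p_var_1 by (intro SUP_least ennreal_leI assms(1))
  then show ?thesis using assms(2) by (simp add: var1_def enn2real_leI)
qed

lemma p_var_1_eq: "p_var 1 s t x < top \<Longrightarrow> p_var 1 s t x = ennreal (var1 s t x)"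
  by (simp add: var1_def)

lemma norm_diff_le_var1:
  assumes "p_var 1 s t x < top" "s \<le> t"
  shows "norm (x t - x s) \<le> var1 s t x"
proof (cases "s = t")
  case True
  then show ?thesis by (simp add: var1_nonneg)
next
  case False
  then have "[s, t] \<in> partitions s t" using assms(2) by (simp add: partitions_def)
  from var_sum_le_var1[OF assms(1) this] show ?thesis by simp
qed

lemma var1_superadditive:
  assumes "p_var 1 s t x < top" "s \<le> u" "u \<le> t"
  shows "var1 s u x + var1 u t x \<le> var1 s t x"
proof -
  have app: "var_sum x ts + var_sum x us \<le> var1 s t x" if "ts \<in> partitions s u" "us \<in> partitions u t" for ts us
    using var_sum_le_var1[OF assms(1) partitions_append(1)[OF that]] partitions_append(2)[OF that] by metis
  obtain ts0 us0 where 0: "ts0 \<in> partitions s u" "us0 \<in> partitions u t"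
    using partitions_nonempty assms by meson
  \<comment> \<open>The supremum over partitions of [u, t] is taken with \<open>ts\<close> fixed,
    that over \<open>ts\<close> afterwards. The partitions \<open>us0\<close> and \<open>ts0\<close>
    supply the nonnegativity that \<open>var1_least\<close> asks of its bound.\<close>
  have "var1 u t x \<le> var1 s t x - var_sum x ts" if "ts \<in> partitions s u" for ts
  proof (rule var1_least)
    show "var_sum x us \<le> var1 s t x - var_sum x ts" if "us \<in> partitions u t" for us
      using app[OF \<open>ts \<in> partitions s u\<close> that] by simp
    show "0 \<le> var1 s t x - var_sum x ts"
      using app[OF \<open>ts \<in> partitions s u\<close> 0(2)] partition_sum_nonneg[of "\<lambda>u v. norm (x v - x u)" us0] by simp
  qed
  then have "var1 s u x \<le> var1 s t x - var1 u t x"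
    using 0(1) partition_sum_nonneg[of "\<lambda>u v. norm (x v - x u)" ts0]
    by (intro var1_least) (smt (verit, ccfv_threshold) norm_ge_zero)+
  then show ?thesis by simp
qed

text \<open>By the triangle inequality, splitting the interval that contains \<open>w\<close> does
  not decrease the sum.\<close>

lemma var_sum_insert:
  assumes "ts \<in> partitions s t" "s \<le> w" "w \<le> t"
  shows "\<exists>us\<in>partitions s w. \<exists>vs\<in>partitions w t. var_sum x ts \<le> var_sum x us + var_sum x vs"
  using assms
proof (induction ts arbitrary: s)
  case Nil
  then show ?case by (simp add: partitions_def)
next
  case (Cons a ts)
  show ?case
  proof (cases ts)
    case Nil
    then have "a = s" "s = t" using Cons.prems(1) by (auto simp: partitions_def)
    then have "[w] \<in> partitions s w" "[w] \<in> partitions w t" using Cons.prems by (auto simp: partitions_def)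
    then show ?thesis using Nil by (auto intro!: bexI[of _ "[w]"])
  next
    case (Cons b zs)
    note P = partition_cases2[OF Cons.prems(1) Cons]
    consider "w = s" | "s < w" "w < b" | "b \<le> w" using Cons.prems(2) by linarith
    then show ?thesis
    proof cases
      case 1
      then have "[s] \<in> partitions s w" "a # ts \<in> partitions w t" using Cons.prems(1) by (auto simp: partitions_def)
      then show ?thesis by (metis add_0 order_refl partition_sum_single)
    next
      case 2
      have "[s, w] \<in> partitions s w" using 2 by (simp add: partitions_def)
      moreover have "w # ts \<in> partitions w t" using P 2 Cons unfolding partitions_def by auto
      moreover have "var_sum x (a # ts) \<le> var_sum x [s, w] + var_sum x (w # ts)"
        using norm_triangle_ineq[of "x w - x s" "x b - x w"] P(1) Cons by simp
      ultimately show ?thesis by blast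
    next
      case 3
      obtain us vs where uv: "us \<in> partitions b w" "vs \<in> partitions w t" "var_sum x ts \<le> var_sum x us + var_sum x vs"
        using Cons.IH[OF P(3) 3 Cons.prems(3)] by blast
      obtain us' where us: "us = b # us'" using uv(1) unfolding partitions_def by (cases us) auto
      have "s # us \<in> partitions s w" using uv(1) P(2) unfolding partitions_def us by auto
      moreover have "var_sum x (a # ts) \<le> var_sum x (s # us) + var_sum x vs"
        using uv(3) P(1) Cons us by simp
      ultimately show ?thesis using uv(2) by blast
    qed
  qed
qed

text \<open>This half of the additivity of the variation lets local bounds on the variation of A(Z)
  be added up over [0, T].\<close>

lemma var1_subadditive:
  assumes "p_var 1 s u x < top" "p_var 1 u t x < top" "s \<le> u" "u \<le> t"
  shows "var1 s t x \<le> var1 s u x + var1 u t x"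
proof (rule var1_least)
  fix ts assume "ts \<in> partitions s t"
  then obtain us vs where "us \<in> partitions s u" "vs \<in> partitions u t" "var_sum x ts \<le> var_sum x us + var_sum x vs"
    using var_sum_insert assms(3,4) by blast
  then show "var_sum x ts \<le> var1 s u x + var1 u t x"
    using var_sum_le_var1[OF assms(1)] var_sum_le_var1[OF assms(2)] by fastforce
qed (simp add: var1_nonneg)

section \<open>Tensors, bilinear maps and the Young integral\<close>

lemma norm_matrix_component_le: "\<bar>M $ i $ j\<bar> \<le> norm (M :: real^'d^'k)"
  by (metis Finite_Cartesian_Product.norm_nth_le order_trans real_norm_def)

lemma norm_tensor: "norm (tensor x y) = norm x * norm y"
proof -
  have row: "norm (tensor x y $ i) = norm y * \<bar>x $ i\<bar>" for i
  proof -
    have "tensor x y $ i = (x $ i) *\<^sub>R y" by (simp add: tensor_def vec_eq_iff)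
    then show ?thesis by (simp add: mult.commute)
  qed
  have "norm (tensor x y) = L2_set (\<lambda>i. norm y * \<bar>x $ i\<bar>) UNIV"
    unfolding norm_vec_def[of "tensor x y"] row ..
  also have "\<dots> = norm y * norm x"
    by (subst L2_set_right_distrib[symmetric]) (auto simp: norm_vec_def)
  finally show ?thesis by (simp add: mult.commute)
qed

lemma tensor_diff_left: "tensor (x - x') y = tensor x y - tensor x' y"
  and tensor_add_right: "tensor x (y + y') = tensor x y + tensor x y'"
  and tensor_0_left [simp]: "tensor 0 y = 0"
  by (simp_all add: tensor_def vec_eq_iff algebra_simps)

text \<open>Estimated entry by entry; the number of entries is the source of
  \<open>dim_const\<close>.\<close>

lemma norm_tensor_apply_le:
  fixes M :: "real^'d^'k"
  assumes B: "\<And>i j. norm (B (axis i 1) (axis j 1)) \<le> b"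
  shows "norm (tensor_apply B M) \<le> real (CARD('k) * CARD('d)) * b * norm M"
proof -
  have b: "0 \<le> b" by (rule order_trans[OF norm_ge_zero B])
  have "norm (tensor_apply B M) \<le> (\<Sum>i\<in>(UNIV::'k set). \<Sum>j\<in>(UNIV::'d set). norm M * b)"
    unfolding tensor_apply_def
    by (intro sum_norm_le order_trans[OF norm_sum] sum_mono)
      (auto intro!: mult_mono simp: B norm_matrix_component_le)
  then show ?thesis by (simp add: algebra_simps)
qed

lemma tensor_apply_add: "tensor_apply B (M + N) = tensor_apply B M + tensor_apply B N"
  by (simp add: tensor_apply_def algebra_simps sum.distrib)

lemma tensor_apply_diff: "tensor_apply B (M - N) = tensor_apply B M - tensor_apply B N"
  by (simp add: tensor_apply_def algebra_simps sum_subtractf)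

lemma tensor_apply_0 [simp]: "tensor_apply B 0 = 0"
  by (simp add: tensor_apply_def)

lemma tensor_apply_diff_left:
  "tensor_apply (\<lambda>v w. B v w - B' v w) M = tensor_apply B M - tensor_apply B' M"
  by (simp add: tensor_apply_def algebra_simps sum_subtractf)

lemma tensor_apply_tensor:
  assumes "\<And>w. linear (\<lambda>v. B v w)" "\<And>v. linear (B v)"
  shows "tensor_apply B (tensor x y) = B x y"
proof -
  have exp: "z = (\<Sum>i\<in>UNIV. (z $ i) *\<^sub>R axis i 1)" for z :: "real^'m"
    using basis_expansion[of z] by (simp add: scalar_mult_eq_scaleR)
  have "B x y = (\<Sum>i\<in>UNIV. (x $ i) *\<^sub>R B (axis i 1) y)"
    by (subst exp[of x]) (simp add: linear_sum[OF assms(1)] linear_scale[OF assms(1)])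
  also have "\<dots> = (\<Sum>i\<in>UNIV. (x $ i) *\<^sub>R B (axis i 1) (\<Sum>j\<in>UNIV. (y $ j) *\<^sub>R axis j 1))"
    using exp[of y] by simp
  also have "\<dots> = (\<Sum>i\<in>UNIV. (x $ i) *\<^sub>R (\<Sum>j\<in>UNIV. (y $ j) *\<^sub>R B (axis i 1) (axis j 1)))"
    by (simp add: linear_sum[OF assms(2)] linear_scale[OF assms(2)])
  finally show ?thesis
    by (simp add: tensor_apply_def tensor_def scaleR_sum_right)
qed

text \<open>The defect of the germ is the tensor of an increment of \<Psi> with one of
  \<open>X\<close>, of the mixed type \<open>V * \<omega> powr b\<close>, so the limit exists; being
  unique, it is the value of the definite description. The germ on [s, t] itself is 0, since \<Psi>
  is centred at \<open>s\<close>, and the sewing bound becomes a bound on the integral.\<close>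

lemma young_integral_bound:
  fixes \<Psi> :: "real \<Rightarrow> real^'n" and X :: "real \<Rightarrow> real \<Rightarrow> real^'d"
  assumes \<omega>: "superadditive_on {s..t} \<omega>" "vanishing_on {s..t} \<omega>" and V: "superadditive_on {s..t} V"
    and b: "0 < b" and st: "s \<le> t"
    and X: "\<And>u w v. s \<le> u \<Longrightarrow> u \<le> w \<Longrightarrow> w \<le> v \<Longrightarrow> v \<le> t \<Longrightarrow> X u v = X u w + X w v"
    and Xb: "\<And>u v. s \<le> u \<Longrightarrow> u \<le> v \<Longrightarrow> v \<le> t \<Longrightarrow> norm (X u v) \<le> \<omega> u v powr b"
    and \<Psi>: "\<And>u v. s \<le> u \<Longrightarrow> u \<le> v \<Longrightarrow> v \<le> t \<Longrightarrow> norm (\<Psi> v - \<Psi> u) \<le> V u v"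
  shows "norm (young_integral \<Psi> X s t) \<le> sew_const (1 + b) * (V s t * \<omega> s t powr b)"
proof -
  let ?G = "\<lambda>u v. tensor (\<Psi> u - \<Psi> s) (X u v)"
  \<comment> \<open>There is no pure term: its coefficient is 0, and 2 is merely some exponent above
    1.\<close>
  have G: "norm (?G u v - ?G u w - ?G w v) \<le> 0 * \<omega> u v powr 2 + 1 * (V u v * \<omega> u v powr b)"
    if "s \<le> u" "u \<le> w" "w \<le> v" "v \<le> t" for u w v
  proof -
    have "?G u v - ?G u w - ?G w v = tensor ((\<Psi> u - \<Psi> s) - (\<Psi> w - \<Psi> s)) (X w v)"
      unfolding tensor_diff_left using X[OF that] by (simp add: tensor_add_right)
    then have "norm (?G u v - ?G u w - ?G w v) = norm (\<Psi> w - \<Psi> u) * norm (X w v)"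
      by (simp add: norm_tensor norm_minus_commute)
    also have "\<dots> \<le> V u w * \<omega> w v powr b"
      using \<Psi>[of u w] Xb[of w v] that superadditive_on_nonneg[OF V, of u w] by (intro mult_mono) auto
    also have "\<dots> \<le> V u v * \<omega> u v powr b"
      using that superadditive_on_nonneg[OF V, of u v] superadditive_on_nonneg[OF \<omega>(1), of w v]
        superadditive_on_mono[OF V, of u u w v] superadditive_on_mono[OF \<omega>(1), of u w v v] b
      by (intro mult_mono powr_mono2) auto
    finally show ?thesis by simp
  qed
  have G0: "?G u u = 0" if "s \<le> u" "u \<le> t" for u
  proof -
    have "X u u = 0" using X[OF that(1) order_refl order_refl that(2)] by (metis add_cancel_right_right)
    then show ?thesis by (simp add: tensor_def vec_eq_iff)
  qed
  obtain I where I: "has_partition_limit ?G s t I"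
    "norm (I - ?G s t) \<le> sew_const 2 * 0 * \<omega> s t powr 2 + sew_const (1 + b) * 1 * (V s t * \<omega> s t powr b)"
    by (rule partition_limit_exists[of s t \<omega> V 0 1 2 b ?G, OF \<omega> V _ _ _ b G G0 st]) simp_all
  have "young_integral \<Psi> X s t = I"
    unfolding young_integral_def
  proof (rule the_equality)
    show "has_partition_limit ?G s t I" by (rule I(1))
    show "J = I" if "has_partition_limit ?G s t J" for J
      by (rule has_partition_limit_unique[OF that I(1) st])
  qed
  then show ?thesis using I(2) by simp
qed

section \<open>The a priori estimate\<close>

text \<open>The properties of \<sigma> on which the estimates rest, with one constant
  \<open>M\<close> for all. A Taylor expansion is asked for in the first variable alone: the second
  one is filled with a path of bounded variation, whose increments are handled by the Lipschitz
  bound. The condition \<open>q\<close> makes the smooth part of the germ defect sewable.\<close>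

locale rough_coefficient =
  fixes \<sigma> :: "(real^'n) \<times> (real^'n) \<Rightarrow> (real^'d) \<Rightarrow>\<^sub>L (real^'n)"
    and \<beta> \<theta> M :: real and F :: "real \<Rightarrow> real"
  assumes \<beta>: "1/3 < \<beta>" "\<beta> \<le> 1/2" and \<theta>: "0 < \<theta>" "\<theta> \<le> 1" and q: "1 < (2 + \<theta>) * \<beta>" and M: "1 \<le> M"
    and \<sigma>_bound: "\<And>p. norm (\<sigma> p) \<le> M"
    and \<sigma>_lipschitz: "\<And>p p'. norm (\<sigma> p - \<sigma> p') \<le> M * norm (p - p')"
    and partial1_linear: "\<And>z y. linear (partial1 \<sigma> z y)"
    and partial1_bound: "\<And>z y v. norm (partial1 \<sigma> z y v) \<le> M * norm v"
    and partial1_holder: "\<And>z y z' y' v. norm (partial1 \<sigma> z y v - partial1 \<sigma> z' y' v)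
          \<le> M * norm ((z, y) - (z', y')) powr \<theta> * norm v"
    and partial1_taylor: "\<And>z z' y. norm (\<sigma> (z', y) - \<sigma> (z, y) - partial1 \<sigma> z y (z' - z))
          \<le> M * norm (z' - z) powr (1 + \<theta>)"
    and partial2_bound: "\<And>z y v. norm (partial2 \<sigma> z y v) \<le> M * norm v"
    and F_mono: "\<And>x y. 0 \<le> x \<Longrightarrow> x \<le> y \<Longrightarrow> F x \<le> F y"
    and F_pos: "\<And>x. 0 \<le> x \<Longrightarrow> 0 < F x"
begin

definition dim_const :: real where "dim_const = real (CARD('d) * CARD('d))"

text \<open>
  \<open>cell_const\<close>, \<open>grid_const\<close> and \<open>path_const\<close> are Hoelder constants of \<open>Z\<close> within a cell of the grid, between
  grid points, and everywhere.  \<open>2 * double_const\<close> is the size of \<open>r h\<^sup>\<beta>\<close> tolerated for a remainder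
  constant \<open>r\<close> on scale \<open>h\<close>; it is chosen so that the trivial bound available after doubling \<open>h\<close> meets it.
\<close>

definition cell_const :: real where "cell_const = M + 2 * dim_const * M\<^sup>2"

definition double_const :: real where "double_const = 3 * M + 2 + cell_const"

definition grid_const :: real where "grid_const = M + 2 * double_const"

definition path_const :: real where "path_const = grid_const + 2 * cell_const"

text \<open>The growth condition on \<open>A\<close> for a path with Hoelder constant
  \<open>path_const\<close> on an interval of control at most 1, which keeps the argument of
  \<open>F\<close> below \<open>path_const\<close>.\<close>

definition A_const :: real where "A_const = F path_const * path_const"

text \<open>Bounds the smooth part of the germ defect relative to
  \<open>w powr (2 * \<beta>)\<close>: the Taylor error of \<sigma>, the share of the remainder of
  \<open>Z\<close> with \<open>r * h powr \<beta>\<close> at its tolerated maximum, and the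
  oscillation of the second level coefficient. It no longer contains \<open>r\<close>.\<close>

definition smooth_const :: real where
  "smooth_const = M * grid_const powr (1 + \<theta>) + M * (2 * double_const)
     + dim_const * (M\<^sup>2 * ((grid_const + A_const) powr \<theta> + (grid_const + A_const)))"

text \<open>Three sources: the second level term, which belongs to the germ but not to the first
  order expansion, and the smooth and the variation part of the sewing error.\<close>

definition rem_const :: real where
  "rem_const = dim_const * M\<^sup>2 + sew_const ((2 + \<theta>) * \<beta>) * smooth_const + sew_const (1 + \<beta>) * (M * A_const)"

text \<open>The solution \<open>h\<close> of \<open>rem_const * h powr \<beta> = 1\<close>: up to
  this scale the remainder adds at most 1 to the Hoelder constant \<open>M\<close>, which is what
  \<open>double_const\<close> allows for.\<close>

definition local_scale :: real where "local_scale = (1 / rem_const) powr (1 / \<beta>)"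

lemma dim_const: "1 \<le> dim_const"
  unfolding dim_const_def of_nat_mult
  by (smt (verit) mult_le_one mult_ge1_I of_nat_1 of_nat_mono zero_less_card_finite Suc_leI One_nat_def)

lemma cell_const: "M \<le> cell_const"
  unfolding cell_const_def using dim_const by simp

lemma double_const: "5 \<le> double_const"
  unfolding double_const_def using cell_const M by linarith

lemma grid_const: "1 \<le> grid_const"
  unfolding grid_const_def using double_const M by linarith

lemma path_const: "1 \<le> path_const"
  unfolding path_const_def using grid_const cell_const M by linarith

lemma A_const: "0 < A_const"
  unfolding A_const_def using path_const F_pos[of path_const] by simp

lemma smooth_const: "0 \<le> smooth_const"
proof -
  have "0 \<le> dim_const" using dim_const by linarith
  then show ?thesis
    unfolding smooth_const_def using M double_const grid_const A_const
    by (intro add_nonneg_nonneg mult_nonneg_nonneg) auto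
qed

lemma rem_const: "1 \<le> rem_const"
proof -
  have "1 * 1 \<le> dim_const * M\<^sup>2" by (rule mult_mono[OF dim_const]) (use M dim_const order_trans[OF zero_le_one dim_const] in auto)
  moreover have "0 \<le> sew_const ((2 + \<theta>) * \<beta>) * smooth_const"
    by (rule mult_nonneg_nonneg[OF sew_const_nonneg[OF q] smooth_const])
  moreover have "0 \<le> sew_const (1 + \<beta>) * (M * A_const)"
    using sew_const_nonneg[of "1 + \<beta>"] \<beta> A_const M by (intro mult_nonneg_nonneg) auto
  ultimately show ?thesis unfolding rem_const_def by linarith
qed

lemma local_scale: "0 < local_scale" "local_scale \<le> 1" "rem_const * local_scale powr \<beta> = 1"
proof -
  show "0 < local_scale" "local_scale \<le> 1"
    unfolding local_scale_def using rem_const \<beta> by (auto intro!: powr_le1)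
  show "rem_const * local_scale powr \<beta> = 1"
    unfolding local_scale_def using rem_const \<beta> by (simp add: powr_powr)
qed

end

section \<open>The normalised driver and the defect of its germ\<close>

locale rough_driver = rough_coefficient \<sigma> \<beta> \<theta> M F
  for \<sigma> :: "(real^'n) \<times> (real^'n) \<Rightarrow> (real^'d) \<Rightarrow>\<^sub>L (real^'n)" and \<beta> \<theta> M F +
  fixes T :: real and w :: "real \<Rightarrow> real \<Rightarrow> real"
    and X :: "real \<Rightarrow> real \<Rightarrow> real^'d" and XX :: "real \<Rightarrow> real \<Rightarrow> real^'d^'d"
  assumes T: "0 < T" and w: "superadditive_on {0..T} w"
    and w_cont: "continuous_on {(s, t). 0 \<le> s \<and> s \<le> t \<and> t \<le> T} (\<lambda>(s, t). w s t)"
    and X_add: "\<And>s u t. 0 \<le> s \<Longrightarrow> s \<le> u \<Longrightarrow> u \<le> t \<Longrightarrow> t \<le> T \<Longrightarrow> X s t = X s u + X u t"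
    and XX_chen: "\<And>s u t. 0 \<le> s \<Longrightarrow> s \<le> u \<Longrightarrow> u \<le> t \<Longrightarrow> t \<le> T \<Longrightarrow>
       XX s t = XX s u + XX u t + tensor (X s u) (X u t)"
    and X_bound: "\<And>s t. 0 \<le> s \<Longrightarrow> s \<le> t \<Longrightarrow> t \<le> T \<Longrightarrow> norm (X s t) \<le> w s t powr \<beta>"
    and XX_bound: "\<And>s t. 0 \<le> s \<Longrightarrow> s \<le> t \<Longrightarrow> t \<le> T \<Longrightarrow> norm (XX s t) \<le> w s t powr (2 * \<beta>)"
begin

definition level2 :: "(real^'n) \<Rightarrow> (real^'n) \<Rightarrow> (real^'d^'d) \<Rightarrow> real^'n" where
  "level2 z y N = tensor_apply (\<lambda>v. blinfun_apply (partial1 \<sigma> z y (blinfun_apply (\<sigma> (z, y)) v))) N"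

definition germ :: "(real \<Rightarrow> real^'n) \<Rightarrow> (real \<Rightarrow> real^'n) \<Rightarrow> real \<Rightarrow> real \<Rightarrow> real^'n" where
  "germ Z Y u v = blinfun_apply (\<sigma> (Z u, Y u)) (X u v) + level2 (Z u) (Y u) (XX u v)"

definition rem :: "(real \<Rightarrow> real^'n) \<Rightarrow> (real \<Rightarrow> real^'n) \<Rightarrow> real \<Rightarrow> real \<Rightarrow> real^'n" where
  "rem Z Y u v = Z v - Z u - blinfun_apply (\<sigma> (Z u, Y u)) (X u v)"

lemma w_nonneg: "0 \<le> u \<Longrightarrow> u \<le> v \<Longrightarrow> v \<le> T \<Longrightarrow> 0 \<le> w u v"
  using superadditive_on_nonneg[OF w] by auto

lemma w_mono: "0 \<le> u \<Longrightarrow> u \<le> u' \<Longrightarrow> u' \<le> v' \<Longrightarrow> v' \<le> v \<Longrightarrow> v \<le> T \<Longrightarrow> w u' v' \<le> w u v"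
  using superadditive_on_mono[OF w, of u u' v' v] by auto

lemma w_powr_mono:
  "0 \<le> u \<Longrightarrow> u \<le> u' \<Longrightarrow> u' \<le> v' \<Longrightarrow> v' \<le> v \<Longrightarrow> v \<le> T \<Longrightarrow> 0 \<le> p \<Longrightarrow> w u' v' powr p \<le> w u v powr p"
  using w_mono w_nonneg by (intro powr_mono2) auto

lemma powr_2\<beta>: "x powr (2 * \<beta>) = x powr \<beta> * x powr \<beta>"
  by (simp flip: powr_add)

lemma X_refl: "0 \<le> u \<Longrightarrow> u \<le> T \<Longrightarrow> X u u = 0"
  using X_add[of u u u] by (metis add_cancel_right_right order_refl)

lemma XX_refl: "0 \<le> u \<Longrightarrow> u \<le> T \<Longrightarrow> XX u u = 0"
  using XX_chen[of u u u] X_refl[of u] by simp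

lemma norm_\<sigma>_apply: "norm (blinfun_apply (\<sigma> p) v) \<le> M * norm v"
  by (rule order_trans[OF norm_blinfun]) (intro mult_right_mono \<sigma>_bound, simp)

lemma norm_level2: "norm (level2 z y N) \<le> dim_const * M\<^sup>2 * norm N"
  unfolding level2_def dim_const_def
proof (rule norm_tensor_apply_le)
  fix i j :: 'd
  have "norm (blinfun_apply (partial1 \<sigma> z y (blinfun_apply (\<sigma> (z, y)) (axis i 1))) (axis j 1 :: real^'d))
     \<le> norm (partial1 \<sigma> z y (blinfun_apply (\<sigma> (z, y)) (axis i 1)))"
    by (rule order_trans[OF norm_blinfun]) simp
  also have "\<dots> \<le> M * norm (blinfun_apply (\<sigma> (z, y)) (axis i 1))" by (rule partial1_bound)
  also have "\<dots> \<le> M * M" using norm_\<sigma>_apply[of "(z, y)" "axis i 1"] M by (intro mult_left_mono) auto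
  finally show "norm (blinfun_apply (partial1 \<sigma> z y (blinfun_apply (\<sigma> (z, y)) (axis i 1))) (axis j 1 :: real^'d)) \<le> M\<^sup>2"
    by (simp add: power2_eq_square)
qed

lemma level2_tensor:
  "level2 z y (tensor a b) = blinfun_apply (partial1 \<sigma> z y (blinfun_apply (\<sigma> (z, y)) a)) b"
  unfolding level2_def
proof (rule tensor_apply_tensor)
  show "linear (\<lambda>v. blinfun_apply (partial1 \<sigma> z y (blinfun_apply (\<sigma> (z, y)) v)) b')" for b'
    by (rule linearI) (simp_all add: blinfun.add_right blinfun.scaleR_right linear_add[OF partial1_linear]
        linear_scale[OF partial1_linear] blinfun.add_left blinfun.scaleR_left)
  show "linear (blinfun_apply (partial1 \<sigma> z y (blinfun_apply (\<sigma> (z, y)) v)))" for v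
    by (rule linearI) (simp_all add: blinfun.add_right blinfun.scaleR_right)
qed

lemma level2_add: "level2 z y (a + b) = level2 z y a + level2 z y b"
  and level2_0: "level2 z y 0 = 0"
  by (simp_all add: level2_def tensor_apply_add)

text \<open>A product rule for \<open>partial1 \<sigma>\<close> applied to \<sigma>: the first
  factor is \<theta>-Hoelder and the second Lipschitz, hence the two powers of the distance.\<close>

lemma norm_level2_diff:
  "norm (level2 z y N - level2 z' y' N)
     \<le> dim_const * (M\<^sup>2 * (norm ((z, y) - (z', y')) powr \<theta> + norm ((z, y) - (z', y')))) * norm N"
proof -
  let ?d = "norm ((z, y) - (z', y'))"
  let ?B = "\<lambda>z y v. partial1 \<sigma> z y (blinfun_apply (\<sigma> (z, y)) v)"
  have "norm (blinfun_apply (?B z y (axis i 1)) (axis j 1) - blinfun_apply (?B z' y' (axis i 1)) (axis j 1 :: real^'d))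
     \<le> M\<^sup>2 * (?d powr \<theta> + ?d)" for i j :: 'd
  proof -
    let ?e = "axis i 1 :: real^'d"
    have "norm (blinfun_apply (?B z y ?e) (axis j 1) - blinfun_apply (?B z' y' ?e) (axis j 1 :: real^'d))
      \<le> norm (?B z y ?e - ?B z' y' ?e)"
      unfolding blinfun.diff_left[symmetric] by (rule order_trans[OF norm_blinfun]) simp
    also have "?B z y ?e - ?B z' y' ?e = (partial1 \<sigma> z y (blinfun_apply (\<sigma> (z, y)) ?e) - partial1 \<sigma> z' y' (blinfun_apply (\<sigma> (z, y)) ?e))
        + partial1 \<sigma> z' y' (blinfun_apply (\<sigma> (z, y) - \<sigma> (z', y')) ?e)"
      by (simp add: blinfun.diff_left linear_diff[OF partial1_linear])
    also have "norm \<dots> \<le> M * ?d powr \<theta> * norm (blinfun_apply (\<sigma> (z, y)) ?e)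
        + M * norm (blinfun_apply (\<sigma> (z, y) - \<sigma> (z', y')) ?e)"
      by (intro norm_triangle_mono partial1_holder partial1_bound)
    also have "\<dots> \<le> M * ?d powr \<theta> * M + M * (M * ?d)"
    proof (intro add_mono mult_left_mono)
      show "norm (blinfun_apply (\<sigma> (z, y)) ?e) \<le> M" using norm_\<sigma>_apply[of "(z, y)" ?e] by simp
      show "norm (blinfun_apply (\<sigma> (z, y) - \<sigma> (z', y')) ?e) \<le> M * ?d"
        by (rule order_trans[OF norm_blinfun]) (use \<sigma>_lipschitz[of "(z, y)" "(z', y')"] in simp)
    qed (use M in auto)
    also have "\<dots> = M\<^sup>2 * (?d powr \<theta> + ?d)" by (simp add: power2_eq_square algebra_simps)
    finally show ?thesis .
  qed
  then show ?thesis
    unfolding level2_def tensor_apply_diff_left[symmetric] dim_const_def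
    by (rule norm_tensor_apply_le)
qed

lemma germ_refl: "0 \<le> u \<Longrightarrow> u \<le> T \<Longrightarrow> germ Z Y u u = 0"
  by (simp add: germ_def X_refl XX_refl level2_0)

text \<open>Chen's relation contributes \<open>partial1 \<sigma>\<close> applied to the first order
  increment of \<open>Z\<close> on [u, x], paired with \<open>X x v\<close>. Up to
  \<open>rem\<close> this cancels the linear part of the change of \<sigma> in its first variable,
  so that only a Taylor error, the remainder and the change of the second level coefficient survive.
  The change of \<sigma> due to \<open>Y\<close> is left unexpanded.\<close>

lemma germ_defect:
  assumes "0 \<le> u" "u \<le> x" "x \<le> v" "v \<le> T"
  shows "germ Z Y u v - germ Z Y u x - germ Z Y x v =
    (level2 (Z u) (Y u) (XX x v) - level2 (Z x) (Y x) (XX x v))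
    - blinfun_apply ((\<sigma> (Z x, Y x) - \<sigma> (Z x, Y u)) + (\<sigma> (Z x, Y u) - \<sigma> (Z u, Y u) - partial1 \<sigma> (Z u) (Y u) (Z x - Z u))
       + partial1 \<sigma> (Z u) (Y u) (rem Z Y u x)) (X x v)"
proof -
  have "partial1 \<sigma> (Z u) (Y u) (rem Z Y u x) =
    partial1 \<sigma> (Z u) (Y u) (Z x - Z u) - partial1 \<sigma> (Z u) (Y u) (blinfun_apply (\<sigma> (Z u, Y u)) (X u x))"
    by (simp add: rem_def linear_diff[OF partial1_linear])
  then show ?thesis
    using X_add[OF assms] XX_chen[OF assms]
    by (simp add: germ_def level2_add level2_tensor blinfun.add_right blinfun.diff_left blinfun.add_left)
qed

end

text \<open>
  Exact solutions (\<open>D = {0..T}\<close>) and Euler schemes (\<open>D\<close> the grid) share their a priori estimate.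
  \<open>V\<close> is the variation of \<open>Y = A(Z)\<close>; the germ omits the Young integral, which does not contribute to
  the limit.
\<close>
locale approx_solution = rough_driver \<sigma> \<beta> \<theta> M F T w X XX
  for \<sigma> :: "(real^'n) \<times> (real^'n) \<Rightarrow> (real^'d) \<Rightarrow>\<^sub>L (real^'n)" and \<beta> \<theta> M F T w
    and X :: "real \<Rightarrow> real \<Rightarrow> real^'d" and XX +
  fixes D :: "real set" and Z Y :: "real \<Rightarrow> real^'n" and V :: "real \<Rightarrow> real \<Rightarrow> real"
  assumes D_sub: "D \<subseteq> {0..T}" and V: "superadditive_on {0..T} V"
    and Y_le_V: "\<And>u v. 0 \<le> u \<Longrightarrow> u \<le> v \<Longrightarrow> v \<le> T \<Longrightarrow> norm (Y v - Y u) \<le> V u v"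
    and V_le: "\<And>u v L. 0 \<le> u \<Longrightarrow> u \<le> v \<Longrightarrow> v \<le> T \<Longrightarrow> 0 \<le> L \<Longrightarrow>
        (\<And>a b. u \<le> a \<Longrightarrow> a \<le> b \<Longrightarrow> b \<le> v \<Longrightarrow> norm (Z b - Z a) \<le> L * w a b powr \<beta>) \<Longrightarrow>
        V u v \<le> F (L * w u v powr \<beta>) * (L * w u v powr \<beta>)"
    and germ_sums: "\<And>u v \<epsilon>. u \<in> D \<Longrightarrow> v \<in> D \<Longrightarrow> u \<le> v \<Longrightarrow> 0 < \<epsilon> \<Longrightarrow>
        \<exists>t n. chain (D \<inter> {u..v}) t n \<and> t 0 = u \<and> t n = v \<and>
          norm (Z v - Z u - (\<Sum>i<n. germ Z Y (t i) (t (Suc i)))) < \<epsilon>"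
    and cells: "\<And>a b. 0 \<le> a \<Longrightarrow> a \<le> b \<Longrightarrow> b \<le> T \<Longrightarrow>
        norm (Z b - Z a) \<le> cell_const * w a b powr \<beta> \<or>
        (\<exists>a'\<in>D. \<exists>b'\<in>D. a \<le> a' \<and> a' \<le> b' \<and> b' \<le> b \<and>
           norm (Z a' - Z a) \<le> cell_const * w a a' powr \<beta> \<and> norm (Z b - Z b') \<le> cell_const * w b' b powr \<beta>)"
    and halving: "\<And>u v. u \<in> D \<Longrightarrow> v \<in> D \<Longrightarrow> u \<le> v \<Longrightarrow>
        \<exists>x\<in>D. \<exists>y\<in>D. u \<le> x \<and> x \<le> y \<and> y \<le> v \<and>
          w u x \<le> w u v / 2 \<and> w y v \<le> w u v / 2 \<and> norm (Z y - Z x) \<le> cell_const * w x y powr \<beta>"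
    and rem_finite: "\<exists>r. \<forall>u\<in>D. \<forall>v\<in>D. u \<le> v \<longrightarrow> norm (rem Z Y u v) \<le> r * w u v powr (2 * \<beta>)"
begin

text \<open>The hypothesis that is bootstrapped. The scale \<open>h\<close> is measured by the
  control, not by time.\<close>

definition rem_bound :: "real \<Rightarrow> real \<Rightarrow> bool" where
  "rem_bound h r \<longleftrightarrow>
     (\<forall>u\<in>D. \<forall>v\<in>D. u \<le> v \<and> w u v \<le> h \<longrightarrow> norm (rem Z Y u v) \<le> r * w u v powr (2 * \<beta>))"

lemma D_in: "u \<in> D \<Longrightarrow> 0 \<le> u" "u \<in> D \<Longrightarrow> u \<le> T"
  using D_sub by auto

lemma grid_bound:
  assumes r: "rem_bound h r" "r * h powr \<beta> \<le> 2 * double_const" "0 \<le> r"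
    and uv: "u \<in> D" "v \<in> D" "u \<le> v" "w u v \<le> h"
  shows "norm (Z v - Z u) \<le> (M + r * h powr \<beta>) * w u v powr \<beta>"
proof -
  have nn: "0 \<le> w u v" using w_nonneg D_in uv by auto
  have "norm (Z v - Z u) \<le> norm (rem Z Y u v) + norm (blinfun_apply (\<sigma> (Z u, Y u)) (X u v))"
    unfolding rem_def by (metis norm_triangle_sub add.commute)
  also have "\<dots> \<le> r * w u v powr (2 * \<beta>) + M * w u v powr \<beta>"
  proof (intro add_mono)
    show "norm (rem Z Y u v) \<le> r * w u v powr (2 * \<beta>)" using r(1) uv unfolding rem_bound_def by blast
    show "norm (blinfun_apply (\<sigma> (Z u, Y u)) (X u v)) \<le> M * w u v powr \<beta>"
      using X_bound[of u v] D_in uv M by (intro order_trans[OF norm_\<sigma>_apply] mult_left_mono) auto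
  qed
  also have "\<dots> = (M + r * w u v powr \<beta>) * w u v powr \<beta>"
    unfolding powr_2\<beta> by (simp add: algebra_simps)
  also have "\<dots> \<le> (M + r * h powr \<beta>) * w u v powr \<beta>"
    using nn uv r \<beta> by (intro mult_right_mono add_left_mono mult_left_mono powr_mono2) auto
  finally show ?thesis .
qed

text \<open>Off \<open>D\<close> nothing is known about the remainder, whereas the growth condition
  on \<open>A\<close> speaks of all times. The assumption \<open>cells\<close> bridges the gap: an
  interval either has the cell bound or, up to two end pieces with the cell bound, has its end
  points in \<open>D\<close>.\<close>

lemma path_bound:
  assumes r: "rem_bound h r" "r * h powr \<beta> \<le> 2 * double_const" "0 \<le> r"
    and ab: "0 \<le> a" "a \<le> b" "b \<le> T" "w a b \<le> h"
  shows "norm (Z b - Z a) \<le> path_const * w a b powr \<beta>"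
proof -
  from cells[OF ab(1-3)] show ?thesis
  proof (elim disjE bexE conjE)
    assume "norm (Z b - Z a) \<le> cell_const * w a b powr \<beta>"
    also have "\<dots> \<le> path_const * w a b powr \<beta>"
      unfolding path_const_def using grid_const cell_const M by (intro mult_right_mono) auto
    finally show ?thesis .
  next
    fix a' b' assume D: "a' \<in> D" "b' \<in> D" and le: "a \<le> a'" "a' \<le> b'" "b' \<le> b"
      and Z: "norm (Z a' - Z a) \<le> cell_const * w a a' powr \<beta>" "norm (Z b - Z b') \<le> cell_const * w b' b powr \<beta>"
    have c0: "0 \<le> cell_const" using cell_const M by linarith
    have "w a' b' \<le> w a b" using le ab by (intro w_mono) auto
    then have "norm (Z b' - Z a') \<le> (M + r * h powr \<beta>) * w a' b' powr \<beta>"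
      using grid_bound[OF r D le(2)] ab by linarith
    also have "\<dots> \<le> grid_const * w a b powr \<beta>"
    proof (rule mult_mono)
      show "M + r * h powr \<beta> \<le> grid_const" using r(2) by (simp add: grid_const_def)
      show "w a' b' powr \<beta> \<le> w a b powr \<beta>" using le ab \<beta> by (intro w_powr_mono) auto
    qed (use grid_const in auto)
    finally have "norm (Z b' - Z a') \<le> grid_const * w a b powr \<beta>" .
    moreover have "norm (Z a' - Z a) \<le> cell_const * w a b powr \<beta>"
      by (rule order_trans[OF Z(1)]) (use le ab \<beta> c0 in \<open>intro mult_left_mono w_powr_mono, auto\<close>)
    moreover have "norm (Z b - Z b') \<le> cell_const * w a b powr \<beta>"
      by (rule order_trans[OF Z(2)]) (use le ab \<beta> c0 in \<open>intro mult_left_mono w_powr_mono, auto\<close>)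
    moreover have "norm (Z b - Z a) \<le> norm (Z a' - Z a) + norm (Z b' - Z a') + norm (Z b - Z b')"
    proof -
      have "Z b - Z a = (Z a' - Z a) + (Z b' - Z a') + (Z b - Z b')" by simp
      then show ?thesis by (simp only: order_trans[OF norm_triangle_ineq add_right_mono[OF norm_triangle_ineq]])
    qed
    ultimately have "norm (Z b - Z a) \<le> cell_const * w a b powr \<beta> + grid_const * w a b powr \<beta> + cell_const * w a b powr \<beta>"
      by linarith
    then show ?thesis unfolding path_const_def by (simp add: algebra_simps)
  qed
qed

text \<open>The condition \<open>h \<le> 1\<close> keeps the argument of \<open>F\<close> below
  \<open>path_const\<close>, so that monotonicity replaces \<open>F\<close> by a constant.\<close>

lemma V_bound:
  assumes r: "rem_bound h r" "r * h powr \<beta> \<le> 2 * double_const" "0 \<le> r"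
    and h: "h \<le> 1" and ab: "0 \<le> a" "a \<le> b" "b \<le> T" "w a b \<le> h"
  shows "V a b \<le> A_const * w a b powr \<beta>"
proof -
  have nn: "0 \<le> w a b" using w_nonneg ab by auto
  have p0: "0 \<le> path_const" using path_const by linarith
  have "norm (Z b' - Z a') \<le> path_const * w a' b' powr \<beta>" if "a \<le> a'" "a' \<le> b'" "b' \<le> b" for a' b'
    using path_bound[OF r, of a' b'] w_mono[of a a' b' b] that ab by auto
  then have "V a b \<le> F (path_const * w a b powr \<beta>) * (path_const * w a b powr \<beta>)"
    by (intro V_le ab p0)
  also have "\<dots> \<le> F path_const * (path_const * w a b powr \<beta>)"
  proof (intro mult_right_mono F_mono)
    have "w a b powr \<beta> \<le> 1" using nn ab h \<beta> by (intro powr_le1) auto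
    then show "path_const * w a b powr \<beta> \<le> path_const" using p0 by (simp add: mult_left_le)
  qed (use p0 in auto)
  finally show ?thesis by (simp add: A_const_def algebra_simps)
qed

end

section \<open>Improving and doubling the remainder bound\<close>

context rough_coefficient
begin

text \<open>The factor at \<open>r\<close> comes from w^(3\<beta>) = w^((1-\<theta>)\<beta>)
  w^((2+\<theta>)\<beta>): the share of the remainder has order 3\<beta>, at least that of the other
  terms, and the surplus is bounded by its value at scale \<open>h\<close>.\<close>

definition defect_const :: "real \<Rightarrow> real \<Rightarrow> real" where
  "defect_const h r = M * grid_const powr (1 + \<theta>) + M * (r * (h powr \<beta>) powr (1 - \<theta>))
     + dim_const * (M\<^sup>2 * ((grid_const + A_const) powr \<theta> + (grid_const + A_const)))"

lemma defect_const_nonneg: "0 \<le> r \<Longrightarrow> 0 \<le> defect_const h r"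
proof -
  assume "0 \<le> r"
  moreover have "0 \<le> dim_const" using dim_const by linarith
  ultimately show ?thesis
    unfolding defect_const_def using M grid_const A_const
    by (intro add_nonneg_nonneg mult_nonneg_nonneg) auto
qed

end

context approx_solution
begin

text \<open>Term by term in \<open>germ_defect\<close>, with a = w^\<beta>: the Taylor error, the
  remainder and the second level difference are of order a^(2+\<theta>). The change of \<sigma> due
  to \<open>Y\<close> is bounded by \<open>V u v\<close> and keeps this control of its own.\<close>

lemma norm_germ_defect:
  assumes r: "rem_bound h r" "r * h powr \<beta> \<le> 2 * double_const" "0 \<le> r" and h: "0 \<le> h" "h \<le> 1"
    and D: "u \<in> D" "x \<in> D" "v \<in> D" and le: "u \<le> x" "x \<le> v" "w u v \<le> h"
  shows "norm (germ Z Y u v - germ Z Y u x - germ Z Y x v)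
    \<le> defect_const h r * w u v powr ((2 + \<theta>) * \<beta>) + M * (V u v * w u v powr \<beta>)"
proof -
  have T: "0 \<le> u" "0 \<le> x" "v \<le> T" "x \<le> T" "u \<le> v" using D_sub D le by auto
  define a where "a = w u v powr \<beta>"
  have w0: "0 \<le> w u v" "w u x \<le> w u v" "w x v \<le> w u v"
    using w_nonneg w_mono T le by auto
  have a: "0 \<le> a" "a \<le> 1" "a \<le> h powr \<beta>"
    unfolding a_def using w0(1) le(3) h \<beta> by (auto intro!: powr_le1 powr_mono2)
  have ux: "w u x powr \<beta> \<le> a" "w u x powr (2 * \<beta>) \<le> a * a" and xv: "w x v powr \<beta> \<le> a" "w x v powr (2 * \<beta>) \<le> a * a"
    unfolding a_def powr_2\<beta>[symmetric] using le T \<beta> by (auto intro!: w_powr_mono)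
  have g: "0 \<le> grid_const" using grid_const by linarith
  have Zux: "norm (Z x - Z u) \<le> grid_const * a"
  proof -
    have "norm (Z x - Z u) \<le> (M + r * h powr \<beta>) * w u x powr \<beta>"
      using grid_bound[OF r D(1,2) le(1)] w0 le(3) by linarith
    also have "\<dots> \<le> grid_const * a"
      by (rule mult_mono) (use r(2) ux g in \<open>auto simp: grid_const_def\<close>)
    finally show ?thesis .
  qed
  have Vux: "V u x \<le> A_const * a"
  proof -
    have "V u x \<le> A_const * w u x powr \<beta>"
      using V_bound[OF r h(2) T(1) le(1) T(4)] w0 le(3) by linarith
    also have "\<dots> \<le> A_const * a" using A_const ux by (intro mult_left_mono) auto
    finally show ?thesis .
  qed
  have V0: "0 \<le> V u x" "V u x \<le> V u v"
    using superadditive_on_nonneg[OF V, of u x] superadditive_on_mono[OF V, of u u x v] T le by auto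
  have Yux: "norm (Y x - Y u) \<le> V u x" using Y_le_V T le by auto
  define d where "d = norm ((Z u, Y u) - (Z x, Y x))"
  have d: "0 \<le> d" "d \<le> (grid_const + A_const) * a"
  proof -
    have "d \<le> norm (Z x - Z u) + norm (Y x - Y u)"
      using norm_Pair_le[of "Z u - Z x" "Y u - Y x"] by (simp add: d_def norm_minus_commute)
    then show "d \<le> (grid_const + A_const) * a" using Zux Vux Yux by (simp add: algebra_simps)
  qed (simp add: d_def)
  \<comment> \<open>Since \<open>a\<close> is at most 1, the linear part of the coefficient
    difference is absorbed in the \<theta>-power.\<close>
  have a\<theta>: "a \<le> a powr \<theta>" using a \<theta> powr_mono'[of \<theta> 1 a] by auto
  define m where "m = (grid_const + A_const) powr \<theta> + (grid_const + A_const)"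
  have d\<theta>: "d powr \<theta> + d \<le> m * a powr \<theta>"
  proof -
    have "d powr \<theta> \<le> ((grid_const + A_const) * a) powr \<theta>" using d \<theta> by (intro powr_mono2) auto
    also have "\<dots> = (grid_const + A_const) powr \<theta> * a powr \<theta>" using g A_const a by (simp add: powr_mult)
    finally have "d powr \<theta> \<le> (grid_const + A_const) powr \<theta> * a powr \<theta>" .
    moreover have "d \<le> (grid_const + A_const) * a powr \<theta>"
      using d(2) mult_left_mono[OF a\<theta>, of "grid_const + A_const"] g A_const by linarith
    ultimately show ?thesis by (simp add: m_def algebra_simps)
  qed
  have a3: "a powr \<theta> * (a * a) = w u v powr ((2 + \<theta>) * \<beta>)"
  proof -
    have "a powr \<theta> * (a * a) = w u v powr (\<theta> * \<beta> + 2 * \<beta>)"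
      unfolding a_def powr_add powr_powr powr_2\<beta> by (simp add: mult.commute)
    then show ?thesis by (simp add: algebra_simps)
  qed
  let ?P = "partial1 \<sigma> (Z u) (Y u)"
  have 1: "norm (level2 (Z u) (Y u) (XX x v) - level2 (Z x) (Y x) (XX x v))
     \<le> dim_const * (M\<^sup>2 * m) * w u v powr ((2 + \<theta>) * \<beta>)"
  proof -
    have dc: "0 \<le> dim_const" using dim_const by linarith
    have "norm (level2 (Z u) (Y u) (XX x v) - level2 (Z x) (Y x) (XX x v))
      \<le> dim_const * (M\<^sup>2 * (d powr \<theta> + d)) * norm (XX x v)"
      unfolding d_def by (rule norm_level2_diff)
    also have "\<dots> \<le> dim_const * (M\<^sup>2 * (m * a powr \<theta>)) * (a * a)"
    proof (rule mult_mono)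
      show "norm (XX x v) \<le> a * a" using XX_bound[of x v] xv(2) T le by auto
      show "dim_const * (M\<^sup>2 * (d powr \<theta> + d)) \<le> dim_const * (M\<^sup>2 * (m * a powr \<theta>))"
        using dc d\<theta> by (intro mult_left_mono) auto
    qed (use dc d(1) d\<theta> a in \<open>auto intro!: mult_nonneg_nonneg simp: m_def\<close>, use g A_const in auto)
    finally show ?thesis unfolding a3[symmetric] by (simp add: algebra_simps)
  qed
  have 2: "norm (blinfun_apply ((\<sigma> (Z x, Y x) - \<sigma> (Z x, Y u)) + (\<sigma> (Z x, Y u) - \<sigma> (Z u, Y u) - ?P (Z x - Z u))
       + ?P (rem Z Y u x)) (X x v))
     \<le> M * (V u v * a) + (M * grid_const powr (1 + \<theta>) + M * (r * (h powr \<beta>) powr (1 - \<theta>))) * w u v powr ((2 + \<theta>) * \<beta>)"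
  proof -
    have s1: "norm (\<sigma> (Z x, Y x) - \<sigma> (Z x, Y u)) \<le> M * V u v"
    proof -
      have "norm (\<sigma> (Z x, Y x) - \<sigma> (Z x, Y u)) \<le> M * norm (Y x - Y u)"
        using \<sigma>_lipschitz[of "(Z x, Y x)" "(Z x, Y u)"] by (simp add: norm_Pair)
      also have "\<dots> \<le> M * V u v" using Yux V0 M by (intro mult_left_mono) auto
      finally show ?thesis .
    qed
    have s2: "norm (\<sigma> (Z x, Y u) - \<sigma> (Z u, Y u) - ?P (Z x - Z u)) \<le> M * (grid_const powr (1 + \<theta>) * (a * a powr \<theta>))"
    proof -
      have "norm (Z x - Z u) powr (1 + \<theta>) \<le> (grid_const * a) powr (1 + \<theta>)"
        using Zux \<theta> by (intro powr_mono2) auto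
      also have "\<dots> = grid_const powr (1 + \<theta>) * (a * a powr \<theta>)"
        using g a by (simp add: powr_mult powr_add)
      finally have "norm (Z x - Z u) powr (1 + \<theta>) \<le> grid_const powr (1 + \<theta>) * (a * a powr \<theta>)" .
      then show ?thesis using M by (intro order_trans[OF partial1_taylor] mult_left_mono) auto
    qed
    have s3: "norm (?P (rem Z Y u x)) \<le> M * (r * (h powr \<beta>) powr (1 - \<theta>) * (a * a powr \<theta>))"
    proof -
      have "norm (rem Z Y u x) \<le> r * w u x powr (2 * \<beta>)"
        using r(1) D le w0 unfolding rem_bound_def by auto
      also have "\<dots> \<le> r * (a * a)" using ux r by (intro mult_left_mono) auto
      also have "\<dots> = r * a powr (1 - \<theta>) * (a * a powr \<theta>)"
      proof -
        have "a powr (1 - \<theta>) * a powr \<theta> = a" using a(1) by (simp flip: powr_add)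
        moreover have "r * a powr (1 - \<theta>) * (a * a powr \<theta>) = r * (a * (a powr (1 - \<theta>) * a powr \<theta>))"
          by (simp only: ac_simps)
        ultimately show ?thesis by simp
      qed
      also have "\<dots> \<le> r * (h powr \<beta>) powr (1 - \<theta>) * (a * a powr \<theta>)"
        using a r(3) \<theta> by (intro mult_right_mono mult_left_mono powr_mono2) auto
      finally show ?thesis using M by (intro order_trans[OF partial1_bound] mult_left_mono) auto
    qed
    have "norm ((\<sigma> (Z x, Y x) - \<sigma> (Z x, Y u)) + (\<sigma> (Z x, Y u) - \<sigma> (Z u, Y u) - ?P (Z x - Z u)) + ?P (rem Z Y u x))
      \<le> M * V u v + M * (grid_const powr (1 + \<theta>) * (a * a powr \<theta>)) + M * (r * (h powr \<beta>) powr (1 - \<theta>) * (a * a powr \<theta>))"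
      by (intro norm_triangle_mono s1 s2 s3)
    moreover have "norm (X x v) \<le> a" using X_bound[of x v] xv(1) T le by auto
    ultimately have "norm (blinfun_apply ((\<sigma> (Z x, Y x) - \<sigma> (Z x, Y u)) + (\<sigma> (Z x, Y u) - \<sigma> (Z u, Y u) - ?P (Z x - Z u))
       + ?P (rem Z Y u x)) (X x v)) \<le>
       (M * V u v + M * (grid_const powr (1 + \<theta>) * (a * a powr \<theta>)) + M * (r * (h powr \<beta>) powr (1 - \<theta>) * (a * a powr \<theta>))) * a"
      by (intro order_trans[OF norm_blinfun] mult_mono) (auto intro: order_trans[OF norm_ge_zero])
    then show ?thesis unfolding a3[symmetric] by (simp add: algebra_simps)
  qed
  have "norm (germ Z Y u v - germ Z Y u x - germ Z Y x v) \<le>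
     dim_const * (M\<^sup>2 * m) * w u v powr ((2 + \<theta>) * \<beta>) +
     (M * (V u v * a) + (M * grid_const powr (1 + \<theta>) + M * (r * (h powr \<beta>) powr (1 - \<theta>))) * w u v powr ((2 + \<theta>) * \<beta>))"
    unfolding germ_defect[OF T(1) le(1,2) T(3)] by (rule order_trans[OF norm_triangle_ineq4 add_mono[OF 1 2]])
  then show ?thesis
    by (simp add: defect_const_def m_def a_def algebra_simps)
qed

text \<open>By \<open>germ_sums\<close> some chain in \<open>D\<close> has a germ sum within any
  \<epsilon> of the increment of \<open>Z\<close>, and the sewing estimate does not see the number
  of points. Grids, where the sums are exact, and limits of partition sums are thus covered
  alike.\<close>

lemma norm_germ_error:
  assumes r: "rem_bound h r" "r * h powr \<beta> \<le> 2 * double_const" "0 \<le> r" and h: "0 \<le> h" "h \<le> 1"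
    and D: "u \<in> D" "v \<in> D" and le: "u \<le> v" "w u v \<le> h"
  shows "norm (Z v - Z u - germ Z Y u v)
    \<le> sew_const ((2 + \<theta>) * \<beta>) * (defect_const h r * w u v powr ((2 + \<theta>) * \<beta>))
      + sew_const (1 + \<beta>) * (M * (V u v * w u v powr \<beta>))"
proof (rule field_le_epsilon)
  fix \<epsilon> :: real assume "0 < \<epsilon>"
  then obtain t n where t: "chain (D \<inter> {u..v}) t n" "t 0 = u" "t n = v"
    "norm (Z v - Z u - (\<Sum>i<n. germ Z Y (t i) (t (Suc i)))) < \<epsilon>"
    using germ_sums[OF D le(1)] by blast
  have T: "0 \<le> u" "v \<le> T" using D_sub D by auto
  have sub: "D \<inter> {u..v} \<subseteq> {0..T}" using D_sub by auto
  have "norm ((\<Sum>i<n. germ Z Y (t i) (t (Suc i))) - germ Z Y (t 0) (t n))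
    \<le> sew_const ((2 + \<theta>) * \<beta>) * (defect_const h r * w (t 0) (t n) powr ((2 + \<theta>) * \<beta>))
      + sew_const (1 + \<beta>) * (M * (V (t 0) (t n) * w (t 0) (t n) powr \<beta>))"
  proof (rule sewing_estimate[OF superadditive_on_subset[OF w sub] superadditive_on_subset[OF V sub]])
    show "0 \<le> defect_const h r"
      by (rule defect_const_nonneg[OF r(3)])
    show "norm (germ Z Y a b - germ Z Y a x - germ Z Y x b)
      \<le> defect_const h r * w a b powr ((2 + \<theta>) * \<beta>) + M * (V a b * w a b powr \<beta>)"
      if "a \<in> D \<inter> {u..v}" "x \<in> D \<inter> {u..v}" "b \<in> D \<inter> {u..v}" "a \<le> x" "x \<le> b" for a x b
      using that T le(2) w_mono[of u a b v] by (intro norm_germ_defect[OF r h]) auto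
    show "germ Z Y a a = 0" if "a \<in> D \<inter> {u..v}" for a
      using that sub by (intro germ_refl) auto
    show "chain (D \<inter> {u..v}) t n" by (rule t(1))
  qed (use M q \<beta> in auto)
  moreover have "norm (Z v - Z u - germ Z Y u v) \<le> norm (Z v - Z u - (\<Sum>i<n. germ Z Y (t i) (t (Suc i))))
      + norm ((\<Sum>i<n. germ Z Y (t i) (t (Suc i))) - germ Z Y u v)"
  proof -
    have "norm (a - c) \<le> norm (a - b) + norm (b - c)" for a b c :: "real^'n"
      using norm_triangle_ineq[of "a - b" "b - c"] by simp
    then show ?thesis .
  qed
  ultimately show "norm (Z v - Z u - germ Z Y u v)
    \<le> sew_const ((2 + \<theta>) * \<beta>) * (defect_const h r * w u v powr ((2 + \<theta>) * \<beta>))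
      + sew_const (1 + \<beta>) * (M * (V u v * w u v powr \<beta>)) + \<epsilon>"
    using t(2-4) by simp
qed

text \<open>The \<theta>-power of h^\<beta> completes its (1-\<theta>)-power to h^\<beta>, so
  \<open>r\<close> occurs only in the product \<open>r * h powr \<beta>\<close>, which is bounded by
  hypothesis.\<close>

lemma defect_const_le:
  assumes "r * h powr \<beta> \<le> 2 * double_const" "0 \<le> r" "0 < h" "h \<le> 1"
  shows "defect_const h r * (h powr \<beta>) powr \<theta> \<le> smooth_const"
proof -
  define H where "H = h powr \<beta>"
  have H: "0 < H" "H powr \<theta> \<le> 1" unfolding H_def using assms \<beta> \<theta> by (auto intro!: powr_le1)
  define m where "m = M * grid_const powr (1 + \<theta>) + dim_const * (M\<^sup>2 * ((grid_const + A_const) powr \<theta> + (grid_const + A_const)))"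
  have "0 \<le> dim_const" using dim_const by linarith
  then have m: "0 \<le> m"
    unfolding m_def using M grid_const A_const by (intro add_nonneg_nonneg mult_nonneg_nonneg) auto
  have "defect_const h r * H powr \<theta> = m * H powr \<theta> + M * (r * (H powr (1 - \<theta>) * H powr \<theta>))"
    by (simp add: defect_const_def m_def H_def algebra_simps)
  also have "H powr (1 - \<theta>) * H powr \<theta> = H" using H by (simp flip: powr_add)
  also have "m * H powr \<theta> + M * (r * H) \<le> m * 1 + M * (2 * double_const)"
    using m H M assms(1) by (intro add_mono mult_left_mono) (auto simp: H_def)
  also have "\<dots> = smooth_const" by (simp add: smooth_const_def m_def)
  finally show ?thesis by (simp add: H_def)
qed

text \<open>The gain is that the new constant depends neither on \<open>r\<close> nor on
  \<open>h\<close>. In the sewing error \<open>defect_const\<close> is tamed by the spare power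
  w^(\<theta>\<beta>), and the variation, now that it has been sewn, may be replaced by its bound
  \<open>A_const * w powr \<beta>\<close>.\<close>

lemma rem_bound_improve:
  assumes r: "rem_bound h r" "r * h powr \<beta> \<le> 2 * double_const" "0 \<le> r" and h: "0 < h" "h \<le> 1"
  shows "rem_bound h rem_const"
  unfolding rem_bound_def
proof (intro ballI impI, elim conjE)
  fix u v assume D: "u \<in> D" "v \<in> D" and le: "u \<le> v" "w u v \<le> h"
  have T: "0 \<le> u" "v \<le> T" using D_sub D by auto
  have w0: "0 \<le> w u v" using w_nonneg T le by auto
  define a where "a = w u v powr (2 * \<beta>)"
  have q1: "w u v powr ((2 + \<theta>) * \<beta>) = (w u v powr \<beta>) powr \<theta> * a"
    unfolding a_def by (simp add: powr_powr algebra_simps flip: powr_add)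
  have "defect_const h r * ((w u v powr \<beta>) powr \<theta> * a) \<le> defect_const h r * (h powr \<beta>) powr \<theta> * a"
  proof -
    have "0 \<le> defect_const h r" by (rule defect_const_nonneg[OF r(3)])
    moreover have "(w u v powr \<beta>) powr \<theta> \<le> (h powr \<beta>) powr \<theta>"
      using w0 le \<beta> \<theta> by (intro powr_mono2) auto
    ultimately show ?thesis by (simp add: a_def mult_left_mono mult_right_mono mult.assoc)
  qed
  also have "\<dots> \<le> smooth_const * a"
    using defect_const_le[OF r(2,3) h] by (intro mult_right_mono) (auto simp: a_def)
  finally have 1: "defect_const h r * w u v powr ((2 + \<theta>) * \<beta>) \<le> smooth_const * a" unfolding q1 .
  have "V u v * w u v powr \<beta> \<le> A_const * w u v powr \<beta> * w u v powr \<beta>"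
    using V_bound[OF r h(2) T(1) le(1) T(2) le(2)] by (intro mult_right_mono) auto
  then have 2: "M * (V u v * w u v powr \<beta>) \<le> M * A_const * a"
    using M by (simp add: a_def powr_2\<beta> mult.assoc)
  have 3: "norm (level2 (Z u) (Y u) (XX u v)) \<le> dim_const * M\<^sup>2 * a"
    unfolding a_def using XX_bound[of u v] T le dim_const M
    by (intro order_trans[OF norm_level2] mult_left_mono) auto
  have "rem Z Y u v = (Z v - Z u - germ Z Y u v) + level2 (Z u) (Y u) (XX u v)"
    by (simp add: rem_def germ_def)
  then have "norm (rem Z Y u v) \<le> norm (Z v - Z u - germ Z Y u v) + norm (level2 (Z u) (Y u) (XX u v))"
    by (simp only: norm_triangle_ineq)
  also have "\<dots> \<le> (sew_const ((2 + \<theta>) * \<beta>) * (smooth_const * a) + sew_const (1 + \<beta>) * (M * A_const * a)) + dim_const * M\<^sup>2 * a"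
  proof (rule add_mono[OF _ 3])
    have "sew_const ((2 + \<theta>) * \<beta>) * (defect_const h r * w u v powr ((2 + \<theta>) * \<beta>))
      + sew_const (1 + \<beta>) * (M * (V u v * w u v powr \<beta>))
      \<le> sew_const ((2 + \<theta>) * \<beta>) * (smooth_const * a) + sew_const (1 + \<beta>) * (M * A_const * a)"
      by (intro add_mono mult_left_mono 1 2 sew_const_nonneg q) (use \<beta> in auto)
    then show "norm (Z v - Z u - germ Z Y u v) \<le>
      sew_const ((2 + \<theta>) * \<beta>) * (smooth_const * a) + sew_const (1 + \<beta>) * (M * A_const * a)"
      using norm_germ_error[OF r less_imp_le[OF h(1)] h(2) D le] by linarith
  qed
  also have "\<dots> = rem_const * a" by (simp add: rem_const_def algebra_simps)
  finally show "norm (rem Z Y u v) \<le> rem_const * w u v powr (2 * \<beta>)" by (simp add: a_def)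
qed

text \<open>An interval is halved in the control. On the outer pieces the bound at scale
  \<open>h\<close> applies; the middle piece given by \<open>halving\<close> is there because a grid
  has no exact midpoint. The triangle inequality then yields
  \<open>double_const * w powr \<beta>\<close>, of poor order but enough to apply
  \<open>rem_bound_improve\<close> at scale \<open>2 * h\<close>.\<close>

lemma rem_bound_double:
  assumes r: "rem_bound h rem_const" and h: "0 < h" "2 * h \<le> local_scale"
  shows "rem_bound (2 * h) rem_const"
proof -
  have R: "rem_const * h powr \<beta> \<le> 1" "rem_const * (2 * h) powr \<beta> \<le> 1"
  proof -
    have "rem_const * (2 * h) powr \<beta> \<le> rem_const * local_scale powr \<beta>"
      using h \<beta> rem_const by (intro mult_left_mono powr_mono2) auto
    then show 2: "rem_const * (2 * h) powr \<beta> \<le> 1" using local_scale by simp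
    have "rem_const * h powr \<beta> \<le> rem_const * (2 * h) powr \<beta>"
      using h \<beta> rem_const by (intro mult_left_mono powr_mono2) auto
    then show "rem_const * h powr \<beta> \<le> 1" using 2 by linarith
  qed
  have R': "rem_const * h powr \<beta> \<le> 2 * double_const" using R double_const by linarith
  have r0: "0 \<le> rem_const" using rem_const by linarith
  have c0: "0 \<le> cell_const" using cell_const M by linarith
  \<comment> \<open>On intervals of control between \<open>h\<close> and \<open>2 * h\<close> a
    bound of order \<beta> becomes one of order 2\<beta> at the cost of h^(-\<beta>).\<close>
  define r' where "r' = max rem_const (double_const * h powr (- \<beta>))"
  have "rem_bound (2 * h) r'"
    unfolding rem_bound_def
  proof (intro ballI impI, elim conjE)
    fix u v assume D: "u \<in> D" "v \<in> D" and le: "u \<le> v" "w u v \<le> 2 * h"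
    have T: "0 \<le> u" "v \<le> T" using D_sub D by auto
    show "norm (rem Z Y u v) \<le> r' * w u v powr (2 * \<beta>)"
    proof (cases "w u v \<le> h")
      case True
      then have "norm (rem Z Y u v) \<le> rem_const * w u v powr (2 * \<beta>)"
        using r D le unfolding rem_bound_def by blast
      also have "\<dots> \<le> r' * w u v powr (2 * \<beta>)" by (intro mult_right_mono) (auto simp: r'_def)
      finally show ?thesis .
    next
      case False
      define a where "a = w u v powr \<beta>"
      obtain x y where xy: "x \<in> D" "y \<in> D" "u \<le> x" "x \<le> y" "y \<le> v"
        "w u x \<le> w u v / 2" "w y v \<le> w u v / 2" "norm (Z y - Z x) \<le> cell_const * w x y powr \<beta>"
        using halving[OF D le(1)] by blast
      have "norm (Z x - Z u) \<le> (M + rem_const * h powr \<beta>) * w u x powr \<beta>"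
        using grid_bound[OF r R' r0 D(1) xy(1,3)] xy(6) le(2) by linarith
      also have "\<dots> \<le> (M + 1) * a"
        unfolding a_def using R(1) xy T M \<beta> by (intro mult_mono w_powr_mono) auto
      finally have 1: "norm (Z x - Z u) \<le> (M + 1) * a" .
      have "norm (Z v - Z y) \<le> (M + rem_const * h powr \<beta>) * w y v powr \<beta>"
        using grid_bound[OF r R' r0 xy(2) D(2) xy(5)] xy(7) le(2) by linarith
      also have "\<dots> \<le> (M + 1) * a"
        unfolding a_def using R(1) xy T M \<beta> by (intro mult_mono w_powr_mono) auto
      finally have 2: "norm (Z v - Z y) \<le> (M + 1) * a" .
      have 3: "norm (Z y - Z x) \<le> cell_const * a"
        unfolding a_def by (rule order_trans[OF xy(8)]) (use xy T c0 \<beta> in \<open>auto intro!: mult_left_mono w_powr_mono\<close>)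
      have 4: "norm (blinfun_apply (\<sigma> (Z u, Y u)) (X u v)) \<le> M * a"
        unfolding a_def using X_bound[of u v] T le M by (intro order_trans[OF norm_\<sigma>_apply] mult_left_mono) auto
      have "rem Z Y u v = (Z x - Z u) + (Z v - Z y) + (Z y - Z x) + - blinfun_apply (\<sigma> (Z u, Y u)) (X u v)"
        by (simp add: rem_def)
      also have "norm \<dots> \<le> (M + 1) * a + (M + 1) * a + cell_const * a + M * a"
        by (intro norm_triangle_mono 1 2 3) (use 4 in simp)
      also have "\<dots> = double_const * a" by (simp add: double_const_def algebra_simps)
      also have "\<dots> \<le> double_const * (h powr (- \<beta>) * w u v powr (2 * \<beta>))"
      proof (rule mult_left_mono)
        have "h powr \<beta> \<le> a" unfolding a_def using False h \<beta> by (intro powr_mono2) auto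
        then have "1 \<le> h powr (- \<beta>) * a" using h by (simp add: powr_minus field_simps)
        then have "1 * a \<le> h powr (- \<beta>) * a * a" by (intro mult_right_mono) (auto simp: a_def)
        then show "a \<le> h powr (- \<beta>) * w u v powr (2 * \<beta>)" by (simp add: a_def powr_2\<beta> mult.assoc)
      qed (use double_const in auto)
      also have "\<dots> \<le> r' * w u v powr (2 * \<beta>)"
        unfolding mult.assoc[symmetric] by (intro mult_right_mono) (auto simp: r'_def)
      finally show ?thesis .
    qed
  qed
  \<comment> \<open>Doubling \<open>h\<close> multiplies h^\<beta> by at most 2, which is why the
    tolerance is \<open>2 * double_const\<close>.\<close>
  moreover have "r' * (2 * h) powr \<beta> \<le> 2 * double_const"
  proof -
    have "double_const * h powr (- \<beta>) * (2 * h) powr \<beta> = double_const * 2 powr \<beta>"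
      using h by (simp add: powr_mult powr_minus field_simps)
    also have "\<dots> \<le> double_const * 2 powr 1" using \<beta> double_const by (intro mult_left_mono powr_mono) auto
    finally have "double_const * h powr (- \<beta>) * (2 * h) powr \<beta> \<le> 2 * double_const" by simp
    then show ?thesis using R(2) double_const by (auto simp: r'_def max_def)
  qed
  moreover have "0 \<le> r'" using r0 by (simp add: r'_def)
  ultimately show ?thesis
    using h local_scale by (intro rem_bound_improve) auto
qed

text \<open>The unknown finite constant only decides at how small a scale the argument starts. Each
  doubling reproduces \<open>rem_const\<close>, so the number of doublings, which does depend on the
  solution, leaves no trace.\<close>

theorem rem_bound_local: "rem_bound local_scale rem_const"
proof -
  obtain r0 where r0: "\<forall>u\<in>D. \<forall>v\<in>D. u \<le> v \<longrightarrow> norm (rem Z Y u v) \<le> r0 * w u v powr (2 * \<beta>)"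
    using rem_finite by blast
  define r where "r = max r0 0"
  have "r0 * x powr (2 * \<beta>) \<le> r * x powr (2 * \<beta>)" for x
    by (intro mult_right_mono) (auto simp: r_def)
  then have r: "rem_bound h r" for h
    unfolding rem_bound_def using r0 order_trans by blast
  have "0 \<le> r" by (simp add: r_def)
  have "(\<lambda>k. r * (local_scale / 2 ^ k) powr \<beta>) \<longlonglongrightarrow> r * 0 powr \<beta>"
    by (intro tendsto_intros LIMSEQ_divide_realpow_zero) (use \<beta> local_scale in auto)
  then have "\<forall>\<^sub>F k in sequentially. r * (local_scale / 2 ^ k) powr \<beta> < 1"
    using \<beta> by (intro order_tendstoD) auto
  then obtain k where k: "r * (local_scale / 2 ^ k) powr \<beta> < 1"
    by (auto simp: eventually_sequentially)
  have "rem_bound (local_scale / 2 ^ k) rem_const"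
  proof (rule rem_bound_improve[OF r _ \<open>0 \<le> r\<close>])
    show "r * (local_scale / 2 ^ k) powr \<beta> \<le> 2 * double_const" using k double_const by linarith
    show "0 < local_scale / 2 ^ k" "local_scale / 2 ^ k \<le> 1"
      using local_scale by (auto simp: divide_le_eq intro: order_trans[OF local_scale(2)])
  qed
  then show ?thesis
  proof (induction k)
    case (Suc k)
    have "rem_bound (2 * (local_scale / 2 ^ Suc k)) rem_const"
      using Suc.prems by (rule rem_bound_double) (use local_scale in \<open>auto simp: divide_le_eq\<close>)
    then show ?case using Suc.IH by simp
  qed simp
qed

lemma rem_const_small: "rem_const * local_scale powr \<beta> \<le> 2 * double_const" "0 \<le> rem_const"
  using local_scale double_const rem_const by auto

lemmas path_bound_local = path_bound[OF rem_bound_local rem_const_small]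
lemmas V_bound_local = V_bound[OF rem_bound_local rem_const_small local_scale(2)]
lemmas germ_error_local = norm_germ_error[OF rem_bound_local rem_const_small less_imp_le[OF local_scale(1)] local_scale(2)]

end

section \<open>From local to global bounds\<close>

context rough_driver
begin

text \<open>Uniform continuity on the compact triangle, compared with the diagonal, where
  superadditivity forces the value 0.\<close>

lemma w_vanishing: "vanishing_on {0..T} w"
  unfolding vanishing_on_def
proof (intro allI impI)
  fix \<epsilon> :: real assume \<epsilon>: "0 < \<epsilon>"
  define S where "S = {(s, t). 0 \<le> s \<and> s \<le> t \<and> t \<le> T}"
  have "S = ({0..T} \<times> {0..T}) \<inter> {p. fst p \<le> snd p}" by (auto simp: S_def)
  moreover have "closed {p :: real \<times> real. fst p \<le> snd p}"
    by (intro closed_Collect_le continuous_intros)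
  ultimately have "compact S" by (simp add: compact_Int_closed compact_Times)
  then have "uniformly_continuous_on S (\<lambda>(s, t). w s t)"
    using w_cont compact_uniformly_continuous unfolding S_def by blast
  then obtain \<delta> where \<delta>: "0 < \<delta>"
    "\<And>p p'. p \<in> S \<Longrightarrow> p' \<in> S \<Longrightarrow> dist p' p < \<delta> \<Longrightarrow> dist (case p' of (s, t) \<Rightarrow> w s t) (case p of (s, t) \<Rightarrow> w s t) < \<epsilon>"
    using \<epsilon> unfolding uniformly_continuous_on_def by meson
  have "w u v < \<epsilon>" if "u \<in> {0..T}" "v \<in> {0..T}" "u \<le> v" "v - u < \<delta>" for u v
  proof -
    have "dist (u, v) (u, u) < \<delta>" using that by (simp add: dist_Pair_Pair dist_real_def)
    then have "dist (w u v) (w u u) < \<epsilon>" using \<delta>(2)[of "(u, u)" "(u, v)"] that by (auto simp: S_def)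
    then show ?thesis using superadditive_on_refl[OF w that(1)] by (simp add: dist_real_def)
  qed
  then show "\<exists>\<delta>>0. \<forall>u\<in>{0..T}. \<forall>v\<in>{0..T}. u \<le> v \<and> v - u < \<delta> \<longrightarrow> w u v < \<epsilon>"
    using \<delta>(1) by blast
qed

text \<open>The intermediate value theorem balances \<open>w u c\<close> and \<open>w c v\<close>;
  by superadditivity two equal parts are at most half each.\<close>

lemma w_midpoint:
  assumes "0 \<le> u" "u \<le> v" "v \<le> T"
  obtains c where "u \<le> c" "c \<le> v" "w u c \<le> w u v / 2" "w c v \<le> w u v / 2"
proof -
  define f where "f c = w u c - w c v" for c
  have 1: "continuous_on {u..v} (\<lambda>c. (\<lambda>(s, t). w s t) (u, c))"
    by (rule continuous_on_compose2[OF w_cont]) (use assms in \<open>auto intro!: continuous_intros\<close>)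
  have 2: "continuous_on {u..v} (\<lambda>c. (\<lambda>(s, t). w s t) (c, v))"
    by (rule continuous_on_compose2[OF w_cont]) (use assms in \<open>auto intro!: continuous_intros\<close>)
  have "continuous_on {u..v} f"
    unfolding f_def using continuous_on_diff[OF 1 2] by simp
  moreover have "f u \<le> 0" "0 \<le> f v"
    using assms superadditive_on_refl[OF w] w_nonneg by (auto simp: f_def)
  ultimately obtain c where c: "u \<le> c" "c \<le> v" "f c = 0"
    using IVT'[of f u 0 v] assms by auto
  have "w u c + w c v \<le> w u v" using superadditive_onD[OF w, of u c v] assms c by auto
  then show ?thesis using that[OF c(1,2)] c(3) by (simp add: f_def)
qed

text \<open>Bisection in the control covers an interval of control at most 2^k h by 2^k pieces of
  control at most h, so \<phi> grows at most linearly in \<open>w\<close>. Linear growth is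
  converted to the power \<beta> by bounding w^(1-\<beta>) by 1 + w(0,T); this is where that factor
  arises.\<close>

lemma subadditive_growth:
  assumes loc: "\<And>a b. 0 \<le> a \<Longrightarrow> a \<le> b \<Longrightarrow> b \<le> T \<Longrightarrow> w a b \<le> h \<Longrightarrow> \<phi> a b \<le> K * w a b powr \<beta>"
    and sub: "\<And>a c b. 0 \<le> a \<Longrightarrow> a \<le> c \<Longrightarrow> c \<le> b \<Longrightarrow> b \<le> T \<Longrightarrow> \<phi> a b \<le> \<phi> a c + \<phi> c b"
    and h: "0 < h" "h \<le> 1" and K: "0 \<le> K" and ab: "0 \<le> a" "a \<le> b" "b \<le> T"
  shows "\<phi> a b \<le> 2 * K * h powr (\<beta> - 1) * (1 + w 0 T) * w a b powr \<beta>"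
proof -
  have double: "w a b \<le> 2 ^ k * h \<Longrightarrow> \<phi> a b \<le> 2 ^ k * (K * h powr \<beta>)" if "0 \<le> a" "a \<le> b" "b \<le> T" for k a b
    using that
  proof (induction k arbitrary: a b)
    case 0
    then have "\<phi> a b \<le> K * w a b powr \<beta>" using loc by simp
    also have "\<dots> \<le> K * h powr \<beta>"
      using 0 K \<beta> w_nonneg by (intro mult_left_mono powr_mono2) auto
    finally show ?case by simp
  next
    case (Suc k)
    obtain c where c: "a \<le> c" "c \<le> b" "w a c \<le> w a b / 2" "w c b \<le> w a b / 2"
      using w_midpoint[OF Suc.prems(2-4)] .
    have "\<phi> a c \<le> 2 ^ k * (K * h powr \<beta>)" "\<phi> c b \<le> 2 ^ k * (K * h powr \<beta>)"
      using Suc.IH[of a c] Suc.IH[of c b] Suc.prems c by auto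
    then show ?case using sub[of a c b] Suc.prems c by simp
  qed
  have w0: "0 \<le> w a b" "w a b \<le> w 0 T" "0 \<le> w 0 T" using w_nonneg w_mono[of 0 a b T] ab T by auto
  have hb: "1 \<le> h powr (\<beta> - 1)" using powr_mono2'[of "\<beta> - 1" h 1] h \<beta> by simp
  show ?thesis
  proof (cases "w a b \<le> h")
    case True
    have "1 * 1 \<le> 2 * h powr (\<beta> - 1) * (1 + w 0 T)"
      using hb w0 by (intro mult_mono) auto
    then have "K * w a b powr \<beta> * 1 \<le> K * w a b powr \<beta> * (2 * h powr (\<beta> - 1) * (1 + w 0 T))"
      using K by (intro mult_left_mono) auto
    then show ?thesis using loc[OF ab True] by (simp add: algebra_simps)
  next
    case False
    then have wpos: "0 < w a b" using h by linarith
    have "\<exists>k. w a b \<le> 2 ^ k * h"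
      using real_arch_pow[of 2 "w a b / h"] h by (auto simp: divide_less_eq intro: less_imp_le)
    \<comment> \<open>The least such exponent satisfies 2^k \<le> 2 w / h: bisection overshoots by
      at most a factor 2.\<close>
    then have k: "w a b \<le> 2 ^ (LEAST k. w a b \<le> 2 ^ k * h) * h"
      by (rule LeastI_ex)
    define k where "k = (LEAST k. w a b \<le> 2 ^ k * h)"
    have k1: "w a b \<le> 2 ^ k * h" using k by (simp add: k_def)
    have "k \<noteq> 0" using k1 False by (cases k) auto
    then obtain j where j: "k = Suc j" by (cases k) auto
    have "\<not> w a b \<le> 2 ^ j * h" using not_less_Least[of j "\<lambda>k. w a b \<le> 2 ^ k * h"] j by (simp add: k_def)
    then have pow: "2 ^ k \<le> 2 * (w a b / h)" using j h by (simp add: field_simps)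
    have "\<phi> a b \<le> 2 ^ k * (K * h powr \<beta>)" by (rule double[OF ab k1])
    also have "\<dots> \<le> 2 * (w a b / h) * (K * h powr \<beta>)" using pow K by (intro mult_right_mono) auto
    also have "\<dots> = 2 * K * h powr (\<beta> - 1) * w a b"
      using h by (simp add: powr_diff)
    also have "\<dots> \<le> 2 * K * h powr (\<beta> - 1) * ((1 + w 0 T) * w a b powr \<beta>)"
    proof (rule mult_left_mono)
      have "w a b = w a b powr (1 - \<beta>) * w a b powr \<beta>" using wpos by (simp flip: powr_add)
      also have "\<dots> \<le> (1 + w 0 T) powr 1 * w a b powr \<beta>"
      proof (rule mult_right_mono)
        have "w a b powr (1 - \<beta>) \<le> (1 + w 0 T) powr (1 - \<beta>)" using w0 \<beta> by (intro powr_mono2) auto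
        also have "\<dots> \<le> (1 + w 0 T) powr 1" using w0 \<beta> by (intro powr_mono) auto
        finally show "w a b powr (1 - \<beta>) \<le> (1 + w 0 T) powr 1" .
      qed simp
      finally show "w a b \<le> (1 + w 0 T) * w a b powr \<beta>" using w0 by simp
    qed (use K in auto)
    finally show ?thesis by (simp add: mult.assoc)
  qed
qed

lemma holder_modulus:
  assumes L: "0 \<le> L" and \<epsilon>: "0 < \<epsilon>"
  shows "\<exists>\<delta>>0. \<forall>u\<in>{0..T}. \<forall>v\<in>{0..T}. u \<le> v \<and> v - u < \<delta> \<longrightarrow> L * w u v powr \<beta> < \<epsilon>"
proof -
  \<comment> \<open>Solves (L + 1) \<eta>^\<beta> = \<epsilon>; the added 1 covers L = 0 and makes
    the final inequality strict.\<close>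
  define \<eta> where "\<eta> = (\<epsilon> / (L + 1)) powr (1 / \<beta>)"
  have "0 < \<eta>" using \<epsilon> L by (simp add: \<eta>_def)
  then obtain \<delta> where \<delta>: "0 < \<delta>" "\<And>u v. u \<in> {0..T} \<Longrightarrow> v \<in> {0..T} \<Longrightarrow> u \<le> v \<Longrightarrow> v - u < \<delta> \<Longrightarrow> w u v < \<eta>"
    using w_vanishing unfolding vanishing_on_def by meson
  have "L * w u v powr \<beta> < \<epsilon>" if uv: "u \<in> {0..T}" "v \<in> {0..T}" "u \<le> v" "v - u < \<delta>" for u v
  proof -
    have "w u v powr \<beta> \<le> \<eta> powr \<beta>" using \<delta>(2)[OF uv] w_nonneg uv \<beta> by (intro powr_mono2) auto
    also have "\<dots> = \<epsilon> / (L + 1)" using \<epsilon> L \<beta> by (simp add: \<eta>_def powr_powr)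
    finally have "L * w u v powr \<beta> \<le> L * (\<epsilon> / (L + 1))" using L by (intro mult_left_mono) auto
    also have "\<dots> < \<epsilon>" using \<epsilon> L by (simp add: field_simps)
    finally show ?thesis .
  qed
  then show ?thesis using \<delta>(1) by blast
qed

lemma holder_imp_continuous_on:
  fixes x :: "real \<Rightarrow> 'e::real_normed_vector"
  assumes "0 \<le> L" and x: "\<And>u v. 0 \<le> u \<Longrightarrow> u \<le> v \<Longrightarrow> v \<le> T \<Longrightarrow> norm (x v - x u) \<le> L * w u v powr \<beta>"
  shows "continuous_on {0..T} x"
  unfolding continuous_on_iff
proof (intro ballI allI impI)
  fix a e :: real assume a: "a \<in> {0..T}" and e: "0 < e"
  obtain \<delta> where \<delta>: "\<delta> > 0" "\<And>u v. u \<in> {0..T} \<Longrightarrow> v \<in> {0..T} \<Longrightarrow> u \<le> v \<Longrightarrow> v - u < \<delta> \<Longrightarrow> norm (x v - x u) < e"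
    using holder_modulus[OF assms(1) e] x by (meson atLeastAtMost_iff le_less_trans)
  have "dist (x y) (x a) < e" if "y \<in> {0..T}" "dist y a < \<delta>" for y
    using \<delta>(2)[of a y] \<delta>(2)[of y a] that a by (cases "a \<le> y") (auto simp: dist_norm dist_real_def norm_minus_commute)
  then show "\<exists>d>0. \<forall>x'\<in>{0..T}. dist x' a < d \<longrightarrow> dist (x x') (x a) < e" using \<delta>(1) by blast
qed

end

section \<open>Exact solutions\<close>

text \<open>Membership in the Hoelder space of paths from \<xi>, with an explicit constant for the
  rescaled control, so that statements can be uniform over a bounded set of paths.\<close>

definition (in rough_driver) holder_from :: "'e::real_normed_vector \<Rightarrow> real \<Rightarrow> (real \<Rightarrow> 'e) \<Rightarrow> bool" where
  "holder_from \<xi> L x \<longleftrightarrow> x 0 = \<xi> \<and> 0 \<le> L \<and>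
      (\<forall>u v. 0 \<le> u \<and> u \<le> v \<and> v \<le> T \<longrightarrow> norm (x v - x u) \<le> L * w u v powr \<beta>)"

text \<open>The hypotheses on \<open>A\<close> as they are used, with \<beta>0 and the extension
  hidden. \<open>A_var\<close> is the growth condition with both norms of the path bounded by L
  w^\<beta>. \<open>A_limit\<close> concerns sequences bounded in the \<beta>-Hoelder norm, along
  which uniform convergence implies convergence in the \<beta>0-norm.\<close>

locale path_map = rough_driver \<sigma> \<beta> \<theta> M F T w X XX
  for \<sigma> :: "(real^'n) \<times> (real^'n) \<Rightarrow> (real^'d) \<Rightarrow>\<^sub>L (real^'n)" and \<beta> \<theta> M F T w
    and X :: "real \<Rightarrow> real \<Rightarrow> real^'d" and XX +
  fixes \<xi> :: "real^'n" and A :: "(real \<Rightarrow> real^'n) \<Rightarrow> real \<Rightarrow> real^'n"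
  assumes A_cont: "\<And>x L. holder_from \<xi> L x \<Longrightarrow> continuous_on {0..T} (A x)"
    and A_adapted: "\<And>x y K L t s. holder_from \<xi> K x \<Longrightarrow> holder_from \<xi> L y \<Longrightarrow> 0 \<le> s \<Longrightarrow> s \<le> t \<Longrightarrow> t \<le> T \<Longrightarrow>
        (\<And>r. 0 \<le> r \<Longrightarrow> r \<le> t \<Longrightarrow> x r = y r) \<Longrightarrow> A x s = A y s"
    and A_var: "\<And>x K L s t. holder_from \<xi> K x \<Longrightarrow> 0 \<le> s \<Longrightarrow> s \<le> t \<Longrightarrow> t \<le> T \<Longrightarrow> 0 \<le> L \<Longrightarrow>
        (\<And>u v. s \<le> u \<Longrightarrow> u \<le> v \<Longrightarrow> v \<le> t \<Longrightarrow> norm (x v - x u) \<le> L * w u v powr \<beta>) \<Longrightarrow>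
        p_var 1 s t (A x) \<le> ennreal (F (L * w s t powr \<beta>) * (L * w s t powr \<beta>))"
    and A_limit: "\<And>xs x L. (\<And>n. holder_from \<xi> L (xs n)) \<Longrightarrow> holder_from \<xi> L x \<Longrightarrow>
        uniform_limit {0..T} xs x sequentially \<Longrightarrow> uniform_limit {0..T} (\<lambda>n. A (xs n)) (A x) sequentially"
begin

abbreviation "holder_const \<equiv> holder_from \<xi>"

lemma holder_constD:
  "holder_const L x \<Longrightarrow> 0 \<le> u \<Longrightarrow> u \<le> v \<Longrightarrow> v \<le> T \<Longrightarrow> norm (x v - x u) \<le> L * w u v powr \<beta>"
  "holder_const L x \<Longrightarrow> x 0 = \<xi>" "holder_const L x \<Longrightarrow> 0 \<le> L"
  by (auto simp: holder_from_def)

lemma A_p_var_finite: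
  assumes "holder_const L x" "0 \<le> s" "s \<le> t" "t \<le> T"
  shows "p_var 1 s t (A x) < top"
proof -
  have "p_var 1 s t (A x) \<le> ennreal (F (L * w s t powr \<beta>) * (L * w s t powr \<beta>))"
    by (rule A_var[OF assms]) (use holder_constD[OF assms(1)] assms in auto)
  also have "\<dots> < top" by simp
  finally show ?thesis .
qed

lemma A_var1_superadditive: "holder_const L x \<Longrightarrow> superadditive_on {0..T} (\<lambda>u v. var1 u v (A x))"
  unfolding superadditive_on_def
  by (auto simp: var1_nonneg intro!: var1_superadditive A_p_var_finite)

lemma A_var1_le:
  assumes "holder_const K x" "0 \<le> s" "s \<le> t" "t \<le> T" "0 \<le> L"
    "\<And>u v. s \<le> u \<Longrightarrow> u \<le> v \<Longrightarrow> v \<le> t \<Longrightarrow> norm (x v - x u) \<le> L * w u v powr \<beta>"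
  shows "var1 s t (A x) \<le> F (L * w s t powr \<beta>) * (L * w s t powr \<beta>)"
proof -
  have "ennreal (var1 s t (A x)) \<le> ennreal (F (L * w s t powr \<beta>) * (L * w s t powr \<beta>))"
    using A_var[OF assms] p_var_1_eq[OF A_p_var_finite[OF assms(1-4)]] by simp
  moreover have "0 \<le> F (L * w s t powr \<beta>) * (L * w s t powr \<beta>)"
    using F_pos[of "L * w s t powr \<beta>"] assms(5) by simp
  ultimately show ?thesis by (simp add: ennreal_le_iff)
qed

lemma A_diff_le: "holder_const L x \<Longrightarrow> 0 \<le> u \<Longrightarrow> u \<le> v \<Longrightarrow> v \<le> T \<Longrightarrow> norm (A x v - A x u) \<le> var1 u v (A x)"
  by (intro norm_diff_le_var1 A_p_var_finite)

section \<open>The Young term in the rough integral\<close>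

definition young_term :: "(real \<Rightarrow> real^'n) \<Rightarrow> real \<Rightarrow> real \<Rightarrow> real^'n" where
  "young_term Z s t = tensor_apply (\<lambda>v. blinfun_apply (partial2 \<sigma> (Z s) (A Z s) v)) (young_integral (A Z) X s t)"

lemma rough_germ_eq:
  "Z' s = \<sigma> (Z s, A Z s) \<Longrightarrow> rough_germ \<sigma> X XX Z Z' (A Z) s t = germ Z (A Z) s t + young_term Z s t"
  by (simp add: rough_germ_def germ_def level2_def young_term_def)

lemma norm_young_term:
  assumes "holder_const L Z" "0 \<le> s" "s \<le> t" "t \<le> T"
  shows "norm (young_term Z s t)
    \<le> real (CARD('n) * CARD('d)) * M * (sew_const (1 + \<beta>) * (var1 s t (A Z) * w s t powr \<beta>))"
proof -
  have sub: "{s..t} \<subseteq> {0..T}" using assms by auto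
  have "norm (young_integral (A Z) X s t) \<le> sew_const (1 + \<beta>) * (var1 s t (A Z) * w s t powr \<beta>)"
    by (rule young_integral_bound[OF superadditive_on_subset[OF w sub] vanishing_on_subset[OF w_vanishing sub]
          superadditive_on_subset[OF A_var1_superadditive[OF assms(1)] sub] _ assms(3)])
      (use \<beta> assms in \<open>auto intro!: X_add X_bound A_diff_le\<close>)
  moreover have "norm (blinfun_apply (partial2 \<sigma> (Z s) (A Z s) (axis i 1)) (axis j 1 :: real^'d)) \<le> M" for i j
    by (rule order_trans[OF norm_blinfun]) (use partial2_bound[of "Z s" "A Z s" "axis i 1"] in simp)
  then have "norm (young_term Z s t) \<le> real (CARD('n) * CARD('d)) * M * norm (young_integral (A Z) X s t)"
    unfolding young_term_def by (rule norm_tensor_apply_le)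
  ultimately show ?thesis using M by (elim order_trans[rotated] order_trans) (auto intro!: mult_left_mono)
qed

text \<open>A Young term is bounded by the variation of A(Z) times w^\<beta>, up to a constant. This
  has degree 1 + \<beta> in the two controls.\<close>

lemma young_terms_small:
  assumes Z: "holder_const L Z" and st: "0 \<le> t" "t \<le> T" and \<epsilon>: "0 < \<epsilon>"
  shows "\<exists>\<delta>>0. \<forall>ts\<in>partitions 0 t. mesh_less ts \<delta> \<longrightarrow> norm (partition_sum (young_term Z) ts) < \<epsilon>"
proof -
  define c where "c = real (CARD('n) * CARD('d)) * M * sew_const (1 + \<beta>)"
  have c: "0 \<le> c" unfolding c_def using M sew_const_nonneg[of "1 + \<beta>"] \<beta> by (intro mult_nonneg_nonneg) auto
  have sub: "{0..t} \<subseteq> {0..T}" using st by auto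
  obtain \<delta> where \<delta>: "0 < \<delta>" "\<And>ts. ts \<in> partitions 0 t \<Longrightarrow> mesh_less ts \<delta> \<Longrightarrow>
     partition_sum (\<lambda>u v. 0 * w u v powr 2 + c * (var1 u v (A Z) * w u v powr \<beta>)) ts < \<epsilon>"
    using partition_sum_controls_small[OF superadditive_on_subset[OF w sub] vanishing_on_subset[OF w_vanishing sub]
        superadditive_on_subset[OF A_var1_superadditive[OF Z] sub], of 0 c 2 \<beta> \<epsilon>] c \<beta> \<epsilon> by auto
  have "norm (partition_sum (young_term Z) ts) < \<epsilon>" if ts: "ts \<in> partitions 0 t" "mesh_less ts \<delta>" for ts
  proof -
    have "norm (partition_sum (young_term Z) ts)
      \<le> partition_sum (\<lambda>u v. 0 * w u v powr 2 + c * (var1 u v (A Z) * w u v powr \<beta>)) ts"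
      unfolding partition_sum_def
    proof (rule sum_norm_le)
      fix i assume i: "i \<in> {..<length ts - 1}"
      have "ts ! i \<in> {0..t}" "ts ! Suc i \<in> {0..t}" "ts ! i \<le> ts ! Suc i"
        using partition_chain(1)[OF ts(1)] i by (auto simp: chain_def simp del: atLeastAtMost_iff)
      then show "norm (young_term Z (ts ! i) (ts ! Suc i))
        \<le> 0 * w (ts ! i) (ts ! Suc i) powr 2 + c * (var1 (ts ! i) (ts ! Suc i) (A Z) * w (ts ! i) (ts ! Suc i) powr \<beta>)"
        using norm_young_term[OF Z, of "ts ! i" "ts ! Suc i"] st by (simp add: c_def mult.assoc)
    qed
    then show ?thesis using \<delta>(2)[OF ts] by simp
  qed
  then show ?thesis using \<delta>(1) by blast
qed

text \<open>Allows the equation to be handled through the shorter germ, both for limits of schemes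
  and for given solutions.\<close>

lemma has_rough_integral_iff:
  assumes Z: "holder_const L Z" and t: "0 \<le> t" "t \<le> T" and Z': "\<And>s. 0 \<le> s \<Longrightarrow> s \<le> T \<Longrightarrow> Z' s = \<sigma> (Z s, A Z s)"
  shows "has_rough_integral \<sigma> X XX Z Z' (A Z) 0 t I \<longleftrightarrow> has_partition_limit (germ Z (A Z)) 0 t I"
proof -
  have diff: "partition_sum (rough_germ \<sigma> X XX Z Z' (A Z)) ts - partition_sum (germ Z (A Z)) ts = partition_sum (young_term Z) ts"
    if ts: "ts \<in> partitions 0 t" for ts
  proof -
    have "rough_germ \<sigma> X XX Z Z' (A Z) (ts ! i) (ts ! Suc i) = germ Z (A Z) (ts ! i) (ts ! Suc i) + young_term Z (ts ! i) (ts ! Suc i)"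
      if "i < length ts - 1" for i
    proof (rule rough_germ_eq[OF Z'])
      have "ts ! i \<in> {0..t}"
        using partition_chain(1)[OF ts] that by (auto simp: chain_def simp del: atLeastAtMost_iff)
      then show "0 \<le> ts ! i" "ts ! i \<le> T" using t by auto
    qed
    then show ?thesis by (simp add: partition_sum_def sum.distrib)
  qed
  show ?thesis
    unfolding has_rough_integral_def
  proof
    assume "has_partition_limit (germ Z (A Z)) 0 t I"
    then show "has_partition_limit (rough_germ \<sigma> X XX Z Z' (A Z)) 0 t I"
    proof (rule has_partition_limit_perturb)
      fix \<epsilon> :: real assume "0 < \<epsilon>"
      from young_terms_small[OF Z t this] diff
      show "\<exists>\<delta>>0. \<forall>ts\<in>partitions 0 t. mesh_less ts \<delta> \<longrightarrow>
         norm (partition_sum (rough_germ \<sigma> X XX Z Z' (A Z)) ts - partition_sum (germ Z (A Z)) ts) < \<epsilon>" by auto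
    qed
  next
    assume "has_partition_limit (rough_germ \<sigma> X XX Z Z' (A Z)) 0 t I"
    then show "has_partition_limit (germ Z (A Z)) 0 t I"
    proof (rule has_partition_limit_perturb)
      fix \<epsilon> :: real assume "0 < \<epsilon>"
      have diff': "norm (partition_sum (germ Z (A Z)) ts - partition_sum (rough_germ \<sigma> X XX Z Z' (A Z)) ts)
          = norm (partition_sum (young_term Z) ts)" if "ts \<in> partitions 0 t" for ts
        using diff[OF that] by (metis norm_minus_commute)
      from young_terms_small[OF Z t \<open>0 < \<epsilon>\<close>] diff'
      show "\<exists>\<delta>>0. \<forall>ts\<in>partitions 0 t. mesh_less ts \<delta> \<longrightarrow>
         norm (partition_sum (germ Z (A Z)) ts - partition_sum (rough_germ \<sigma> X XX Z Z' (A Z)) ts) < \<epsilon>"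
        by auto
    qed
  qed
qed

text \<open>With \<open>D\<close> the whole interval, \<open>cells\<close> and
  \<open>halving\<close> degenerate: end pieces may be empty and exact midpoints exist. The work
  lies in \<open>germ_sums\<close>, because the equation gives integrals from 0 only.\<close>

lemma exact_solution_approx:
  assumes Z: "holder_const L Z"
    and lim: "\<And>t. 0 \<le> t \<Longrightarrow> t \<le> T \<Longrightarrow> has_partition_limit (germ Z (A Z)) 0 t (Z t - \<xi>)"
    and rem: "\<And>u v. 0 \<le> u \<Longrightarrow> u \<le> v \<Longrightarrow> v \<le> T \<Longrightarrow> norm (rem Z (A Z) u v) \<le> r * w u v powr (2 * \<beta>)"
  shows "approx_solution \<sigma> \<beta> \<theta> M F T w X XX {0..T} Z (A Z) (\<lambda>u v. var1 u v (A Z))"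
proof unfold_locales
  show "\<exists>t n. chain ({0..T} \<inter> {u..v}) t n \<and> t 0 = u \<and> t n = v \<and>
      norm (Z v - Z u - (\<Sum>i<n. germ Z (A Z) (t i) (t (Suc i)))) < \<epsilon>"
    if uv: "u \<in> {0..T}" "v \<in> {0..T}" "u \<le> v" and \<epsilon>: "0 < \<epsilon>" for u v \<epsilon>
  proof -
    let ?G = "germ Z (A Z)"
    obtain \<delta> where \<delta>: "0 < \<delta>" "\<And>ts. ts \<in> partitions 0 u \<Longrightarrow> mesh_less ts \<delta> \<Longrightarrow> norm (partition_sum ?G ts - (Z u - \<xi>)) < \<epsilon> / 2"
      using lim[of u] uv \<epsilon> unfolding has_partition_limit_def by (auto dest: spec[of _ "\<epsilon> / 2"])
    obtain \<delta>' where \<delta>': "0 < \<delta>'" "\<And>ts. ts \<in> partitions 0 v \<Longrightarrow> mesh_less ts \<delta>' \<Longrightarrow> norm (partition_sum ?G ts - (Z v - \<xi>)) < \<epsilon> / 2"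
      using lim[of v] uv \<epsilon> unfolding has_partition_limit_def by (auto dest: spec[of _ "\<epsilon> / 2"])
    \<comment> \<open>A fine partition of [0, u] continued by a fine one of [u, v] is fine on
      [0, v]; subtracting the two approximate integrals isolates the sum over [u, v].\<close>
    obtain ts where ts: "ts \<in> partitions 0 u" "mesh_less ts (min \<delta> \<delta>')"
      using partitions_fine[of 0 u "min \<delta> \<delta>'"] \<delta>(1) \<delta>'(1) uv by auto
    obtain us where us: "us \<in> partitions u v" "mesh_less us (min \<delta> \<delta>')"
      using partitions_fine[of u v "min \<delta> \<delta>'"] \<delta>(1) \<delta>'(1) uv by auto
    have "mesh_less ts \<delta>" "mesh_less (ts @ tl us) \<delta>'"
      using mesh_less_mono[OF ts(2), of \<delta>] mesh_less_mono[OF ts(2), of \<delta>'] mesh_less_mono[OF us(2), of \<delta>']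
      by (simp_all add: partitions_append(3)[OF ts(1) us(1)])
    then have "norm (partition_sum ?G ts - (Z u - \<xi>)) < \<epsilon> / 2"
      "norm (partition_sum ?G (ts @ tl us) - (Z v - \<xi>)) < \<epsilon> / 2"
      using \<delta>(2)[OF ts(1)] \<delta>'(2)[OF partitions_append(1)[OF ts(1) us(1)]] by blast+
    then have "norm (Z v - Z u - partition_sum ?G us) < \<epsilon>"
      unfolding partitions_append(2)[OF ts(1) us(1)]
      using norm_triangle_ineq4[of "partition_sum ?G ts - (Z u - \<xi>)" "partition_sum ?G ts + partition_sum ?G us - (Z v - \<xi>)"]
      by (simp add: algebra_simps)
    moreover have "{0..T} \<inter> {u..v} = {u..v}" using uv by auto
    ultimately show ?thesis
      using partition_chain[OF us(1)] unfolding partition_sum_def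
      by (intro exI[of _ "\<lambda>i. us ! i"] exI[of _ "length us - 1"]) auto
  qed
  show "norm (Z b - Z a) \<le> cell_const * w a b powr \<beta> \<or> (\<exists>a'\<in>{0..T}. \<exists>b'\<in>{0..T}. a \<le> a' \<and> a' \<le> b' \<and> b' \<le> b \<and>
      norm (Z a' - Z a) \<le> cell_const * w a a' powr \<beta> \<and> norm (Z b - Z b') \<le> cell_const * w b' b powr \<beta>)"
    if "0 \<le> a" "a \<le> b" "b \<le> T" for a b
    \<comment> \<open>The choice \<open>a' = a\<close> and \<open>b' = b\<close> makes both end
      pieces empty.\<close>
    using that cell_const M by (intro disjI2 bexI[of _ a] bexI[of _ b]) auto
  show "\<exists>x\<in>{0..T}. \<exists>y\<in>{0..T}. u \<le> x \<and> x \<le> y \<and> y \<le> v \<and>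
      w u x \<le> w u v / 2 \<and> w y v \<le> w u v / 2 \<and> norm (Z y - Z x) \<le> cell_const * w x y powr \<beta>"
    if uv: "u \<in> {0..T}" "v \<in> {0..T}" "u \<le> v" for u v
  proof -
    obtain c where "u \<le> c" "c \<le> v" "w u c \<le> w u v / 2" "w c v \<le> w u v / 2"
      using w_midpoint[of u v] uv by auto
    then show ?thesis using uv cell_const M by (intro bexI[of _ c]) auto
  qed
  show "\<exists>r. \<forall>u\<in>{0..T}. \<forall>v\<in>{0..T}. u \<le> v \<longrightarrow> norm (rem Z (A Z) u v) \<le> r * w u v powr (2 * \<beta>)"
    by (intro exI[of _ r]) (use rem in auto)
qed (use Z in \<open>auto intro!: A_var1_superadditive A_diff_le A_var1_le\<close>)

end

context rough_coefficient
begin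

definition global_const :: "real \<Rightarrow> real" where
  "global_const K = 2 * K * local_scale powr (\<beta> - 1)"

lemma global_const_nonneg: "0 \<le> K \<Longrightarrow> 0 \<le> global_const K"
  by (simp add: global_const_def)

end

context approx_solution
begin

lemma path_bound_global:
  assumes "0 \<le> a" "a \<le> b" "b \<le> T"
  shows "norm (Z b - Z a) \<le> global_const path_const * (1 + w 0 T) * w a b powr \<beta>"
  unfolding global_const_def
proof (rule subadditive_growth[where \<phi> = "\<lambda>a b. norm (Z b - Z a)", OF _ _ local_scale(1,2) _ assms])
  show "norm (Z b - Z a) \<le> norm (Z c - Z a) + norm (Z b - Z c)" for a c b
    using norm_triangle_ineq[of "Z c - Z a" "Z b - Z c"] by simp
qed (use path_bound_local path_const in auto)

end

context rough_driver
begin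

text \<open>The germ with fixed base point \<open>s\<close> is what a scheme follows within a cell.
  Chen's relation turns the increment of \<open>XX s\<close> into \<open>XX u v\<close> plus a
  tensor, each at most w^\<beta> because \<open>w s v \<le> 1\<close>; this is the 2 in
  \<open>cell_const\<close>.\<close>

lemma norm_germ_increment:
  assumes "0 \<le> s" "s \<le> u" "u \<le> v" "v \<le> T" and small: "w s v \<le> 1"
  shows "norm (germ Z Y s v - germ Z Y s u) \<le> cell_const * w u v powr \<beta>"
proof -
  define a where "a = w u v powr \<beta>"
  have w0: "0 \<le> w s u" "0 \<le> w u v" "w s u \<le> 1" "w u v \<le> 1"
    using w_nonneg assms w_mono[of s s u v] w_mono[of s u v v] by auto
  have a: "0 \<le> a" "a \<le> 1" unfolding a_def using w0 \<beta> by (auto intro!: powr_le1)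
  have Xuv: "norm (X u v) \<le> a" unfolding a_def using X_bound assms by auto
  have "norm (XX u v + tensor (X s u) (X u v)) \<le> 1 * a + 1 * a"
  proof (rule norm_triangle_mono)
    have "norm (XX u v) \<le> a * a" using XX_bound[of u v] assms by (simp add: a_def powr_2\<beta>)
    also have "\<dots> \<le> 1 * a" using a by (intro mult_right_mono) auto
    finally show "norm (XX u v) \<le> 1 * a" .
    have "norm (X s u) \<le> 1" using X_bound[of s u] powr_le1[of \<beta> "w s u"] w0 \<beta> assms by auto
    then show "norm (tensor (X s u) (X u v)) \<le> 1 * a" unfolding norm_tensor using Xuv by (intro mult_mono) auto
  qed
  then have "norm (level2 (Z s) (Y s) (XX u v + tensor (X s u) (X u v))) \<le> dim_const * M\<^sup>2 * (2 * a)"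
    using dim_const by (intro order_trans[OF norm_level2] mult_left_mono) auto
  moreover have "norm (blinfun_apply (\<sigma> (Z s, Y s)) (X u v)) \<le> M * a"
    using Xuv M by (intro order_trans[OF norm_\<sigma>_apply] mult_left_mono) auto
  moreover have "germ Z Y s v - germ Z Y s u =
      blinfun_apply (\<sigma> (Z s, Y s)) (X u v) + level2 (Z s) (Y s) (XX u v + tensor (X s u) (X u v))"
    using X_add[OF assms(1-4)] XX_chen[OF assms(1-4)]
    by (simp add: germ_def level2_add blinfun.add_right)
  ultimately have "norm (germ Z Y s v - germ Z Y s u) \<le> M * a + dim_const * M\<^sup>2 * (2 * a)"
    by (simp only: norm_triangle_mono)
  then show ?thesis by (simp add: cell_const_def a_def algebra_simps)
qed

end

section \<open>The Euler scheme\<close>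

context path_map
begin

context
  fixes \<tau> :: "nat \<Rightarrow> real" and N :: nat
  assumes \<tau>0: "\<tau> 0 = 0" and \<tau>N: "\<tau> N = T" and \<tau>_less: "\<And>k. k < N \<Longrightarrow> \<tau> k < \<tau> (Suc k)"
    and \<tau>_fine: "\<And>k. k < N \<Longrightarrow> w (\<tau> k) (\<tau> (Suc k)) \<le> 1"
begin

text \<open>Each stage is a path on all of [0, T], constant after \<open>\<tau> k\<close>, because
  \<open>A\<close> acts on such paths only. Clamping \<open>t\<close> to the current cell makes the
  correction vanish before the cell and freezes it afterwards.\<close>

primrec euler :: "nat \<Rightarrow> real \<Rightarrow> real^'n" where
  "euler 0 = (\<lambda>t. \<xi>)"
| "euler (Suc k) = (\<lambda>t. euler k t + germ (euler k) (A (euler k)) (\<tau> k) (max (\<tau> k) (min t (\<tau> (Suc k)))))"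

lemma \<tau>_strict: "i < j \<Longrightarrow> j \<le> N \<Longrightarrow> \<tau> i < \<tau> j"
proof (induction j)
  case (Suc j)
  then show ?case using \<tau>_less[of j] by (cases "i = j") auto
qed simp

lemma \<tau>_mono: "i \<le> j \<Longrightarrow> j \<le> N \<Longrightarrow> \<tau> i \<le> \<tau> j"
  using \<tau>_strict[of i j] by (cases "i = j") auto

lemma \<tau>_range: "k \<le> N \<Longrightarrow> 0 \<le> \<tau> k" "k \<le> N \<Longrightarrow> \<tau> k \<le> T"
  using \<tau>_mono[of 0 k] \<tau>_mono[of k N] \<tau>0 \<tau>N by auto

text \<open>A crude constant that grows with every step and only serves to place the scheme in the
  domain of \<open>A\<close>. The constant uniform in the mesh comes from the a priori
  estimate.\<close>

lemma euler_holder: "k \<le> N \<Longrightarrow> \<exists>L. holder_const L (euler k)"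
proof (induction k)
  case 0
  show ?case by (rule exI[of _ 0]) (simp add: holder_from_def)
next
  case (Suc k)
  then obtain L where L: "holder_const L (euler k)" by auto
  let ?c = "\<lambda>t. max (\<tau> k) (min t (\<tau> (Suc k)))"
  let ?g = "germ (euler k) (A (euler k)) (\<tau> k)"
  have k: "k < N" "\<tau> k < \<tau> (Suc k)" "0 \<le> \<tau> k" "\<tau> (Suc k) \<le> T"
    using Suc.prems \<tau>_less \<tau>_range by auto
  have c0: "0 \<le> cell_const" using cell_const M by linarith
  have "norm (?g (?c v) - ?g (?c u)) \<le> cell_const * w u v powr \<beta>" if uv: "0 \<le> u" "u \<le> v" "v \<le> T" for u v
  \<comment> \<open>The clamped interval is either a single point or contained in [u, v].\<close>
  proof (cases "?c u = ?c v")
    case True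
    then show ?thesis using c0 by simp
  next
    case False
    then have lt: "?c u < ?c v" using uv by auto
    then have le: "u \<le> ?c u" "?c v \<le> v" using k by (auto simp: max_def min_def split: if_splits)
    have "norm (?g (?c v) - ?g (?c u)) \<le> cell_const * w (?c u) (?c v) powr \<beta>"
    proof (rule norm_germ_increment)
      have "w (\<tau> k) (?c v) \<le> w (\<tau> k) (\<tau> (Suc k))" using k by (intro w_mono) auto
      then show "w (\<tau> k) (?c v) \<le> 1" using \<tau>_fine[OF k(1)] by linarith
    qed (use k lt in auto)
    also have "\<dots> \<le> cell_const * w u v powr \<beta>"
      using le lt uv c0 \<beta> by (intro mult_left_mono w_powr_mono) auto
    finally show ?thesis .
  qed
  then have "norm (euler (Suc k) v - euler (Suc k) u) \<le> (L + cell_const) * w u v powr \<beta>"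
    if uv: "0 \<le> u" "u \<le> v" "v \<le> T" for u v
  proof -
    have "euler (Suc k) v - euler (Suc k) u = (euler k v - euler k u) + (?g (?c v) - ?g (?c u))" by simp
    also have "norm \<dots> \<le> L * w u v powr \<beta> + cell_const * w u v powr \<beta>"
      by (intro norm_triangle_mono holder_constD(1)[OF L uv])
        (use \<open>\<And>u v. 0 \<le> u \<Longrightarrow> u \<le> v \<Longrightarrow> v \<le> T \<Longrightarrow> norm (?g (?c v) - ?g (?c u)) \<le> cell_const * w u v powr \<beta>\<close> uv in blast)
    finally show ?thesis by (simp add: algebra_simps)
  qed
  moreover have "euler (Suc k) 0 = \<xi>"
    using holder_constD(2)[OF L] k germ_refl[of "\<tau> k"] germ_refl[of 0] T by (simp add: max_def min_def)
  ultimately have "holder_const (L + cell_const) (euler (Suc k))"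
    using holder_constD(3)[OF L] c0 unfolding holder_from_def by simp
  then show ?case by blast
qed

lemma euler_past: "k \<le> j \<Longrightarrow> j \<le> N \<Longrightarrow> t \<le> \<tau> k \<Longrightarrow> euler j t = euler k t"
proof (induction j rule: dec_induct)
  case (step j)
  then have "t \<le> \<tau> j" "\<tau> j < \<tau> (Suc j)" "0 \<le> \<tau> j" "\<tau> j \<le> T"
    using \<tau>_mono[of k j] \<tau>_less[of j] \<tau>_range[of j] by auto
  moreover from this have "max (\<tau> j) (min t (\<tau> (Suc j))) = \<tau> j" by simp
  ultimately show ?case using step germ_refl[of "\<tau> j"] by simp
qed simp

lemma euler_stopped: "k \<le> N \<Longrightarrow> \<tau> k \<le> t \<Longrightarrow> euler k t = euler k (\<tau> k)"
proof (induction k arbitrary: t)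
  case (Suc k)
  then have "\<tau> k \<le> \<tau> (Suc k)" using \<tau>_less[of k] by auto
  then show ?case using Suc.IH[of t] Suc.IH[of "\<tau> (Suc k)"] Suc.prems by (simp add: min_def)
qed simp

text \<open>Stage \<open>k\<close> and the final path agree up to \<open>\<tau> k\<close>, so
  adaptedness identifies the values of \<open>A\<close> on them at \<open>\<tau> k\<close>. The
  scheme, built by stages, thus satisfies a recursion that involves its final path alone.\<close>

lemma euler_step:
  assumes k: "k < N" and t: "\<tau> k \<le> t" "t \<le> \<tau> (Suc k)"
  shows "euler N t = euler N (\<tau> k) + germ (euler N) (A (euler N)) (\<tau> k) t"
proof -
  have "euler N t = euler (Suc k) t" using euler_past[of "Suc k" N t] k t by auto
  also have "\<dots> = euler k t + germ (euler k) (A (euler k)) (\<tau> k) t"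
    using t by (simp add: max_def min_def)
  also have "euler k t = euler k (\<tau> k)" using euler_stopped[of k t] k t by auto
  also have eq: "euler k (\<tau> k) = euler N (\<tau> k)" using euler_past[of k N "\<tau> k"] k by auto
  also have "germ (euler k) (A (euler k)) (\<tau> k) t = germ (euler N) (A (euler N)) (\<tau> k) t"
  proof -
    obtain K L where "holder_const K (euler k)" "holder_const L (euler N)"
      using euler_holder[of k] euler_holder[of N] k by auto
    then have "A (euler k) (\<tau> k) = A (euler N) (\<tau> k)"
      by (rule A_adapted[where t = "\<tau> k"]) (use \<tau>_range[of k] k euler_past[of k N] in auto)
    then show ?thesis using eq by (simp add: germ_def)
  qed
  finally show ?thesis .
qed

lemma cell_of:
  assumes "0 \<le> t" "t \<le> T"
  obtains k where "k < N" "\<tau> k \<le> t" "t \<le> \<tau> (Suc k)"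
proof -
  have "\<exists>k<n. \<tau> k \<le> t \<and> t \<le> \<tau> (Suc k)" if "0 < n" "t \<le> \<tau> n" for n
    using that
  proof (induction n)
    case (Suc n)
    show ?case
    proof (cases "0 < n \<and> t \<le> \<tau> n")
      case True
      then show ?thesis using Suc.IH less_SucI by blast
    next
      case False
      then have "\<tau> n \<le> t" using assms \<tau>0 by (cases "n = 0") auto
      then show ?thesis using Suc.prems by blast
    qed
  qed simp
  moreover have "0 < N" using \<tau>0 \<tau>N T by (cases N) auto
  ultimately show ?thesis using that assms \<tau>N by blast
qed

lemma euler_cell_bound:
  assumes "k < N" "\<tau> k \<le> u" "u \<le> v" "v \<le> \<tau> (Suc k)"
  shows "norm (euler N v - euler N u) \<le> cell_const * w u v powr \<beta>"
proof -
  have T: "0 \<le> \<tau> k" "\<tau> (Suc k) \<le> T" using \<tau>_range assms(1) by auto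
  have "w (\<tau> k) v \<le> w (\<tau> k) (\<tau> (Suc k))" using assms T by (intro w_mono) auto
  then have "w (\<tau> k) v \<le> 1" using \<tau>_fine[OF assms(1)] by linarith
  then show ?thesis
    using euler_step[OF assms(1), of u] euler_step[OF assms(1), of v] assms T
      norm_germ_increment[of "\<tau> k" u v] by auto
qed

text \<open>Germ sums telescope exactly along the grid, and an interval with end points off the grid
  loses at most one partial cell on either side.\<close>

lemma euler_approx:
  "approx_solution \<sigma> \<beta> \<theta> M F T w X XX (\<tau> ` {..N}) (euler N) (A (euler N)) (\<lambda>u v. var1 u v (A (euler N)))"
proof -
  obtain L where L: "holder_const L (euler N)" using euler_holder by blast
  let ?Z = "euler N" let ?D = "\<tau> ` {..N}" let ?G = "germ (euler N) (A (euler N))"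
  have c0: "0 \<le> cell_const" using cell_const M by linarith
  have D: "?D \<subseteq> {0..T}" using \<tau>_range by auto
  have \<tau>_le: "i \<le> j" if "\<tau> i \<le> \<tau> j" "i \<le> N" "j \<le> N" for i j
    using \<tau>_strict[of j i] that by force
  show ?thesis
  proof unfold_locales
    show "\<exists>t n. chain (?D \<inter> {u..v}) t n \<and> t 0 = u \<and> t n = v \<and>
        norm (?Z v - ?Z u - (\<Sum>i<n. ?G (t i) (t (Suc i)))) < \<epsilon>"
      if uv: "u \<in> ?D" "v \<in> ?D" "u \<le> v" and \<epsilon>: "0 < \<epsilon>" for u v \<epsilon>
    proof -
      obtain i j where ij: "u = \<tau> i" "v = \<tau> j" "i \<le> N" "j \<le> N" using uv by auto
      then have "i \<le> j" using \<tau>_le uv by auto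
      have "(\<Sum>k<n. ?G (\<tau> (i + k)) (\<tau> (Suc (i + k)))) = ?Z (\<tau> (i + n)) - ?Z (\<tau> i)" if "i + n \<le> N" for n
        using that
      proof (induction n)
        case (Suc n)
        then show ?case using euler_step[of "i + n" "\<tau> (Suc (i + n))"] \<tau>_less[of "i + n"] by simp
      qed simp
      from this[of "j - i"] have "(\<Sum>k<j - i. ?G (\<tau> (i + k)) (\<tau> (Suc (i + k)))) = ?Z v - ?Z u"
        using ij \<open>i \<le> j\<close> by simp
      moreover have "chain (?D \<inter> {u..v}) (\<lambda>k. \<tau> (i + k)) (j - i)"
        unfolding chain_def using ij \<open>i \<le> j\<close> \<tau>_mono by auto
      ultimately show ?thesis using ij \<open>i \<le> j\<close> \<epsilon>
        by (intro exI[of _ "\<lambda>k. \<tau> (i + k)"] exI[of _ "j - i"]) auto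
    qed
    show "norm (?Z b - ?Z a) \<le> cell_const * w a b powr \<beta> \<or> (\<exists>a'\<in>?D. \<exists>b'\<in>?D. a \<le> a' \<and> a' \<le> b' \<and> b' \<le> b \<and>
        norm (?Z a' - ?Z a) \<le> cell_const * w a a' powr \<beta> \<and> norm (?Z b - ?Z b') \<le> cell_const * w b' b powr \<beta>)"
      if ab: "0 \<le> a" "a \<le> b" "b \<le> T" for a b
    proof -
      obtain i where i: "i < N" "\<tau> i \<le> a" "a \<le> \<tau> (Suc i)" using cell_of[of a] ab by auto
      obtain j where j: "j < N" "\<tau> j \<le> b" "b \<le> \<tau> (Suc j)" using cell_of[of b] ab by auto
      consider "i = j" | "i < j" | "j < i" by linarith
      then show ?thesis
      proof cases
        case 1
        then show ?thesis using euler_cell_bound[of i a b] i j ab by auto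
      next
        case 2
        have "\<tau> (Suc i) \<le> \<tau> j" using 2 j by (intro \<tau>_mono) auto
        then show ?thesis
          using euler_cell_bound[of i a "\<tau> (Suc i)"] euler_cell_bound[of j "\<tau> j" b] i j
          by (intro disjI2 bexI[of _ "\<tau> (Suc i)"] bexI[of _ "\<tau> j"]) auto
      next
        case 3
        have "\<tau> (Suc j) \<le> \<tau> i" using 3 i by (intro \<tau>_mono) auto
        then have "a = b" using i j ab by linarith
        then show ?thesis using c0 by simp
      qed
    qed
    show "\<exists>x\<in>?D. \<exists>y\<in>?D. u \<le> x \<and> x \<le> y \<and> y \<le> v \<and>
        w u x \<le> w u v / 2 \<and> w y v \<le> w u v / 2 \<and> norm (?Z y - ?Z x) \<le> cell_const * w x y powr \<beta>"
      if uv: "u \<in> ?D" "v \<in> ?D" "u \<le> v" for u v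
    proof -
      obtain i j where ij: "u = \<tau> i" "v = \<tau> j" "i \<le> N" "j \<le> N" using uv by auto
      then have "i \<le> j" using \<tau>_le uv by auto
      have uvT: "u \<in> {0..T}" "v \<in> {0..T}" using D uv by auto
      have wuv: "0 \<le> w u v" using w_nonneg uvT uv by auto
      \<comment> \<open>The last grid point before which at most half of the control is spent. Its
        successor lies beyond the half, so superadditivity leaves less than half after it, and the
        middle piece is a single cell.\<close>
      define k where "k = (GREATEST k. i \<le> k \<and> k \<le> j \<and> w u (\<tau> k) \<le> w u v / 2)"
      have "i \<le> i \<and> i \<le> j \<and> w u (\<tau> i) \<le> w u v / 2"
        using \<open>i \<le> j\<close> superadditive_on_refl[OF w uvT(1)] wuv ij by simp
      then have k: "i \<le> k" "k \<le> j" "w u (\<tau> k) \<le> w u v / 2"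
        unfolding k_def by (metis (mono_tags, lifting) GreatestI_nat)+
      show ?thesis
      proof (cases "k = j")
        case True
        then show ?thesis
          using k uv ij superadditive_on_refl[OF w uvT(2)] wuv c0 by (intro bexI[of _ v]) auto
      next
        case False
        then have kj: "Suc k \<le> j" using k by simp
        have "\<not> (i \<le> Suc k \<and> Suc k \<le> j \<and> w u (\<tau> (Suc k)) \<le> w u v / 2)"
        proof
          assume "i \<le> Suc k \<and> Suc k \<le> j \<and> w u (\<tau> (Suc k)) \<le> w u v / 2"
          then have "Suc k \<le> k" unfolding k_def by (rule Greatest_le_nat[where b = j]) simp
          then show False by simp
        qed
        then have "w u v / 2 < w u (\<tau> (Suc k))" using k kj by auto
        moreover have "w u (\<tau> (Suc k)) + w (\<tau> (Suc k)) v \<le> w u v"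
          using superadditive_onD[OF w uvT(1) _ uvT(2), of "\<tau> (Suc k)"] \<tau>_range[of "Suc k"] kj k ij
            \<tau>_mono[of i "Suc k"] \<tau>_mono[of "Suc k" j] by auto
        ultimately have "w (\<tau> (Suc k)) v \<le> w u v / 2" by linarith
        moreover have "norm (?Z (\<tau> (Suc k)) - ?Z (\<tau> k)) \<le> cell_const * w (\<tau> k) (\<tau> (Suc k)) powr \<beta>"
          using euler_cell_bound[of k] \<tau>_less[of k] kj ij by auto
        moreover have "u \<le> \<tau> k" "\<tau> k \<le> \<tau> (Suc k)" "\<tau> (Suc k) \<le> v"
          using ij k kj \<tau>_mono by auto
        ultimately show ?thesis using k kj ij by (intro bexI[of _ "\<tau> k"] bexI[of _ "\<tau> (Suc k)"]) auto
      qed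
    qed
    \<comment> \<open>There are finitely many pairs, so the sum of all quotients serves as
      \<open>r\<close>. A pair with \<open>w u v = 0\<close> has quotient 0 by the convention for
      division; its remainder vanishes since \<open>Z\<close> and \<open>X\<close> are Hoelder with
      respect to \<open>w\<close>.\<close>
    define f where "f p = norm (rem ?Z (A ?Z) (fst p) (snd p)) / w (fst p) (snd p) powr (2 * \<beta>)" for p
    have "norm (rem ?Z (A ?Z) u v) \<le> (\<Sum>p\<in>?D \<times> ?D. f p) * w u v powr (2 * \<beta>)"
      if uv: "u \<in> ?D" "v \<in> ?D" "u \<le> v" for u v
    proof (cases "w u v = 0")
      case True
      have uv': "0 \<le> u" "v \<le> T" using D uv by auto
      have "?Z v - ?Z u = 0" "X u v = 0"
        using holder_constD(1)[OF L uv'(1) uv(3) uv'(2)] X_bound[OF uv'(1) uv(3) uv'(2)] True by auto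
      then show ?thesis by (simp add: rem_def True)
    next
      case False
      have "norm (rem ?Z (A ?Z) u v) = f (u, v) * w u v powr (2 * \<beta>)"
        using False by (simp add: f_def)
      also have "\<dots> \<le> (\<Sum>p\<in>?D \<times> ?D. f p) * w u v powr (2 * \<beta>)"
        using uv by (intro mult_right_mono member_le_sum) (auto simp: f_def)
      finally show ?thesis .
    qed
    then show "\<exists>r. \<forall>u\<in>?D. \<forall>v\<in>?D. u \<le> v \<longrightarrow> norm (rem ?Z (A ?Z) u v) \<le> r * w u v powr (2 * \<beta>)" by blast
    show "?D \<subseteq> {0..T}" by (rule D)
  qed (use L in \<open>auto intro!: A_var1_superadditive A_diff_le A_var1_le\<close>)
qed

end

end

section \<open>Convergence of the Euler schemes\<close>

lemma uniform_limit_at_moving_point: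
  fixes f :: "nat \<Rightarrow> real \<Rightarrow> 'e::real_normed_vector"
  assumes "uniform_limit S f g sequentially" "continuous_on S g" "\<And>n. ts n \<in> S" "t \<in> S" "ts \<longlonglongrightarrow> t"
  shows "(\<lambda>n. f n (ts n)) \<longlonglongrightarrow> g t"
proof -
  have g: "(\<lambda>n. g (ts n)) \<longlonglongrightarrow> g t"
    by (rule continuous_on_tendsto_compose[OF assms(2,5,4)]) (simp add: assms(3))
  have "(\<lambda>n. f n (ts n) - g (ts n)) \<longlonglongrightarrow> 0"
    unfolding tendsto_iff
  proof (intro allI impI)
    fix e :: real assume "0 < e"
    from uniform_limitD[OF assms(1) this] show "\<forall>\<^sub>F n in sequentially. dist (f n (ts n) - g (ts n)) 0 < e"
      by eventually_elim (use assms(3) in \<open>auto simp: dist_norm\<close>)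
  qed
  from tendsto_add[OF this g] show ?thesis by simp
qed

section \<open>Continuity of the driver and of the second level coefficient\<close>

context rough_driver
begin

text \<open>By Chen's relation \<open>X\<close> and \<open>XX\<close> are determined by the paths
  \<open>X 0\<close> and \<open>XX 0\<close>, which are \<beta>-Hoelder and hence continuous; joint
  continuity in both times follows.\<close>

lemma X_tendsto:
  assumes u: "\<And>n. 0 \<le> us n" "\<And>n. us n \<le> vs n" "\<And>n. vs n \<le> T" "us \<longlonglongrightarrow> u" "vs \<longlonglongrightarrow> v"
  shows "(\<lambda>n. w (us n) (vs n)) \<longlonglongrightarrow> w u v" "(\<lambda>n. X (us n) (vs n)) \<longlonglongrightarrow> X u v"
    "(\<lambda>n. XX (us n) (vs n)) \<longlonglongrightarrow> XX u v"
proof -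
  have uv: "0 \<le> u" "u \<le> v" "v \<le> T"
    using LIMSEQ_le_const[OF u(4)] u(1) LIMSEQ_le[OF u(4,5)] u(2) LIMSEQ_le_const2[OF u(5)] u(3) by blast+
  have usT: "us n \<in> {0..T}" "vs n \<in> {0..T}" for n
    using u(1)[of n] u(2)[of n] u(3)[of n] by auto
  have "(\<lambda>n. (\<lambda>(s, t). w s t) (us n, vs n)) \<longlonglongrightarrow> (\<lambda>(s, t). w s t) (u, v)"
    by (rule continuous_on_tendsto_compose[OF w_cont tendsto_Pair[OF u(4,5)]]) (use u uv in auto)
  then show "(\<lambda>n. w (us n) (vs n)) \<longlonglongrightarrow> w u v" by simp
  have Xe: "X a b = X 0 b - X 0 a" if "0 \<le> a" "a \<le> b" "b \<le> T" for a b
    using X_add[of 0 a b] that by simp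
  have "norm (X 0 b - X 0 a) \<le> 1 * w a b powr \<beta>" if "0 \<le> a" "a \<le> b" "b \<le> T" for a b
    using X_bound[OF that] by (simp flip: Xe[OF that])
  then have X0: "continuous_on {0..T} (X 0)" by (rule holder_imp_continuous_on[OF zero_le_one])
  have Xus: "(\<lambda>n. X 0 (us n)) \<longlonglongrightarrow> X 0 u" and Xvs: "(\<lambda>n. X 0 (vs n)) \<longlonglongrightarrow> X 0 v"
    by (rule continuous_on_tendsto_compose[OF X0]; use u uv usT in auto)+
  have "(\<lambda>n. X 0 (vs n) - X 0 (us n)) \<longlonglongrightarrow> X 0 v - X 0 u" by (intro tendsto_intros Xus Xvs)
  then show Xlim: "(\<lambda>n. X (us n) (vs n)) \<longlonglongrightarrow> X u v" unfolding Xe[OF u(1-3)] Xe[OF uv] .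
  define C where "C = w 0 T powr \<beta>"
  have "norm (XX 0 b - XX 0 a) \<le> (2 * C) * w a b powr \<beta>" if "0 \<le> a" "a \<le> b" "b \<le> T" for a b
  proof -
    have wC: "w a b powr \<beta> \<le> C" "w 0 a powr \<beta> \<le> C"
      unfolding C_def using that \<beta> T by (auto intro!: w_powr_mono)
    have "XX 0 b - XX 0 a = XX a b + tensor (X 0 a) (X a b)" using XX_chen[of 0 a b] that by simp
    also have "norm \<dots> \<le> C * w a b powr \<beta> + C * w a b powr \<beta>"
    proof (rule norm_triangle_mono)
      show "norm (XX a b) \<le> C * w a b powr \<beta>"
        using XX_bound[OF that] mult_right_mono[OF wC(1), of "w a b powr \<beta>"] by (simp add: powr_2\<beta>)
      have "norm (X 0 a) \<le> C" using X_bound[of 0 a] wC(2) that by auto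
      then show "norm (tensor (X 0 a) (X a b)) \<le> C * w a b powr \<beta>"
        unfolding norm_tensor using X_bound[OF that] by (intro mult_mono) (auto simp: C_def)
    qed
    finally show ?thesis by (simp add: algebra_simps)
  qed
  moreover have "0 \<le> 2 * C" by (simp add: C_def)
  ultimately have XX0: "continuous_on {0..T} (XX 0)" by (intro holder_imp_continuous_on[of "2 * C"])
  have XXus: "(\<lambda>n. XX 0 (us n)) \<longlonglongrightarrow> XX 0 u" and XXvs: "(\<lambda>n. XX 0 (vs n)) \<longlonglongrightarrow> XX 0 v"
    by (rule continuous_on_tendsto_compose[OF XX0]; use u uv usT in auto)+
  have XXe: "XX a b = XX 0 b - XX 0 a - tensor (X 0 a) (X a b)" if "0 \<le> a" "a \<le> b" "b \<le> T" for a b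
    using XX_chen[of 0 a b] that by simp
  have "(\<lambda>n. XX 0 (vs n) - XX 0 (us n) - tensor (X 0 (us n)) (X (us n) (vs n))) \<longlonglongrightarrow>
      XX 0 v - XX 0 u - tensor (X 0 u) (X u v)"
    unfolding tensor_def
    by (intro tendsto_diff XXus XXvs tendsto_vec_lambda tendsto_mult tendsto_vec_nth Xus Xlim)
  then show "(\<lambda>n. XX (us n) (vs n)) \<longlonglongrightarrow> XX u v" unfolding XXe[OF u(1-3)] XXe[OF uv] .
qed

lemma \<sigma>_tendsto: "zs \<longlonglongrightarrow> z \<Longrightarrow> ys \<longlonglongrightarrow> y \<Longrightarrow> (\<lambda>n. \<sigma> (zs n, ys n)) \<longlonglongrightarrow> \<sigma> (z, y)"
proof -
  assume "zs \<longlonglongrightarrow> z" "ys \<longlonglongrightarrow> y"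
  then have "(\<lambda>n. M * norm ((zs n, ys n) - (z, y))) \<longlonglongrightarrow> M * norm ((z, y) - (z, y))" by (intro tendsto_intros)
  then have "(\<lambda>n. M * norm ((zs n, ys n) - (z, y))) \<longlonglongrightarrow> 0" by simp
  then have "(\<lambda>n. \<sigma> (zs n, ys n) - \<sigma> (z, y)) \<longlonglongrightarrow> 0"
    by (rule Lim_null_comparison[OF always_eventually, rotated]) (use \<sigma>_lipschitz in blast)
  then show ?thesis by (simp add: LIM_zero_iff)
qed

lemma level2_tendsto:
  assumes z: "zs \<longlonglongrightarrow> z" and y: "ys \<longlonglongrightarrow> y" and N: "Ns \<longlonglongrightarrow> N"
  shows "(\<lambda>n. level2 (zs n) (ys n) (Ns n)) \<longlonglongrightarrow> level2 z y N"
proof -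
  let ?d = "\<lambda>n. norm ((zs n, ys n) - (z, y))"
  have d: "?d \<longlonglongrightarrow> norm ((z, y) - (z, y))" by (intro tendsto_intros z y)
  have "(\<lambda>n. dim_const * (M\<^sup>2 * (?d n powr \<theta> + ?d n)) * norm (Ns n) + dim_const * M\<^sup>2 * norm (Ns n - N))
     \<longlonglongrightarrow> dim_const * (M\<^sup>2 * (0 powr \<theta> + 0)) * norm N + dim_const * M\<^sup>2 * norm (N - N)"
    using d \<theta> by (intro tendsto_intros tendsto_powr' N) auto
  then have "(\<lambda>n. dim_const * (M\<^sup>2 * (?d n powr \<theta> + ?d n)) * norm (Ns n) + dim_const * M\<^sup>2 * norm (Ns n - N)) \<longlonglongrightarrow> 0"
    by simp
  moreover have bound: "norm (level2 (zs n) (ys n) (Ns n) - level2 z y N)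
     \<le> dim_const * (M\<^sup>2 * (?d n powr \<theta> + ?d n)) * norm (Ns n) + dim_const * M\<^sup>2 * norm (Ns n - N)" for n
  proof -
    have "level2 (zs n) (ys n) (Ns n) - level2 z y N
       = (level2 (zs n) (ys n) (Ns n) - level2 z y (Ns n)) + level2 z y (Ns n - N)"
      by (simp add: level2_def tensor_apply_diff)
    then show ?thesis by (simp only: norm_triangle_mono[OF norm_level2_diff norm_level2])
  qed
  ultimately have "(\<lambda>n. level2 (zs n) (ys n) (Ns n) - level2 z y N) \<longlonglongrightarrow> 0"
    by (intro Lim_null_comparison[OF always_eventually[OF allI[OF bound]]])
  then show ?thesis by (simp add: LIM_zero_iff)
qed

end

context path_map
begin

text \<open>The estimates for \<open>Zs n\<close> hold on \<open>D n\<close> only, so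
  \<open>p n\<close> rounds times down into \<open>D n\<close>, with error at most
  \<open>h n\<close>. For a fixed fine partition the germ sum at the rounded points is within
  \<open>B\<close> of the increment of \<open>Zs n\<close>, where \<open>B\<close> depends neither
  on \<open>n\<close> nor on the partition; then \<open>n\<close> tends to infinity. No rate of
  convergence enters.\<close>

lemma limit_of_approximations:
  fixes Zs :: "nat \<Rightarrow> real \<Rightarrow> real^'n"
  assumes approx: "\<And>n. approx_solution \<sigma> \<beta> \<theta> M F T w X XX (D n) (Zs n) (A (Zs n)) (\<lambda>u v. var1 u v (A (Zs n)))"
    and holder: "\<And>n. holder_const L (Zs n)"
    and unif: "uniform_limit {0..T} Zs Z sequentially"
    and p: "\<And>n t. 0 \<le> t \<Longrightarrow> t \<le> T \<Longrightarrow> p n t \<in> D n" "\<And>n s t. s \<le> t \<Longrightarrow> p n s \<le> p n t"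
      "\<And>n t. 0 \<le> t \<Longrightarrow> t \<le> T \<Longrightarrow> p n t \<le> t" "\<And>n t. 0 \<le> t \<Longrightarrow> t \<le> T \<Longrightarrow> t \<le> p n t + h n"
    and h: "h \<longlonglongrightarrow> 0"
  shows "holder_const L Z"
    and "\<And>t. 0 \<le> t \<Longrightarrow> t \<le> T \<Longrightarrow> has_partition_limit (germ Z (A Z)) 0 t (Z t - \<xi>)"
    and "\<exists>r. \<forall>u v. 0 \<le> u \<and> u \<le> v \<and> v \<le> T \<longrightarrow> norm (rem Z (A Z) u v) \<le> r * w u v powr (2 * \<beta>)"
proof -
  have L: "0 \<le> L" using holder_constD(3)[OF holder] .
  have pt: "(\<lambda>n. Zs n t) \<longlonglongrightarrow> Z t" if "0 \<le> t" "t \<le> T" for t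
    using tendsto_uniform_limitI[OF unif, of t] that by auto
  show hZ: "holder_const L Z"
    unfolding holder_from_def
  proof (intro conjI allI impI L)
    show "Z 0 = \<xi>"
      using LIMSEQ_unique[OF pt[of 0]] holder_constD(2)[OF holder] T by auto
    fix u v assume uv: "0 \<le> u \<and> u \<le> v \<and> v \<le> T"
    have "(\<lambda>n. norm (Zs n v - Zs n u)) \<longlonglongrightarrow> norm (Z v - Z u)" by (intro tendsto_intros pt) (use uv in auto)
    then show "norm (Z v - Z u) \<le> L * w u v powr \<beta>"
      by (rule LIMSEQ_le_const2) (use holder_constD(1)[OF holder] uv in auto)
  qed
  have contZ: "continuous_on {0..T} Z"
    by (rule holder_imp_continuous_on[OF L holder_constD(1)[OF hZ]])
  have contA: "continuous_on {0..T} (A Z)" by (rule A_cont[OF hZ])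
  have unifA: "uniform_limit {0..T} (\<lambda>n. A (Zs n)) (A Z) sequentially"
    by (rule A_limit[OF holder hZ unif])
  have p_in: "p n t \<in> {0..T}" if "0 \<le> t" "t \<le> T" for n t
  proof -
    have "D n \<subseteq> {0..T}" by (rule approx_solution.D_sub[OF approx])
    then show ?thesis using p(1)[OF that] by blast
  qed
  have p_lim: "(\<lambda>n. p n t) \<longlonglongrightarrow> t" if "0 \<le> t" "t \<le> T" for t
  proof (rule tendsto_sandwich[of "\<lambda>n. t - h n" _ _ "\<lambda>n. t"])
    show "(\<lambda>n. t - h n) \<longlonglongrightarrow> t" using tendsto_diff[OF tendsto_const h, of t] by simp
    show "\<forall>\<^sub>F n in sequentially. t - h n \<le> p n t"
      using p(4)[OF that] by (intro always_eventually) (simp add: algebra_simps)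
  qed (use p(3)[OF that] in auto)
  have Zlim: "(\<lambda>n. Zs n (p n t)) \<longlonglongrightarrow> Z t" and Alim: "(\<lambda>n. A (Zs n) (p n t)) \<longlonglongrightarrow> A Z t"
    if "0 \<le> t" "t \<le> T" for t
    using uniform_limit_at_moving_point[OF unif contZ p_in[OF that] _ p_lim[OF that]]
      uniform_limit_at_moving_point[OF unifA contA p_in[OF that] _ p_lim[OF that]] that by auto
  have wXlim: "(\<lambda>n. w (p n u) (p n v)) \<longlonglongrightarrow> w u v" "(\<lambda>n. X (p n u) (p n v)) \<longlonglongrightarrow> X u v"
      "(\<lambda>n. XX (p n u) (p n v)) \<longlonglongrightarrow> XX u v" if uv: "0 \<le> u" "u \<le> v" "v \<le> T" for u v
    using X_tendsto[of "\<lambda>n. p n u" "\<lambda>n. p n v" u v] p_in[of u] p_in[of v] p_lim[of u] p_lim[of v] p(2)[OF uv(2)] uv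
    by auto
  have germ_lim: "(\<lambda>n. germ (Zs n) (A (Zs n)) (p n u) (p n v)) \<longlonglongrightarrow> germ Z (A Z) u v"
    if uv: "0 \<le> u" "u \<le> v" "v \<le> T" for u v
    unfolding germ_def using uv
    by (intro tendsto_add blinfun.tendsto \<sigma>_tendsto level2_tendsto Zlim Alim wXlim) auto
  have rem_lim: "(\<lambda>n. rem (Zs n) (A (Zs n)) (p n u) (p n v)) \<longlonglongrightarrow> rem Z (A Z) u v"
    if uv: "0 \<le> u" "u \<le> v" "v \<le> T" for u v
    unfolding rem_def using uv
    by (intro tendsto_diff blinfun.tendsto \<sigma>_tendsto Zlim Alim wXlim) auto
  \<comment> \<open>Short intervals inherit \<open>rem_const\<close>. For long ones the triangle
    inequality gives order \<beta>, and \<open>w u v \<ge> local_scale\<close> converts it to order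
    2\<beta>.\<close>
  define r where "r = max rem_const ((L + M) * local_scale powr (- \<beta>))"
  have "norm (rem Z (A Z) u v) \<le> r * w u v powr (2 * \<beta>)" if uv: "0 \<le> u" "u \<le> v" "v \<le> T" for u v
  proof (cases "w u v < local_scale")
    case True
    \<comment> \<open>The inequality is strict so that it passes to the rounded end points for large
      \<open>n\<close>.\<close>
    then have "\<forall>\<^sub>F n in sequentially. w (p n u) (p n v) < local_scale"
      using order_tendstoD(2)[OF wXlim(1)[OF uv]] by blast
    then have "\<forall>\<^sub>F n in sequentially. norm (rem (Zs n) (A (Zs n)) (p n u) (p n v)) \<le> rem_const * w (p n u) (p n v) powr (2 * \<beta>)"
    proof eventually_elim
      case (elim n)
      interpret a: approx_solution \<sigma> \<beta> \<theta> M F T w X XX "D n" "Zs n" "A (Zs n)" "\<lambda>u v. var1 u v (A (Zs n))"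
        by (rule approx)
      show ?case
        using a.rem_bound_local p(1)[of u n] p(1)[of v n] p(2)[OF uv(2), of n] elim uv
        unfolding a.rem_bound_def by auto
    qed
    moreover have "(\<lambda>n. rem_const * w (p n u) (p n v) powr (2 * \<beta>)) \<longlonglongrightarrow> rem_const * w u v powr (2 * \<beta>)"
      using \<beta> w_nonneg p_in[of u] p_in[of v] p(2)[OF uv(2)] uv
      by (intro tendsto_intros tendsto_powr' wXlim) auto
    ultimately have "norm (rem Z (A Z) u v) \<le> rem_const * w u v powr (2 * \<beta>)"
      using tendsto_le[OF sequentially_bot _ tendsto_norm[OF rem_lim[OF uv]]] by blast
    also have "\<dots> \<le> r * w u v powr (2 * \<beta>)" by (intro mult_right_mono) (auto simp: r_def)
    finally show ?thesis .
  next
    case False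
    have "norm (rem Z (A Z) u v) \<le> norm (Z v - Z u) + norm (blinfun_apply (\<sigma> (Z u, A Z u)) (X u v))"
      unfolding rem_def by (rule norm_triangle_ineq4)
    also have "\<dots> \<le> L * w u v powr \<beta> + M * w u v powr \<beta>"
      using holder_constD(1)[OF hZ uv] X_bound[OF uv] M
      by (intro add_mono order_trans[OF norm_\<sigma>_apply] mult_left_mono) auto
    also have "\<dots> = (L + M) * (1 * w u v powr \<beta>)" by (simp add: algebra_simps)
    also have "\<dots> \<le> (L + M) * (local_scale powr (- \<beta>) * w u v powr \<beta> * w u v powr \<beta>)"
    proof (intro mult_left_mono mult_right_mono)
      have "local_scale powr \<beta> \<le> w u v powr \<beta>" using False local_scale \<beta> by (intro powr_mono2) auto
      then show "1 \<le> local_scale powr (- \<beta>) * w u v powr \<beta>"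
        using local_scale by (simp add: powr_minus field_simps)
    qed (use L M in auto)
    also have "\<dots> = (L + M) * local_scale powr (- \<beta>) * w u v powr (2 * \<beta>)"
      by (simp add: powr_2\<beta> mult.assoc)
    also have "\<dots> \<le> r * w u v powr (2 * \<beta>)" by (intro mult_right_mono) (auto simp: r_def)
    finally show ?thesis .
  qed
  then show "\<exists>r. \<forall>u v. 0 \<le> u \<and> u \<le> v \<and> v \<le> T \<longrightarrow> norm (rem Z (A Z) u v) \<le> r * w u v powr (2 * \<beta>)" by blast
  \<comment> \<open>One bound on the variation of all \<open>A (Zs n)\<close>, from the common
    Hoelder constant; it makes the smallness below uniform in \<open>n\<close>.\<close>
  define Vmax where "Vmax = F (L * w 0 T powr \<beta>) * (L * w 0 T powr \<beta>)"
  define c1 where "c1 = sew_const ((2 + \<theta>) * \<beta>) * defect_const local_scale rem_const"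
  define c2 where "c2 = sew_const (1 + \<beta>) * M"
  have c: "0 \<le> c1" "0 \<le> c2"
    unfolding c1_def c2_def using sew_const_nonneg[OF q] sew_const_nonneg[of "1 + \<beta>"] \<beta> M
      defect_const_nonneg[of rem_const] rem_const by auto
  have V_le: "var1 0 T (A (Zs n)) \<le> Vmax" for n
    unfolding Vmax_def by (rule A_var1_le[OF holder]) (use T L holder_constD(1)[OF holder] in auto)
  show "has_partition_limit (germ Z (A Z)) 0 t (Z t - \<xi>)" if t: "0 \<le> t" "t \<le> T" for t
    unfolding has_partition_limit_def
  proof (intro allI impI)
    fix \<epsilon> :: real assume \<epsilon>: "0 < \<epsilon>"
    obtain \<eta> where \<eta>: "0 < \<eta>" "\<eta> < local_scale"
      "c1 * w 0 T * \<eta> powr ((2 + \<theta>) * \<beta> - 1) + c2 * Vmax * \<eta> powr \<beta> < \<epsilon>"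
      using small_scale_exists[OF q _ \<epsilon> local_scale(1), of \<beta> "c1 * w 0 T" "c2 * Vmax"] \<beta> by auto
    define B where "B = c1 * \<eta> powr ((2 + \<theta>) * \<beta> - 1) * w 0 T + c2 * \<eta> powr \<beta> * Vmax"
    have B: "B < \<epsilon>" using \<eta>(3) by (simp add: B_def mult_ac)
    obtain \<delta> where \<delta>: "0 < \<delta>" "\<And>u v. u \<in> {0..T} \<Longrightarrow> v \<in> {0..T} \<Longrightarrow> u \<le> v \<Longrightarrow> v - u < \<delta> \<Longrightarrow> w u v < \<eta>"
      using w_vanishing \<eta>(1) unfolding vanishing_on_def by meson
    have "norm (partition_sum (germ Z (A Z)) ts - (Z t - \<xi>)) < \<epsilon>"
      if ts: "ts \<in> partitions 0 t" "mesh_less ts (\<delta> / 2)" for ts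
    proof -
      define m where "m = length ts - 1"
      have ch: "chain {0..t} (\<lambda>i. ts ! i) m" "ts ! 0 = 0" "ts ! m = t"
        using partition_chain[OF ts(1)] by (auto simp: m_def)
      have ts_in: "0 \<le> ts ! i" "ts ! i \<le> T" if "i \<le> m" for i
        using chain_in[OF ch(1) that] t by auto
      have ts_le: "ts ! i \<le> ts ! Suc i" if "i < m" for i using ch(1) that by (auto simp: chain_def)
      have bound: "norm (Zs n (p n (ts ! m)) - Zs n (p n (ts ! 0)) - (\<Sum>i<m. germ (Zs n) (A (Zs n)) (p n (ts ! i)) (p n (ts ! Suc i)))) \<le> B"
        if hn: "h n < \<delta> / 2" for n
      proof -
        interpret a: approx_solution \<sigma> \<beta> \<theta> M F T w X XX "D n" "Zs n" "A (Zs n)" "\<lambda>u v. var1 u v (A (Zs n))"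
          by (rule approx)
        let ?t = "\<lambda>i. p n (ts ! i)"
        have chp: "chain {0..T} ?t m"
          unfolding chain_def using p_in ts_in ts_le p(2) by (auto simp del: atLeastAtMost_iff)
        have small: "w (?t i) (?t (Suc i)) < \<eta>" if i: "i < m" for i
        proof (rule \<delta>(2))
          show "?t i \<in> {0..T}" "?t (Suc i) \<in> {0..T}" "?t i \<le> ?t (Suc i)"
            using chp i by (auto simp: chain_def simp del: atLeastAtMost_iff)
          have "ts ! Suc i - ts ! i < \<delta> / 2" using ts(2) i by (simp add: mesh_less_def m_def)
          \<comment> \<open>Rounding down never moves the right end up and moves the left end down
            by at most \<open>h n < \<delta> / 2\<close>.\<close>
          then show "?t (Suc i) - ?t i < \<delta>"
            using p(3)[of "ts ! Suc i" n] p(4)[of "ts ! i" n] ts_in[of i] ts_in[of "Suc i"] i hn by simp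
        qed
        have telescope: "Zs n (?t m) - Zs n (?t 0) - (\<Sum>i<m. germ (Zs n) (A (Zs n)) (?t i) (?t (Suc i)))
          = (\<Sum>i<m. Zs n (?t (Suc i)) - Zs n (?t i) - germ (Zs n) (A (Zs n)) (?t i) (?t (Suc i)))"
          using sum_lessThan_telescope[of "\<lambda>i. Zs n (?t i)" m] by (simp add: sum_subtractf)
        have "norm (Zs n (?t m) - Zs n (?t 0) - (\<Sum>i<m. germ (Zs n) (A (Zs n)) (?t i) (?t (Suc i))))
          \<le> (\<Sum>i<m. c1 * w (?t i) (?t (Suc i)) powr ((2 + \<theta>) * \<beta>)
            + c2 * (var1 (?t i) (?t (Suc i)) (A (Zs n)) * w (?t i) (?t (Suc i)) powr \<beta>))"
          unfolding telescope
        proof (rule sum_norm_le)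
          fix i assume i: "i \<in> {..<m}"
          then have "?t i \<in> D n" "?t (Suc i) \<in> D n" "?t i \<le> ?t (Suc i)"
            using p(1) ts_in p(2) ts_le by auto
          from a.germ_error_local[OF this] small[of i] i \<eta>(2)
          show "norm (Zs n (?t (Suc i)) - Zs n (?t i) - germ (Zs n) (A (Zs n)) (?t i) (?t (Suc i)))
            \<le> c1 * w (?t i) (?t (Suc i)) powr ((2 + \<theta>) * \<beta>)
            + c2 * (var1 (?t i) (?t (Suc i)) (A (Zs n)) * w (?t i) (?t (Suc i)) powr \<beta>)"
            by (simp add: c1_def c2_def mult.assoc)
        qed
        also have "\<dots> \<le> c1 * \<eta> powr ((2 + \<theta>) * \<beta> - 1) * w (?t 0) (?t m) + c2 * \<eta> powr \<beta> * var1 (?t 0) (?t m) (A (Zs n))"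
        proof (rule sum_controls_le[where V = "\<lambda>u v. var1 u v (A (Zs n))" and \<omega> = w and t = ?t])
          show "superadditive_on {0..T} w" by (rule w)
          show "superadditive_on {0..T} (\<lambda>u v. var1 u v (A (Zs n)))" by (rule a.V)
          show "w (?t i) (?t (Suc i)) \<le> \<eta>" if "i < m" for i by (rule less_imp_le[OF small[OF that]])
          show "0 < \<beta>" using \<beta> by simp
        qed (rule chp c q)+
        also have "\<dots> \<le> B"
        proof -
          have m0: "?t 0 \<in> {0..T}" "?t m \<in> {0..T}" "?t 0 \<le> ?t m"
            using chp chain_mono[OF chp, of 0 m] by (auto simp: chain_def simp del: atLeastAtMost_iff)
          have "w (?t 0) (?t m) \<le> w 0 T" using m0 by (intro w_mono) auto
          moreover have "var1 (?t 0) (?t m) (A (Zs n)) \<le> Vmax"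
            using superadditive_on_mono[OF a.V, of 0 "?t 0" "?t m" T] m0 T V_le[of n] by auto
          ultimately show ?thesis unfolding B_def using c by (intro add_mono mult_left_mono) auto
        qed
        finally show ?thesis .
      qed
      have "(\<lambda>n. norm (Zs n (p n (ts ! m)) - Zs n (p n (ts ! 0)) - (\<Sum>i<m. germ (Zs n) (A (Zs n)) (p n (ts ! i)) (p n (ts ! Suc i)))))
        \<longlonglongrightarrow> norm (Z (ts ! m) - Z (ts ! 0) - (\<Sum>i<m. germ Z (A Z) (ts ! i) (ts ! Suc i)))"
        by (intro tendsto_norm tendsto_diff Zlim tendsto_sum germ_lim) (use ts_in ts_le in auto)
      moreover have "\<forall>\<^sub>F n in sequentially. norm (Zs n (p n (ts ! m)) - Zs n (p n (ts ! 0)) - (\<Sum>i<m. germ (Zs n) (A (Zs n)) (p n (ts ! i)) (p n (ts ! Suc i)))) \<le> B"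
      proof -
        have "\<forall>\<^sub>F n in sequentially. h n < \<delta> / 2" by (rule order_tendstoD(2)[OF h half_gt_zero[OF \<delta>(1)]])
        then show ?thesis by eventually_elim (rule bound)
      qed
      ultimately have "norm (Z (ts ! m) - Z (ts ! 0) - (\<Sum>i<m. germ Z (A Z) (ts ! i) (ts ! Suc i))) \<le> B"
        by (rule tendsto_upperbound) simp
      then have "norm (Z t - \<xi> - partition_sum (germ Z (A Z)) ts) \<le> B"
        using ch holder_constD(2)[OF hZ] by (simp add: partition_sum_def m_def)
      then show ?thesis using B by (simp add: norm_minus_commute)
    qed
    then show "\<exists>\<delta>>0. \<forall>ts\<in>partitions 0 t. mesh_less ts \<delta> \<longrightarrow> norm (partition_sum (germ Z (A Z)) ts - (Z t - \<xi>)) < \<epsilon>"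
      using \<delta>(1) by (intro exI[of _ "\<delta> / 2"]) auto
  qed
qed

section \<open>Uniform grids and compactness\<close>

definition grid :: "nat \<Rightarrow> nat \<Rightarrow> real" where
  "grid N k = real k * (T / real N)"

definition grid_floor :: "nat \<Rightarrow> real \<Rightarrow> real" where
  "grid_floor N t = grid N (nat \<lfloor>t / (T / real N)\<rfloor>)"

lemma grid_floor:
  assumes N: "0 < N" and t: "0 \<le> t" "t \<le> T"
  shows "grid_floor N t \<in> grid N ` {..N}" "grid_floor N t \<le> t" "t \<le> grid_floor N t + T / real N"
proof -
  define c where "c = T / real N"
  have c: "0 < c" using T N by (simp add: c_def)
  define k where "k = nat \<lfloor>t / c\<rfloor>"
  have fl: "grid_floor N t = real k * c" by (simp add: grid_floor_def grid_def k_def c_def)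
  have k: "real k = of_int \<lfloor>t / c\<rfloor>" using t c by (simp add: k_def)
  then have kl: "real k \<le> t / c" "t / c < real k + 1" by linarith+
  show "grid_floor N t \<le> t" using kl(1) c by (simp add: fl le_divide_eq)
  show "t \<le> grid_floor N t + T / real N" using kl(2) c unfolding fl c_def[symmetric]
    by (simp add: divide_less_eq algebra_simps)
  have "t / c \<le> real N" using t N T c by (simp add: c_def divide_le_eq)
  then have "k \<le> N" using kl(1) by linarith
  then show "grid_floor N t \<in> grid N ` {..N}"
    by (auto simp: grid_floor_def k_def c_def)
qed

lemma grid_floor_mono: "s \<le> t \<Longrightarrow> grid_floor N s \<le> grid_floor N t"
  unfolding grid_floor_def grid_def using T
  by (intro mult_right_mono of_nat_mono nat_mono floor_mono divide_right_mono) auto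

text \<open>From \<open>n0\<close> on every cell has control below 1. The step-dependent Hoelder
  constant of the scheme makes the a priori estimate applicable, which then replaces it by one that
  does not see the mesh.\<close>

lemma euler_on_grid:
  obtains n0 where "0 < n0" "\<And>N. n0 \<le> N \<Longrightarrow> \<exists>Z. holder_const (global_const path_const * (1 + w 0 T)) Z \<and>
    approx_solution \<sigma> \<beta> \<theta> M F T w X XX (grid N ` {..N}) Z (A Z) (\<lambda>u v. var1 u v (A Z))"
proof -
  obtain \<delta> where \<delta>: "0 < \<delta>" "\<And>u v. u \<in> {0..T} \<Longrightarrow> v \<in> {0..T} \<Longrightarrow> u \<le> v \<Longrightarrow> v - u < \<delta> \<Longrightarrow> w u v < 1"
    using w_vanishing unfolding vanishing_on_def by (meson zero_less_one)
  obtain n0 where n0: "T / \<delta> < real n0" using reals_Archimedean2 by blast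
  have "0 < T / \<delta>" using T \<delta>(1) by simp
  then have pos: "0 < n0" using n0 by (metis less_trans of_nat_0_less_iff)
  have "\<exists>Z. holder_const (global_const path_const * (1 + w 0 T)) Z \<and>
    approx_solution \<sigma> \<beta> \<theta> M F T w X XX (grid N ` {..N}) Z (A Z) (\<lambda>u v. var1 u v (A Z))"
    if N: "n0 \<le> N" for N
  proof -
    have N0: "0 < N" using N pos by simp
    have step: "0 < T / real N" "T / real N < \<delta>"
    proof -
      show "0 < T / real N" using T N0 by simp
      have "T < \<delta> * real n0" using n0 \<delta>(1) by (simp add: divide_less_eq mult.commute)
      also have "\<dots> \<le> \<delta> * real N" using N \<delta>(1) by simp
      finally show "T / real N < \<delta>" using N0 by (simp add: divide_less_eq)
    qed
    have g: "grid N 0 = 0" "grid N N = T" "grid N (Suc k) = grid N k + T / real N" for k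
      using N0 by (auto simp: grid_def algebra_simps add_divide_distrib)
    have gr: "grid N k \<in> {0..T}" if "k \<le> N" for k
      using that step(1) g(2) mult_right_mono[of "real k" "real N" "T / real N"] T unfolding grid_def by auto
    have fine: "w (grid N k) (grid N (Suc k)) \<le> 1" if "k < N" for k
    proof (rule less_imp_le[OF \<delta>(2)])
      show "grid N k \<in> {0..T}" "grid N (Suc k) \<in> {0..T}" using that by (auto intro!: gr simp del: atLeastAtMost_iff)
    qed (use g(3) step in auto)
    have less: "grid N k < grid N (Suc k)" if "k < N" for k using g(3) step by simp
    let ?Z = "euler (grid N) N"
    have ap: "approx_solution \<sigma> \<beta> \<theta> M F T w X XX (grid N ` {..N}) ?Z (A ?Z) (\<lambda>u v. var1 u v (A ?Z))"
      by (rule euler_approx[OF g(1,2) less fine])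
    moreover have "holder_const (global_const path_const * (1 + w 0 T)) ?Z"
    proof -
      obtain L where "holder_const L ?Z" using euler_holder[OF g(1,2) less fine, of N] by auto
      then show ?thesis
        unfolding holder_from_def using approx_solution.path_bound_global[OF ap]
          global_const_nonneg[of path_const] path_const w_nonneg[of 0 T] T by auto
    qed
    ultimately show ?thesis by blast
  qed
  then show ?thesis using that pos by blast
qed

theorem exact_solution_exists:
  obtains Z L r where "holder_const L Z"
    "\<And>t. 0 \<le> t \<Longrightarrow> t \<le> T \<Longrightarrow> has_partition_limit (germ Z (A Z)) 0 t (Z t - \<xi>)"
    "\<And>u v. 0 \<le> u \<Longrightarrow> u \<le> v \<Longrightarrow> v \<le> T \<Longrightarrow> norm (rem Z (A Z) u v) \<le> r * w u v powr (2 * \<beta>)"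
proof -
  define L where "L = global_const path_const * (1 + w 0 T)"
  obtain n0 where n0: "0 < n0" "\<And>N. n0 \<le> N \<Longrightarrow> \<exists>Z. holder_const L Z \<and>
      approx_solution \<sigma> \<beta> \<theta> M F T w X XX (grid N ` {..N}) Z (A Z) (\<lambda>u v. var1 u v (A Z))"
    using euler_on_grid unfolding L_def by blast
  then have "\<exists>Zs. \<forall>n. holder_const L (Zs n) \<and>
      approx_solution \<sigma> \<beta> \<theta> M F T w X XX (grid (n0 + n) ` {..n0 + n}) (Zs n) (A (Zs n)) (\<lambda>u v. var1 u v (A (Zs n)))"
    by (intro choice allI) simp
  then obtain Zs where Zs: "\<And>n. holder_const L (Zs n)"
      "\<And>n. approx_solution \<sigma> \<beta> \<theta> M F T w X XX (grid (n0 + n) ` {..n0 + n}) (Zs n) (A (Zs n)) (\<lambda>u v. var1 u v (A (Zs n)))"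
    by blast
  have L: "0 \<le> L" using holder_constD(3)[OF Zs(1)] .
  obtain Z k where Z: "continuous_on {0..T} Z" "strict_mono (k :: nat \<Rightarrow> nat)"
    "\<And>e. 0 < e \<Longrightarrow> \<exists>N. \<forall>n x. n \<ge> N \<and> x \<in> {0..T} \<longrightarrow> norm (Zs (k n) x - Z x) < e"
  proof (rule Arzela_Ascoli[of "{0..T}" Zs "norm \<xi> + L * w 0 T powr \<beta>"])
    fix n x assume x: "x \<in> {0..T}"
    have "norm (Zs n x) \<le> norm (Zs n 0) + norm (Zs n x - Zs n 0)" by (rule norm_triangle_sub)
    also have "\<dots> \<le> norm \<xi> + L * w 0 x powr \<beta>"
      using holder_constD(1)[OF Zs(1), of 0 x n] holder_constD(2)[OF Zs(1)] x by auto
    also have "\<dots> \<le> norm \<xi> + L * w 0 T powr \<beta>"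
      using x L \<beta> by (intro add_left_mono mult_left_mono w_powr_mono) auto
    finally show "norm (Zs n x) \<le> norm \<xi> + L * w 0 T powr \<beta>" .
  next
    fix x e :: real assume x: "x \<in> {0..T}" and e: "0 < e"
    obtain \<delta> where \<delta>: "0 < \<delta>" "\<And>u v. u \<in> {0..T} \<Longrightarrow> v \<in> {0..T} \<Longrightarrow> u \<le> v \<Longrightarrow> v - u < \<delta> \<Longrightarrow> L * w u v powr \<beta> < e"
      using holder_modulus[OF L e] by blast
    have lt: "norm (Zs n v - Zs n u) < e" if "u \<in> {0..T}" "v \<in> {0..T}" "u \<le> v" "v - u < \<delta>" for n u v
      using \<delta>(2)[OF that] holder_constD(1)[OF Zs(1), of u v n] that by auto
    have "norm (Zs n x - Zs n y) < e" if "y \<in> {0..T}" "norm (x - y) < \<delta>" for n y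
      using lt[of x y n] lt[of y x n] that x by (cases "x \<le> y") (auto simp: norm_minus_commute)
    then show "\<exists>d. 0 < d \<and> (\<forall>n y. y \<in> {0..T} \<and> norm (x - y) < d \<longrightarrow> norm (Zs n x - Zs n y) < e)"
      using \<delta>(1) by blast
  qed auto
  have unif: "uniform_limit {0..T} (\<lambda>n. Zs (k n)) Z sequentially"
    unfolding uniform_limit_iff eventually_sequentially dist_norm using Z(3) by blast
  have h: "(\<lambda>n. T / real (n0 + k n)) \<longlonglongrightarrow> 0"
  proof -
    have "filterlim (\<lambda>n. n0 + k n) at_top sequentially"
      by (rule filterlim_at_top_mono[OF filterlim_subseq[OF Z(2)]]) auto
    then show ?thesis
      by (intro real_tendsto_divide_at_top[OF tendsto_const] filterlim_compose[OF filterlim_real_sequentially])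
  qed
  have N0: "0 < n0 + k n" for n using n0(1) by simp
  note lim = limit_of_approximations[OF Zs(2) Zs(1) unif grid_floor(1)[OF N0] grid_floor_mono
      grid_floor(2)[OF N0] grid_floor(3)[OF N0] h]
  obtain r where "\<forall>u v. 0 \<le> u \<and> u \<le> v \<and> v \<le> T \<longrightarrow> norm (rem Z (A Z) u v) \<le> r * w u v powr (2 * \<beta>)"
    using lim(3) by blast
  then show ?thesis using that[OF lim(1,2)] by blast
qed

end

section \<open>Coefficients of class \<open>Lip\<close>\<close>

lemma iterated_deriv_Nil_eq: "iterated_deriv f [] = f"
  by (rule ext) simp

text \<open>
  For \<open>\<gamma> - 1 = m + \<rho>\<close> with \<open>m \<ge> 2\<close> the second derivative is bounded, so \<open>D\<sigma>\<close> is Lipschitz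
  and \<open>\<theta> = 1\<close>; for \<open>m = 1\<close> one has \<open>\<theta> = \<rho> = \<gamma> - 2\<close>.  The case \<open>m = 0\<close> is excluded by
  \<open>\<gamma> > 1/\<beta> \<ge> 2\<close>.
\<close>
lemma lip_class_derivative:
  fixes f :: "'a::euclidean_space \<Rightarrow> 'b::real_normed_vector"
  assumes \<beta>: "1/3 < \<beta>" "\<beta> \<le> 1/2" and \<gamma>: "\<gamma> > 1 / \<beta>" and lip: "lip_class (\<gamma> - 1) f"
  obtains \<theta> M f' where "0 < \<theta>" "\<theta> \<le> 1" "1 < (2 + \<theta>) * \<beta>" "1 \<le> M" "\<And>x. norm (f x) \<le> M"
    "\<And>x. (f has_derivative f' x) (at x)" "\<And>x v. norm (f' x v) \<le> M * norm v"
    "\<And>x y v. norm (f' x v - f' y v) \<le> M * norm (x - y) powr \<theta> * norm v"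
proof -
  obtain m \<rho> where m: "\<gamma> - 1 = real m + \<rho>" "0 < \<rho>" "\<rho> \<le> 1"
    and diff: "\<And>vs x. length vs < m \<Longrightarrow> iterated_deriv f vs differentiable (at x)"
    and bdd: "\<And>k. k \<le> m \<Longrightarrow> \<exists>B. \<forall>vs x. length vs = k \<longrightarrow> norm (iterated_deriv f vs x) \<le> B * prod_list (map norm vs)"
    and hol: "\<exists>C. \<forall>vs x y. length vs = m \<longrightarrow> norm (iterated_deriv f vs x - iterated_deriv f vs y)
              \<le> C * norm (x - y) powr \<rho> * prod_list (map norm vs)"
    using lip unfolding lip_class_def by metis
  have "2 \<le> 1 / \<beta>" using \<beta> by (simp add: le_divide_eq)
  then have "0 < m" using m \<gamma> by (cases m) auto
  define f' where "f' x = frechet_derivative f (at x)" for x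
  have f': "(f has_derivative f' x) (at x)" for x
    using diff[of "[]" x] \<open>0 < m\<close> unfolding iterated_deriv_Nil_eq f'_def by (simp add: frechet_derivative_works)
  have it1: "iterated_deriv f [v] x = f' x v" for v x
    by (simp add: iterated_deriv_Nil_eq f'_def)
  obtain B0 where B0: "\<And>x. norm (f x) \<le> B0"
    using bdd[of 0] by (auto simp: iterated_deriv_Nil_eq)
  obtain B1 where B1: "\<And>x v. norm (f' x v) \<le> B1 * norm v"
  proof -
    obtain B where "\<forall>vs x. length vs = 1 \<longrightarrow> norm (iterated_deriv f vs x) \<le> B * prod_list (map norm vs)"
      using bdd[of 1] \<open>0 < m\<close> by auto
    then have "norm (iterated_deriv f [v] x) \<le> B * prod_list (map norm [v])" for v x by (metis One_nat_def length_Cons list.size(3))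
    then show ?thesis unfolding it1 by (intro that) simp
  qed
  have "\<exists>\<theta> C. 0 < \<theta> \<and> \<theta> \<le> 1 \<and> 1 < (2 + \<theta>) * \<beta> \<and> (\<forall>x y v. norm (f' x v - f' y v) \<le> C * norm (x - y) powr \<theta> * norm v)"
  proof (cases "m = 1")
    case True
    obtain C where C: "\<forall>vs x y. length vs = m \<longrightarrow> norm (iterated_deriv f vs x - iterated_deriv f vs y)
              \<le> C * norm (x - y) powr \<rho> * prod_list (map norm vs)" using hol by blast
    have "norm (iterated_deriv f [v] x - iterated_deriv f [v] y) \<le> C * norm (x - y) powr \<rho> * prod_list (map norm [v])" for x y v
      using C[rule_format, of "[v]" x y] True by simp
    then have "\<forall>x y v. norm (f' x v - f' y v) \<le> C * norm (x - y) powr \<rho> * norm v"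
      unfolding it1 by simp
    moreover have "2 + \<rho> = \<gamma>" using m(1) True by simp
    then have "1 < (2 + \<rho>) * \<beta>" using \<gamma> \<beta> by (simp add: divide_less_eq)
    ultimately show ?thesis using m by blast
  next
    case False
    then have m2: "2 \<le> m" using \<open>0 < m\<close> by simp
    obtain C where C: "\<forall>vs x. length vs = 2 \<longrightarrow> norm (iterated_deriv f vs x) \<le> C * prod_list (map norm vs)"
      using bdd[OF m2] by blast
    have "norm (f' x v - f' y v) \<le> C * norm (x - y) powr 1 * norm v" for x y v
    proof -
      have der: "((\<lambda>x. f' x v) has_derivative frechet_derivative (iterated_deriv f [v]) (at x)) (at x)" for x
        using diff[of "[v]" x] m2 unfolding it1[abs_def, symmetric] by (simp add: frechet_derivative_works)
      have "norm (f' x v - f' y v) \<le> (C * norm v) * norm (x - y)"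
      proof (rule differentiable_bound[of UNIV "\<lambda>x. f' x v" "\<lambda>x. frechet_derivative (iterated_deriv f [v]) (at x)"])
        show "onorm (frechet_derivative (iterated_deriv f [v]) (at x)) \<le> C * norm v" for x
        proof (rule onorm_le)
          fix u show "norm (frechet_derivative (iterated_deriv f [v]) (at x) u) \<le> C * norm v * norm u"
            using C[rule_format, of "[u, v]" x] by (simp add: mult_ac)
        qed
      qed (use der in auto)
      then show ?thesis by (simp add: mult_ac)
    qed
    moreover have "1 < (2 + 1) * \<beta>" using \<beta> by simp
    ultimately show ?thesis by (intro exI[of _ 1] exI[of _ C]) auto
  qed
  then obtain \<theta> C where \<theta>: "0 < \<theta>" "\<theta> \<le> 1" "1 < (2 + \<theta>) * \<beta>"
    and C: "\<And>x y v. norm (f' x v - f' y v) \<le> C * norm (x - y) powr \<theta> * norm v" by blast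
  define M where "M = 1 + \<bar>B0\<bar> + \<bar>B1\<bar> + \<bar>C\<bar>"
  have M: "1 \<le> M" "B0 \<le> M" "B1 \<le> M" "C \<le> M" by (auto simp: M_def)
  show ?thesis
  proof (rule that[OF \<theta> M(1) _ f'])
    show "norm (f x) \<le> M" for x using B0[of x] M(2) by linarith
    show "norm (f' x v) \<le> M * norm v" for x v
      by (rule order_trans[OF B1 mult_right_mono[OF M(3)]]) simp
    show "norm (f' x v - f' y v) \<le> M * norm (x - y) powr \<theta> * norm v" for x y v
      using order_trans[OF C mult_right_mono[OF mult_right_mono[OF M(4)]]] by simp
  qed
qed

text \<open>The partial derivatives are the total one at (v, 0) and (0, v), which have the norm of
  \<open>v\<close>, so \<open>M\<close> carries over. The Taylor bound is the mean value inequality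
  on the segment from \<open>z\<close> to \<open>z'\<close>, where the derivative differs from that
  at \<open>z\<close> by at most M |z' - z|^\<theta>.\<close>

lemma lip_class_rough_coefficient:
  fixes \<sigma> :: "(real^'n) \<times> (real^'n) \<Rightarrow> (real^'d) \<Rightarrow>\<^sub>L (real^'n)"
  assumes \<beta>: "1/3 < \<beta>" "\<beta> \<le> 1/2" and \<gamma>: "\<gamma> > 1 / \<beta>" and lip: "lip_class (\<gamma> - 1) \<sigma>"
    and F: "mono_on {0..} F" "\<And>u. u \<ge> 0 \<Longrightarrow> F u > 0"
  obtains \<theta> M where "rough_coefficient \<sigma> \<beta> \<theta> M F"
proof -
  obtain \<theta> M \<sigma>' where \<theta>: "0 < \<theta>" "\<theta> \<le> 1" "1 < (2 + \<theta>) * \<beta>" and M: "1 \<le> M"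
    and bd: "\<And>x. norm (\<sigma> x) \<le> M"
    and der: "\<And>x. (\<sigma> has_derivative \<sigma>' x) (at x)" and der_bd: "\<And>x v. norm (\<sigma>' x v) \<le> M * norm v"
    and hol: "\<And>x y v. norm (\<sigma>' x v - \<sigma>' y v) \<le> M * norm (x - y) powr \<theta> * norm v"
    using lip_class_derivative[OF \<beta> \<gamma> lip] by metis
  have d1: "((\<lambda>z. \<sigma> (z, y)) has_derivative (\<lambda>v. \<sigma>' (z, y) (v, 0))) (at z)" for z y
    by (rule has_derivative_compose[OF _ der, of "\<lambda>z. (z, y)" "\<lambda>v. (v, 0)" z UNIV])
      (auto intro!: derivative_eq_intros)
  have d2: "((\<lambda>y. \<sigma> (z, y)) has_derivative (\<lambda>v. \<sigma>' (z, y) (0, v))) (at y)" for z y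
    by (rule has_derivative_compose[OF _ der, of "\<lambda>y. (z, y)" "\<lambda>v. (0, v)" y UNIV])
      (auto intro!: derivative_eq_intros)
  have p1: "partial1 \<sigma> z y = (\<lambda>v. \<sigma>' (z, y) (v, 0))" for z y
    unfolding partial1_def using frechet_derivative_at[OF d1] by simp
  have p2: "partial2 \<sigma> z y = (\<lambda>v. \<sigma>' (z, y) (0, v))" for z y
    unfolding partial2_def using frechet_derivative_at[OF d2] by simp
  have "rough_coefficient \<sigma> \<beta> \<theta> M F"
  proof (rule rough_coefficient.intro)
    show "norm (\<sigma> p - \<sigma> p') \<le> M * norm (p - p')" for p p'
      by (rule differentiable_bound[of UNIV \<sigma> \<sigma>']) (use der der_bd in \<open>auto intro: onorm_le\<close>)
    show "linear (partial1 \<sigma> z y)" for z y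
      unfolding p1 by (rule has_derivative_linear[OF d1])
    show "norm (partial1 \<sigma> z y v) \<le> M * norm v" for z y v
      unfolding p1 using der_bd[of "(z, y)" "(v, 0)"] by (simp add: norm_Pair)
    show "norm (partial2 \<sigma> z y v) \<le> M * norm v" for z y v
      unfolding p2 using der_bd[of "(z, y)" "(0, v)"] by (simp add: norm_Pair)
    show "norm (partial1 \<sigma> z y v - partial1 \<sigma> z' y' v) \<le> M * norm ((z, y) - (z', y')) powr \<theta> * norm v" for z y z' y' v
      unfolding p1 using hol[of "(z, y)" "(v, 0)" "(z', y')"] by (simp add: norm_Pair)
    show "norm (\<sigma> (z', y) - \<sigma> (z, y) - partial1 \<sigma> z y (z' - z)) \<le> M * norm (z' - z) powr (1 + \<theta>)" for z z' y
    proof -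
      have "norm (\<sigma> (z', y) - \<sigma> (z, y) - partial1 \<sigma> z y (z' - z)) \<le> norm (z' - z) * (M * norm (z' - z) powr \<theta>)"
        unfolding p1
      proof (rule differentiable_bound_linearization[where S = "closed_segment z z'" and f = "\<lambda>z. \<sigma> (z, y)"
            and f' = "\<lambda>z v. \<sigma>' (z, y) (v, 0)"])
        show "z + t *\<^sub>R (z' - z) \<in> closed_segment z z'" if "t \<in> {0..1}" for t
          using that by (auto simp: in_segment algebra_simps intro!: exI[of _ t])
        show "((\<lambda>z. \<sigma> (z, y)) has_derivative (\<lambda>v. \<sigma>' (\<zeta>, y) (v, 0))) (at \<zeta> within closed_segment z z')" for \<zeta>
          using d1 by (rule has_derivative_at_withinI)
        show "onorm ((\<lambda>v. \<sigma>' (\<zeta>, y) (v, 0)) - (\<lambda>v. \<sigma>' (z, y) (v, 0))) \<le> M * norm (z' - z) powr \<theta>"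
          if "\<zeta> \<in> closed_segment z z'" for \<zeta>
        proof (rule onorm_le)
          fix v :: "real^'n"
          have "norm (\<zeta> - z) \<le> norm (z' - z)"
            using segment_bound(1)[OF that] by (simp add: norm_minus_commute)
          then have "norm ((\<zeta>, y) - (z, y)) powr \<theta> \<le> norm (z' - z) powr \<theta>"
            using \<theta> by (intro powr_mono2) (auto simp: norm_Pair)
          then have "M * norm ((\<zeta>, y) - (z, y)) powr \<theta> * norm (v, 0::real^'n) \<le> M * norm (z' - z) powr \<theta> * norm (v, 0::real^'n)"
            using M by (intro mult_right_mono mult_left_mono) auto
          then show "norm (((\<lambda>v. \<sigma>' (\<zeta>, y) (v, 0)) - (\<lambda>v. \<sigma>' (z, y) (v, 0))) v) \<le> M * norm (z' - z) powr \<theta> * norm v"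
            using hol[of "(\<zeta>, y)" "(v, 0)" "(z, y)"] by (simp add: norm_Pair)
        qed
      qed simp
      also have "\<dots> = M * norm (z' - z) powr (1 + \<theta>)"
        by (simp add: powr_add)
      finally show ?thesis .
    qed
    show "F x \<le> F y" if "0 \<le> x" "x \<le> y" for x y
      using F(1) that by (auto simp: mono_on_def)
  qed (use \<beta> \<theta> M bd F(2) in auto)
  then show ?thesis by (rule that)
qed

section \<open>From norms to pointwise bounds\<close>

text \<open>The infimum is attained: where the weight is positive one divides by it, and where it is
  0 any admissible constant, which exists by finiteness, forces the value 0.\<close>

lemma norm_le_holder_norm2:
  assumes "holder_norm2 \<omega> \<theta> s t G < top" "s \<le> u" "u \<le> v" "v \<le> t"
  shows "norm (G u v) \<le> enn2real (holder_norm2 \<omega> \<theta> s t G) * \<omega> u v powr \<theta>"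
proof -
  define S where "S = {ennreal C |C. 0 < C \<and>
            (\<forall>u v. s \<le> u \<and> u \<le> v \<and> v \<le> t \<longrightarrow> norm (G u v) \<le> C * \<omega> u v powr \<theta>)}"
  have inf: "holder_norm2 \<omega> \<theta> s t G = Inf S" by (simp add: holder_norm2_def S_def)
  show ?thesis
  proof (cases "\<omega> u v powr \<theta> = 0")
    case True
    have "S \<noteq> {}" using assms(1) unfolding inf by (metis Inf_empty less_irrefl)
    then obtain C where "norm (G u v) \<le> C * \<omega> u v powr \<theta>" using assms(2-4) unfolding S_def by blast
    then show ?thesis using True by simp
  next
    case False
    then have pos: "0 < \<omega> u v powr \<theta>" using powr_ge_zero[of "\<omega> u v" \<theta>] by linarith
    have "ennreal (norm (G u v) / \<omega> u v powr \<theta>) \<le> Inf S"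
    proof (rule Inf_greatest)
      fix c assume "c \<in> S"
      then obtain C where C: "c = ennreal C" "norm (G u v) \<le> C * \<omega> u v powr \<theta>" using assms(2-4) unfolding S_def by blast
      then show "ennreal (norm (G u v) / \<omega> u v powr \<theta>) \<le> c" using pos by (simp add: divide_le_eq ennreal_leI)
    qed
    also have "\<dots> = ennreal (enn2real (holder_norm2 \<omega> \<theta> s t G))" using assms(1) by (simp add: inf)
    finally have "norm (G u v) / \<omega> u v powr \<theta> \<le> enn2real (holder_norm2 \<omega> \<theta> s t G)" by simp
    then show ?thesis using pos by (simp add: divide_le_eq)
  qed
qed

lemma holder_norm2_le:
  assumes "0 < C" "\<And>u v. s \<le> u \<Longrightarrow> u \<le> v \<Longrightarrow> v \<le> t \<Longrightarrow> norm (G u v) \<le> C * \<omega> u v powr \<theta>"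
  shows "holder_norm2 \<omega> \<theta> s t G \<le> ennreal C"
  unfolding holder_norm2_def by (rule Inf_lower) (use assms in auto)

lemma holder_norm_le:
  assumes "0 < C" "\<And>u v. s \<le> u \<Longrightarrow> u \<le> v \<Longrightarrow> v \<le> t \<Longrightarrow> norm (x v - x u) \<le> C * \<omega> u v powr \<theta>"
  shows "holder_norm \<omega> \<theta> s t x \<le> ennreal C"
  unfolding holder_norm_def using assms by (rule holder_norm2_le)

lemma var_holder_norm_1_le:
  assumes "0 < C" "\<And>u v. s \<le> u \<Longrightarrow> u \<le> v \<Longrightarrow> v \<le> t \<Longrightarrow> p_var 1 u v x \<le> ennreal (C * \<omega> u v powr \<theta>)"
  shows "var_holder_norm \<omega> 1 \<theta> s t x \<le> ennreal C"
  unfolding var_holder_norm_def by (rule Inf_lower) (use assms in auto)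

lemma rough_norm_nonneg: "0 \<le> rough_norm T \<omega> \<beta> X XX"
  by (simp add: rough_norm_def)

lemma p_var_cong: "(\<And>u. s \<le> u \<Longrightarrow> u \<le> t \<Longrightarrow> x u = y u) \<Longrightarrow> p_var p s t x = p_var p s t y"
proof -
  assume eq: "\<And>u. s \<le> u \<Longrightarrow> u \<le> t \<Longrightarrow> x u = y u"
  have "partition_sum (\<lambda>u v. norm (x v - x u) powr p) ts = partition_sum (\<lambda>u v. norm (y v - y u) powr p) ts"
    if ts: "ts \<in> partitions s t" for ts
    unfolding partition_sum_def
  proof (rule sum.cong)
    fix i assume "i \<in> {..<length ts - 1}"
    then have "ts ! i \<in> {s..t}" "ts ! Suc i \<in> {s..t}"
      using partition_chain(1)[OF ts] by (auto simp: chain_def simp del: atLeastAtMost_iff)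
    then show "norm (x (ts ! Suc i) - x (ts ! i)) powr p = norm (y (ts ! Suc i) - y (ts ! i)) powr p"
      using eq by simp
  qed simp
  then show ?thesis unfolding p_var_def by (simp cong: SUP_cong)
qed

lemma norm_le_sup_norm:
  assumes "sup_norm s t x < ennreal \<epsilon>" "s \<le> u" "u \<le> t"
  shows "norm (x u) < \<epsilon>"
proof -
  have "ennreal (norm (x u)) \<le> sup_norm s t x"
    unfolding sup_norm_def using assms by (intro SUP_upper) auto
  also note assms(1)
  finally show ?thesis by (simp add: ennreal_less_iff)
qed

section \<open>Constants and bounds on the whole interval\<close>

context rough_coefficient
begin

lemma norm_\<sigma>_diff:
  "norm (\<sigma> (z, y) - \<sigma> (z', y')) \<le> M * (norm (z - z') + norm (y - y'))"
proof -
  have "M * norm (z - z', y - y') \<le> M * (norm (z - z') + norm (y - y'))"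
    using M by (intro mult_left_mono norm_Pair_le) auto
  then show ?thesis using \<sigma>_lipschitz[of "(z, y)" "(z', y')"] by simp
qed

text \<open>The first summand serves intervals of control up to \<open>local_scale\<close>, the
  second the longer ones.\<close>

definition rem_global_const :: real where
  "rem_global_const = rem_const + (global_const path_const + M) * local_scale powr (- \<beta>)"

text \<open>The constants for \<open>Z\<close>, \<open>Z'\<close>, the variation of A(Z) and the
  remainder, in this order; that for \<open>Z'\<close> stems from the Lipschitz bound of
  \<sigma>.\<close>

definition total_const :: real where
  "total_const = global_const path_const + M * (global_const path_const + global_const A_const)
     + global_const A_const + rem_global_const"

lemma global_consts_pos:
  "0 < global_const path_const" "0 < global_const A_const" "0 < rem_global_const" "0 < total_const"
proof -
  show *: "0 < global_const path_const" "0 < global_const A_const"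
    using path_const A_const local_scale by (simp_all add: global_const_def)
  have "0 \<le> (global_const path_const + M) * local_scale powr (- \<beta>)" using * M by simp
  then show "0 < rem_global_const" unfolding rem_global_const_def using rem_const by linarith
  then show "0 < total_const"
    unfolding total_const_def using * M by (intro add_pos_pos mult_pos_pos) auto
qed

end

context path_map
begin

text \<open>Increments of \<open>Z\<close> and the variation of A(Z) are subadditive and grow from
  their local bounds by bisection. The remainder is not subadditive: beyond
  \<open>local_scale\<close> it is estimated by the increment of \<open>Z\<close> and the first
  order term, a negative power of \<open>local_scale\<close> making up for the missing
  order.\<close>

lemma exact_solution_bounds:
  assumes approx: "approx_solution \<sigma> \<beta> \<theta> M F T w X XX {0..T} Z (A Z) (\<lambda>u v. var1 u v (A Z))"
    and Z: "holder_const L Z" and uv: "0 \<le> u" "u \<le> v" "v \<le> T"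
  shows "norm (Z v - Z u) \<le> global_const path_const * (1 + w 0 T) * w u v powr \<beta>"
    and "var1 u v (A Z) \<le> global_const A_const * (1 + w 0 T) * w u v powr \<beta>"
    and "norm (\<sigma> (Z v, A Z v) - \<sigma> (Z u, A Z u))
           \<le> M * (global_const path_const + global_const A_const) * (1 + w 0 T) * w u v powr \<beta>"
    and "norm (rem Z (A Z) u v) \<le> rem_global_const * (1 + w 0 T) * w u v powr (2 * \<beta>)"
proof -
  interpret a: approx_solution \<sigma> \<beta> \<theta> M F T w X XX "{0..T}" Z "A Z" "\<lambda>u v. var1 u v (A Z)"
    by (rule approx)
  show 1: "norm (Z v - Z u) \<le> global_const path_const * (1 + w 0 T) * w u v powr \<beta>"
    by (rule a.path_bound_global[OF uv])
  show 2: "var1 u v (A Z) \<le> global_const A_const * (1 + w 0 T) * w u v powr \<beta>"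
    unfolding global_const_def
  proof (rule subadditive_growth[where \<phi> = "\<lambda>u v. var1 u v (A Z)", OF _ _ local_scale(1,2) _ uv])
    show "var1 a b (A Z) \<le> A_const * w a b powr \<beta>" if "0 \<le> a" "a \<le> b" "b \<le> T" "w a b \<le> local_scale" for a b
      by (rule a.V_bound_local[OF that])
    show "var1 a b (A Z) \<le> var1 a c (A Z) + var1 c b (A Z)" if "0 \<le> a" "a \<le> c" "c \<le> b" "b \<le> T" for a b c
      using that by (intro var1_subadditive A_p_var_finite[OF Z]) auto
  qed (use A_const in auto)
  have W: "0 \<le> w 0 T" using w_nonneg[of 0 T] T by auto
  have "norm (\<sigma> (Z v, A Z v) - \<sigma> (Z u, A Z u)) \<le> M * (norm (Z v - Z u) + norm (A Z v - A Z u))"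
    by (rule norm_\<sigma>_diff)
  also have "\<dots> \<le> M * (global_const path_const * (1 + w 0 T) * w u v powr \<beta> + global_const A_const * (1 + w 0 T) * w u v powr \<beta>)"
    using 1 2 A_diff_le[OF Z uv] M by (intro mult_left_mono) auto
  also have "\<dots> = M * (global_const path_const + global_const A_const) * (1 + w 0 T) * w u v powr \<beta>"
    by (simp only: distrib_left distrib_right mult.assoc)
  finally show "norm (\<sigma> (Z v, A Z v) - \<sigma> (Z u, A Z u))
      \<le> M * (global_const path_const + global_const A_const) * (1 + w 0 T) * w u v powr \<beta>" .
  show "norm (rem Z (A Z) u v) \<le> rem_global_const * (1 + w 0 T) * w u v powr (2 * \<beta>)"
  proof (cases "w u v \<le> local_scale")
    case True
    then have "norm (rem Z (A Z) u v) \<le> rem_const * 1 * w u v powr (2 * \<beta>)"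
      using a.rem_bound_local uv unfolding a.rem_bound_def by auto
    also have "\<dots> \<le> rem_global_const * (1 + w 0 T) * w u v powr (2 * \<beta>)"
    proof (intro mult_right_mono mult_mono)
      have "0 \<le> (global_const path_const + M) * local_scale powr (- \<beta>)"
        using global_consts_pos M by simp
      then show "rem_const \<le> rem_global_const" by (simp add: rem_global_const_def)
    qed (use W global_consts_pos in auto)
    finally show ?thesis .
  next
    case False
    define g where "g = global_const path_const"
    have g: "0 < g" unfolding g_def by (rule global_consts_pos)
    have "norm (rem Z (A Z) u v) \<le> norm (Z v - Z u) + norm (blinfun_apply (\<sigma> (Z u, A Z u)) (X u v))"
      unfolding rem_def by (rule norm_triangle_ineq4)
    also have "\<dots> \<le> g * (1 + w 0 T) * w u v powr \<beta> + M * (1 + w 0 T) * w u v powr \<beta>"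
    proof (rule add_mono)
      have "norm (blinfun_apply (\<sigma> (Z u, A Z u)) (X u v)) \<le> M * 1 * w u v powr \<beta>"
        using X_bound[OF uv] M by (intro order_trans[OF norm_\<sigma>_apply]) simp
      also have "\<dots> \<le> M * (1 + w 0 T) * w u v powr \<beta>"
        using W M by (intro mult_right_mono mult_left_mono) auto
      finally show "norm (blinfun_apply (\<sigma> (Z u, A Z u)) (X u v)) \<le> M * (1 + w 0 T) * w u v powr \<beta>" .
    qed (use 1 in \<open>simp add: g_def\<close>)
    also have "\<dots> = (g + M) * (1 + w 0 T) * (1 * w u v powr \<beta>)" by (simp add: algebra_simps)
    also have "\<dots> \<le> (g + M) * (1 + w 0 T) * (local_scale powr (- \<beta>) * w u v powr \<beta> * w u v powr \<beta>)"
    proof (intro mult_left_mono mult_right_mono)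
      have "local_scale powr \<beta> \<le> w u v powr \<beta>" using False local_scale \<beta> by (intro powr_mono2) auto
      then show "1 \<le> local_scale powr (- \<beta>) * w u v powr \<beta>"
        using local_scale by (simp add: powr_minus field_simps)
    qed (use g M W in auto)
    also have "\<dots> = (g + M) * local_scale powr (- \<beta>) * (1 + w 0 T) * w u v powr (2 * \<beta>)"
      unfolding powr_2\<beta> by (simp only: mult_ac)
    also have "\<dots> \<le> rem_global_const * (1 + w 0 T) * w u v powr (2 * \<beta>)"
      using W rem_const by (intro mult_right_mono) (auto simp: rem_global_const_def g_def)
    finally show ?thesis .
  qed
qed

end

section \<open>Reduction to a normalised driver\<close>

text \<open>
  Passing to the control \<open>N\<^bsup>1/\<beta>\<^esup> \<omega>\<close> normalises the rough path.  As \<open>N\<close> only has to dominate the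
  norm, it may be taken positive also for the zero path.
\<close>
lemma rough_driver_rescale:
  assumes co: "rough_coefficient \<sigma> \<beta> \<theta> M F" and T: "0 < T" and \<omega>: "control_fun T \<omega>"
    and rp: "rough_path T \<omega> \<beta> X XX" and N: "0 < N" "rough_norm T \<omega> \<beta> X XX \<le> N"
  shows "rough_driver \<sigma> \<beta> \<theta> M F T (\<lambda>s t. N powr (1 / \<beta>) * \<omega> s t) X XX"
proof -
  interpret rough_coefficient \<sigma> \<beta> \<theta> M F by (rule co)
  have pw: "(N powr (1 / \<beta>) * \<omega> s t) powr p = N powr (p / \<beta>) * \<omega> s t powr p" for s t p
    by (simp add: powr_mult powr_powr)
  have N1: "N powr (\<beta> / \<beta>) = N" "N powr (2 * \<beta> / \<beta>) = N\<^sup>2"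
    using N(1) \<beta> by simp_all
  define nX where "nX = enn2real (holder_norm2 \<omega> \<beta> 0 T X)"
  define nXX where "nXX = enn2real (holder_norm2 \<omega> (2 * \<beta>) 0 T XX)"
  have le: "nX + sqrt nXX \<le> N" "0 \<le> nX" "0 \<le> nXX"
    using N(2) by (auto simp: rough_norm_def nX_def nXX_def)
  then have nX: "nX \<le> N" and "sqrt nXX \<le> N" by (auto intro: order_trans[rotated])
  then have nXX: "nXX \<le> N\<^sup>2" using le(3) real_sqrt_le_iff real_le_rsqrt sqrt_le_D by blast
  have cont: "continuous_on {(s, t). 0 \<le> s \<and> s \<le> t \<and> t \<le> T} (\<lambda>(s, t). N powr (1 / \<beta>) * \<omega> s t)"
  proof -
    have "continuous_on {(s, t). 0 \<le> s \<and> s \<le> t \<and> t \<le> T} (\<lambda>p. N powr (1 / \<beta>) * (case p of (s, t) \<Rightarrow> \<omega> s t))"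
      using \<omega> by (intro continuous_intros) (auto simp: control_fun_def)
    then show ?thesis by (simp add: case_prod_unfold)
  qed
  show ?thesis
  proof (intro rough_driver.intro co rough_driver_axioms.intro)
    show "superadditive_on {0..T} (\<lambda>s t. N powr (1 / \<beta>) * \<omega> s t)"
      using \<omega> unfolding superadditive_on_def control_fun_def
      by (auto simp flip: distrib_left intro!: mult_left_mono)
    fix s t assume st: "0 \<le> s" "s \<le> t" "t \<le> T"
    have "norm (X s t) \<le> nX * \<omega> s t powr \<beta>"
      unfolding nX_def using rp st by (intro norm_le_holder_norm2) (auto simp: rough_path_def)
    also have "\<dots> \<le> N * \<omega> s t powr \<beta>" using nX by (intro mult_right_mono) auto
    finally show "norm (X s t) \<le> (N powr (1 / \<beta>) * \<omega> s t) powr \<beta>" unfolding pw N1 .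
    have "norm (XX s t) \<le> nXX * \<omega> s t powr (2 * \<beta>)"
      unfolding nXX_def using rp st by (intro norm_le_holder_norm2) (auto simp: rough_path_def)
    also have "\<dots> \<le> N\<^sup>2 * \<omega> s t powr (2 * \<beta>)" using nXX by (intro mult_right_mono) auto
    finally show "norm (XX s t) \<le> (N powr (1 / \<beta>) * \<omega> s t) powr (2 * \<beta>)" unfolding pw N1 .
  qed (use T cont rp in \<open>auto simp: rough_path_def\<close>)
qed

section \<open>Comparison with the smaller exponent \<beta>0\<close>

context rough_driver
begin

text \<open>Since \<beta>/\<beta>0 > 1, superadditivity bounds sums of w^(\<beta>/\<beta>0) by the
  same power over the whole interval.\<close>

lemma p_var_holder_le:
  fixes x :: "real \<Rightarrow> 'e::real_normed_vector"
  assumes \<beta>0: "0 < \<beta>0" "\<beta>0 < \<beta>" and L: "0 \<le> L" and st: "0 \<le> s" "s \<le> t" "t \<le> T"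
    and x: "\<And>u v. s \<le> u \<Longrightarrow> u \<le> v \<Longrightarrow> v \<le> t \<Longrightarrow> norm (x v - x u) \<le> L * w u v powr \<beta>"
  shows "p_var (1 / \<beta>0) s t x \<le> ennreal (L * w s t powr \<beta>)"
proof (rule p_var_le)
  fix ts assume ts: "ts \<in> partitions s t"
  define r where "r = \<beta> / \<beta>0"
  have r: "1 < r" using \<beta>0 by (simp add: r_def)
  have sub: "{s..t} \<subseteq> {0..T}" using st by auto
  have w': "superadditive_on {s..t} w" by (rule superadditive_on_subset[OF w sub])
  note ch = partition_chain[OF ts]
  have W: "0 \<le> w s t" using w_nonneg st by auto
  have "partition_sum (\<lambda>u v. norm (x v - x u) powr (1 / \<beta>0)) ts
    \<le> (\<Sum>i<length ts - 1. L powr (1 / \<beta>0) * w (ts ! i) (ts ! Suc i) powr r + 0 * (w (ts ! i) (ts ! Suc i) * w (ts ! i) (ts ! Suc i) powr 1))"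
    unfolding partition_sum_def
  proof (rule sum_mono)
    fix i assume "i \<in> {..<length ts - 1}"
    then have i: "ts ! i \<in> {s..t}" "ts ! Suc i \<in> {s..t}" "ts ! i \<le> ts ! Suc i"
      using ch(1) by (auto simp: chain_def simp del: atLeastAtMost_iff)
    have "norm (x (ts ! Suc i) - x (ts ! i)) powr (1 / \<beta>0) \<le> (L * w (ts ! i) (ts ! Suc i) powr \<beta>) powr (1 / \<beta>0)"
      using x[of "ts ! i" "ts ! Suc i"] i \<beta>0 by (intro powr_mono2) auto
    then show "norm (x (ts ! Suc i) - x (ts ! i)) powr (1 / \<beta>0)
      \<le> L powr (1 / \<beta>0) * w (ts ! i) (ts ! Suc i) powr r + 0 * (w (ts ! i) (ts ! Suc i) * w (ts ! i) (ts ! Suc i) powr 1)"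
      by (simp add: powr_mult powr_powr r_def)
  qed
  also have "\<dots> \<le> L powr (1 / \<beta>0) * w s t powr (r - 1) * w (ts ! 0) (ts ! (length ts - 1)) + 0 * w s t powr 1 * w (ts ! 0) (ts ! (length ts - 1))"
  proof (rule sum_controls_le[where t = "\<lambda>i. ts ! i", OF w' w' ch(1)])
    fix i assume "i < length ts - 1"
    then have i: "ts ! i \<in> {s..t}" "ts ! Suc i \<in> {s..t}" "ts ! i \<le> ts ! Suc i"
      using ch(1) by (auto simp: chain_def simp del: atLeastAtMost_iff)
    then show "w (ts ! i) (ts ! Suc i) \<le> w s t" using st by (intro w_mono) auto
  qed (use r in auto)
  also have "\<dots> = L powr (1 / \<beta>0) * w s t powr r"
    using W ch by (cases "w s t = 0") (auto simp: powr_diff)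
  also have "\<dots> = (L * w s t powr \<beta>) powr (1 / \<beta>0)"
    by (simp add: powr_mult powr_powr r_def)
  finally show "partition_sum (\<lambda>u v. norm (x v - x u) powr (1 / \<beta>0)) ts \<le> (L * w s t powr \<beta>) powr (1 / \<beta>0)" .
qed (use \<beta>0 L in auto)

end

text \<open>With \<kappa> = \<beta>0/\<beta>, write x as x^\<kappa> x^(1-\<kappa>) and use the
  Hoelder bound on the first factor, the uniform one on the second. For paths bounded in the
  \<beta>-norm, uniform convergence thus becomes convergence in the \<beta>0-norm.\<close>

lemma holder_interpolation:
  fixes a c e :: real
  assumes "0 \<le> x" "x \<le> c * a powr \<beta>" "x \<le> e" "0 < \<beta>0" "\<beta>0 \<le> \<beta>" "0 \<le> c" "0 \<le> a"
  shows "x \<le> c powr (\<beta>0 / \<beta>) * e powr (1 - \<beta>0 / \<beta>) * a powr \<beta>0"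
proof -
  have k: "0 \<le> \<beta>0 / \<beta>" "\<beta>0 / \<beta> \<le> 1" using assms by auto
  have "x = x powr (\<beta>0 / \<beta>) * x powr (1 - \<beta>0 / \<beta>)"
    using assms(1) by (simp flip: powr_add)
  also have "\<dots> \<le> (c * a powr \<beta>) powr (\<beta>0 / \<beta>) * e powr (1 - \<beta>0 / \<beta>)"
    using assms k by (intro mult_mono powr_mono2) auto
  also have "(c * a powr \<beta>) powr (\<beta>0 / \<beta>) = c powr (\<beta>0 / \<beta>) * a powr \<beta>0"
    using assms by (simp add: powr_mult powr_powr)
  finally show ?thesis by (simp add: mult_ac)
qed

text \<open>\<open>A\<close> and its extension agree on \<beta>-Hoelder paths, which are
  \<beta>0-Hoelder because the control is bounded on [0, T]. The conditions on the extension can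
  therefore be read off on the paths of \<open>holder_from\<close>.\<close>

lemma path_map_rescale:
  assumes rd: "rough_driver \<sigma> \<beta> \<theta> M F T (\<lambda>s t. N powr (1 / \<beta>) * \<omega> s t) X XX"
    and \<omega>: "control_fun T \<omega>" and N: "0 < N" and adm: "admissible_map T \<omega> \<beta> F \<xi> A"
  shows "path_map \<sigma> \<beta> \<theta> M F T (\<lambda>s t. N powr (1 / \<beta>) * \<omega> s t) X XX \<xi> A"
proof -
  define w where "w = (\<lambda>s t. N powr (1 / \<beta>) * \<omega> s t)"
  interpret rough_driver \<sigma> \<beta> \<theta> M F T w X XX using rd by (simp add: w_def)
  obtain \<beta>0 A0 where \<beta>0: "1/3 < \<beta>0" "\<beta>0 < \<beta>"
    and A0: "\<And>x t. x \<in> holder_space_from T \<omega> \<beta> \<xi> \<Longrightarrow> t \<in> {0..T} \<Longrightarrow> A0 x t = A x t"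
    and A0_cont: "continuous_holder_to_sup T \<omega> \<beta>0 (holder_space_from T \<omega> \<beta>0 \<xi>) A0"
    and A0_var: "\<And>x s t. x \<in> holder_space_from T \<omega> \<beta>0 \<xi> \<Longrightarrow> 0 \<le> s \<Longrightarrow> s \<le> t \<Longrightarrow> t \<le> T \<Longrightarrow>
       p_var 1 s t (A0 x) \<le> ennreal (F (enn2real (p_var (1 / \<beta>0) s t x))) * inf_var s t x"
    using adm unfolding admissible_map_def by metis
  have \<omega>0: "0 \<le> \<omega> s t" if "0 \<le> s" "s \<le> t" "t \<le> T" for s t
    using \<omega> that by (auto simp: control_fun_def)
  have w\<beta>: "w s t powr \<beta> = N * \<omega> s t powr \<beta>" for s t
    using N \<beta> by (simp add: w_def powr_mult powr_powr)
  have \<omega>_le: "\<omega> u v \<le> \<omega> 0 T" if "0 \<le> u" "u \<le> v" "v \<le> T" for u v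
    using w_mono[of 0 u v T] that T N by (simp add: w_def)
  have in_space: "x \<in> holder_space_from T \<omega> p \<xi>" if x: "holder_from \<xi> L x" and p: "0 < p" "p \<le> \<beta>" for x L p
  proof -
    have L: "0 \<le> L" using x by (simp add: holder_from_def)
    \<comment> \<open>The spare power of \<omega> is bounded by its value at (0, T); the added 1
      keeps the constant positive, as the norm is an infimum over positive constants.\<close>
    have "norm (x v - x u) \<le> (L * N * \<omega> 0 T powr (\<beta> - p) + 1) * \<omega> u v powr p" if uv: "0 \<le> u" "u \<le> v" "v \<le> T" for u v
    proof -
      have "norm (x v - x u) \<le> L * (N * \<omega> u v powr \<beta>)"
        using x uv by (simp add: holder_from_def w\<beta>)
      also have "\<omega> u v powr \<beta> = \<omega> u v powr (\<beta> - p) * \<omega> u v powr p" by (simp flip: powr_add)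
      also have "L * (N * (\<omega> u v powr (\<beta> - p) * \<omega> u v powr p)) \<le> L * (N * (\<omega> 0 T powr (\<beta> - p) * \<omega> u v powr p))"
        using L N p \<omega>0[OF uv] \<omega>_le[OF uv] by (intro mult_left_mono mult_right_mono powr_mono2) auto
      also have "\<dots> \<le> (L * N * \<omega> 0 T powr (\<beta> - p) + 1) * \<omega> u v powr p"
        by (simp add: algebra_simps)
      finally show ?thesis .
    qed
    then have "holder_norm \<omega> p 0 T x \<le> ennreal (L * N * \<omega> 0 T powr (\<beta> - p) + 1)"
      using L N by (intro holder_norm_le) (auto intro!: add_nonneg_pos mult_nonneg_nonneg)
    then have "holder_norm \<omega> p 0 T x < top" using le_less_trans ennreal_less_top by blast
    moreover have "continuous_on {0..T} x"
      by (rule holder_imp_continuous_on[OF L]) (use x in \<open>auto simp: holder_from_def\<close>)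
    ultimately show ?thesis
      using x by (simp add: holder_space_from_def holder_space_def holder_from_def)
  qed
  have in_\<beta>: "x \<in> holder_space_from T \<omega> \<beta> \<xi>" and in_\<beta>0: "x \<in> holder_space_from T \<omega> \<beta>0 \<xi>"
    if "holder_from \<xi> L x" for x L
    using in_space[OF that, of \<beta>] in_space[OF that, of \<beta>0] \<beta> \<beta>0 by auto
  have "path_map \<sigma> \<beta> \<theta> M F T w X XX \<xi> A"
  proof (intro path_map.intro path_map_axioms.intro)
    show "rough_driver \<sigma> \<beta> \<theta> M F T w X XX" by unfold_locales
    show "continuous_on {0..T} (A x)" if "holder_from \<xi> L x" for x L
      using adm in_\<beta>[OF that] unfolding admissible_map_def by blast
    show "A x s = A y s" if "holder_from \<xi> K x" "holder_from \<xi> L y" "0 \<le> s" "s \<le> t" "t \<le> T"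
      "\<And>r. 0 \<le> r \<Longrightarrow> r \<le> t \<Longrightarrow> x r = y r" for x y K L t s
    proof -
      have "adapted_map T (holder_space_from T \<omega> \<beta> \<xi>) A" using adm unfolding admissible_map_def by blast
      moreover have "t \<in> {0..T}" using that(3-5) by auto
      ultimately have "(\<forall>r\<in>{0..t}. x r = y r) \<longrightarrow> (\<forall>r\<in>{0..t}. A x r = A y r)"
        using in_\<beta>[OF that(1)] in_\<beta>[OF that(2)] unfolding adapted_map_def by blast
      then show ?thesis using that(3,4,6) by auto
    qed
    show "p_var 1 s t (A x) \<le> ennreal (F (L * w s t powr \<beta>) * (L * w s t powr \<beta>))"
      if x: "holder_from \<xi> K x" and st: "0 \<le> s" "s \<le> t" "t \<le> T" and L: "0 \<le> L"
        and bd: "\<And>u v. s \<le> u \<Longrightarrow> u \<le> v \<Longrightarrow> v \<le> t \<Longrightarrow> norm (x v - x u) \<le> L * w u v powr \<beta>" for x K L s t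
    proof -
      have p: "p_var (1 / \<beta>0) s t x \<le> ennreal (L * w s t powr \<beta>)"
        by (rule p_var_holder_le) (use \<beta>0 L st bd in auto)
      have i: "inf_var s t x \<le> ennreal (L * w s t powr \<beta>)"
        unfolding inf_var_def
      proof (rule SUP_least, clarify)
        fix u v assume uv: "s \<le> u" "u \<le> v" "v \<le> t"
        have "norm (x v - x u) \<le> L * w u v powr \<beta>" by (rule bd[OF uv])
        also have "\<dots> \<le> L * w s t powr \<beta>"
          using L uv st \<beta> by (intro mult_left_mono w_powr_mono) auto
        finally show "ennreal (norm (x v - x u)) \<le> ennreal (L * w s t powr \<beta>)" by (rule ennreal_leI)
      qed
      have c0: "0 \<le> L * w s t powr \<beta>" using L by simp
      have "enn2real (p_var (1 / \<beta>0) s t x) \<le> L * w s t powr \<beta>"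
        using p c0 by (rule enn2real_leI[rotated])
      then have Fle: "F (enn2real (p_var (1 / \<beta>0) s t x)) \<le> F (L * w s t powr \<beta>)"
        by (intro F_mono) auto
      have "p_var 1 s t (A x) = p_var 1 s t (A0 x)"
        by (rule p_var_cong) (use A0[OF in_\<beta>[OF x]] st in auto)
      also have "\<dots> \<le> ennreal (F (enn2real (p_var (1 / \<beta>0) s t x))) * inf_var s t x"
        by (rule A0_var[OF in_\<beta>0[OF x] st])
      also have "\<dots> \<le> ennreal (F (L * w s t powr \<beta>)) * ennreal (L * w s t powr \<beta>)"
        by (intro mult_mono ennreal_leI Fle i) auto
      also have "\<dots> = ennreal (F (L * w s t powr \<beta>) * (L * w s t powr \<beta>))"
        using c0 less_imp_le[OF F_pos[OF c0]] by (simp add: ennreal_mult)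
      finally show ?thesis .
    qed
    show "uniform_limit {0..T} (\<lambda>n. A (xs n)) (A x) sequentially"
      if xs: "\<And>n. holder_from \<xi> L (xs n)" and x: "holder_from \<xi> L x" and unif: "uniform_limit {0..T} xs x sequentially"
      for xs x L
      unfolding uniform_limit_iff
    proof (intro allI impI)
      fix \<epsilon> :: real assume \<epsilon>: "0 < \<epsilon>"
      have L: "0 \<le> L" using x by (simp add: holder_from_def)
      obtain \<delta> where \<delta>: "0 < \<delta>" "\<And>y. y \<in> holder_space_from T \<omega> \<beta>0 \<xi> \<Longrightarrow>
          holder_space_norm T \<omega> \<beta>0 (\<lambda>t. y t - x t) < ennreal \<delta> \<Longrightarrow> sup_norm 0 T (\<lambda>t. A0 y t - A0 x t) < ennreal \<epsilon>"
        using A0_cont in_\<beta>0[OF x] \<epsilon> unfolding continuous_holder_to_sup_def by meson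
      define \<kappa> where "\<kappa> = \<beta>0 / \<beta>"
      have \<kappa>: "\<kappa> < 1" using \<beta> \<beta>0 by (simp add: \<kappa>_def)
      \<comment> \<open>Makes the interpolated norm at most \<delta>/2. The last division by 2
        accounts for the two end points of an increment, the added 1 for a vanishing
        \<open>2 * L * N\<close>.\<close>
      define e where "e = (\<delta> / 2 / ((2 * L * N) powr \<kappa> + 1)) powr (1 / (1 - \<kappa>)) / 2"
      have "0 < (2 * L * N) powr \<kappa> + 1" using powr_ge_zero[of "2 * L * N" \<kappa>] by linarith
      then have e: "0 < e" using \<delta>(1) by (simp add: e_def)
      have e_pow: "(2 * L * N) powr \<kappa> * (2 * e) powr (1 - \<kappa>) \<le> \<delta> / 2"
      proof -
        have eq: "(2 * e) powr (1 - \<kappa>) = \<delta> / 2 / ((2 * L * N) powr \<kappa> + 1)"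
          using \<delta>(1) \<kappa> \<open>0 < (2 * L * N) powr \<kappa> + 1\<close> by (simp add: e_def powr_powr)
        have le: "P * (d / (P + 1)) \<le> d" if "0 \<le> P" "0 < d" for P d :: real
          using that by (simp add: pos_divide_le_eq algebra_simps)
        show ?thesis unfolding eq by (rule le) (use \<delta>(1) in auto)
      qed
      from uniform_limitD[OF unif e]
      show "\<forall>\<^sub>F n in sequentially. \<forall>t\<in>{0..T}. dist (A (xs n) t) (A x t) < \<epsilon>"
      proof eventually_elim
        case (elim n)
        have "norm ((xs n v - x v) - (xs n u - x u)) \<le> \<delta> / 2 * \<omega> u v powr \<beta>0" if uv: "0 \<le> u" "u \<le> v" "v \<le> T" for u v
        proof -
          let ?d = "norm ((xs n v - x v) - (xs n u - x u))"
          have "(xs n v - x v) - (xs n u - x u) = (xs n v - xs n u) - (x v - x u)" by simp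
          then have "?d \<le> norm (xs n v - xs n u) + norm (x v - x u)" by (metis norm_triangle_ineq4)
          also have "\<dots> \<le> L * w u v powr \<beta> + L * w u v powr \<beta>"
            using xs[of n] x uv by (intro add_mono) (auto simp: holder_from_def)
          also have "\<dots> = (2 * L * N) * \<omega> u v powr \<beta>" by (simp add: w\<beta>)
          finally have 1: "?d \<le> (2 * L * N) * \<omega> u v powr \<beta>" .
          have "?d \<le> norm (xs n v - x v) + norm (xs n u - x u)" by (rule norm_triangle_ineq4)
          also have "\<dots> \<le> 2 * e" using bspec[OF elim, of u] bspec[OF elim, of v] uv by (simp add: dist_norm)
          finally have 2: "?d \<le> 2 * e" .
          have "?d \<le> (2 * L * N) powr \<kappa> * (2 * e) powr (1 - \<kappa>) * \<omega> u v powr \<beta>0"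
            unfolding \<kappa>_def by (rule holder_interpolation[OF norm_ge_zero 1 2]) (use \<beta>0 L N \<omega>0[OF uv] in auto)
          also have "\<dots> \<le> \<delta> / 2 * \<omega> u v powr \<beta>0" by (intro mult_right_mono e_pow) auto
          finally show ?thesis .
        qed
        then have "holder_norm \<omega> \<beta>0 0 T (\<lambda>t. xs n t - x t) \<le> ennreal (\<delta> / 2)"
          using \<delta>(1) by (intro holder_norm_le) auto
        moreover have "xs n 0 - x 0 = 0" using xs[of n] x by (simp add: holder_from_def)
        ultimately have "holder_space_norm T \<omega> \<beta>0 (\<lambda>t. xs n t - x t) \<le> ennreal (\<delta> / 2)"
          by (simp add: holder_space_norm_def)
        also have "\<dots> < ennreal \<delta>" using \<delta>(1) by (simp add: ennreal_less_iff)
        finally have sup: "sup_norm 0 T (\<lambda>t. A0 (xs n) t - A0 x t) < ennreal \<epsilon>"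
          by (rule \<delta>(2)[OF in_\<beta>0[OF xs]])
        show ?case
        proof
          fix t assume t: "t \<in> {0..T}"
          then have "norm (A0 (xs n) t - A0 x t) < \<epsilon>" using norm_le_sup_norm[OF sup, of t] by simp
          then show "dist (A (xs n) t) (A x t) < \<epsilon>"
            using A0[OF in_\<beta>[OF xs] t] A0[OF in_\<beta>[OF x] t] by (simp add: dist_norm)
        qed
      qed
    qed
  qed
  then show ?thesis by (simp add: w_def)
qed

section \<open>Solutions in terms of the original control\<close>

lemma holder_space_fromD:
  assumes rd: "rough_driver \<sigma> \<beta> \<theta> M F T (\<lambda>s t. N powr (1 / \<beta>) * \<omega> s t) X XX" and N: "0 < N"
    and x: "x \<in> holder_space T \<omega> \<beta>" and x0: "x 0 = \<xi>"
  shows "\<exists>L. rough_driver.holder_from \<beta> T (\<lambda>s t. N powr (1 / \<beta>) * \<omega> s t) \<xi> L x"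
proof -
  interpret rough_driver \<sigma> \<beta> \<theta> M F T "\<lambda>s t. N powr (1 / \<beta>) * \<omega> s t" X XX by (rule rd)
  define n where "n = enn2real (holder_norm \<omega> \<beta> 0 T x)"
  have w\<beta>: "(N powr (1 / \<beta>) * \<omega> s t) powr \<beta> = N * \<omega> s t powr \<beta>" for s t
    using N \<beta> by (simp add: powr_mult powr_powr)
  have "norm (x v - x u) \<le> n / N * (N powr (1 / \<beta>) * \<omega> u v) powr \<beta>" if "0 \<le> u" "u \<le> v" "v \<le> T" for u v
    using norm_le_holder_norm2[OF _ that, of \<omega> \<beta> "\<lambda>u v. x v - x u"] x N
    unfolding w\<beta> by (simp add: holder_space_def holder_norm_def n_def)
  then show ?thesis
    using x0 N by (intro exI[of _ "n / N"]) (auto simp: holder_from_def n_def)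
qed

lemma rde_solution_of_exact:
  assumes pm: "path_map \<sigma> \<beta> \<theta> M F T (\<lambda>s t. N powr (1 / \<beta>) * \<omega> s t) X XX \<xi> A" and N: "0 < N"
  shows "\<exists>Z Z'. rde_solution T \<omega> \<beta> \<sigma> X XX \<xi> A Z Z'"
proof -
  define w where "w = (\<lambda>s t. N powr (1 / \<beta>) * \<omega> s t)"
  interpret path_map \<sigma> \<beta> \<theta> M F T w X XX \<xi> A using pm by (simp add: w_def)
  have w\<beta>: "w s t powr \<beta> = N * \<omega> s t powr \<beta>" "w s t powr (2 * \<beta>) = N\<^sup>2 * \<omega> s t powr (2 * \<beta>)" for s t
    using N \<beta> by (simp_all add: w_def powr_mult powr_powr)
  obtain Z L r where Z: "holder_const L Z"
    and lim: "\<And>t. 0 \<le> t \<Longrightarrow> t \<le> T \<Longrightarrow> has_partition_limit (germ Z (A Z)) 0 t (Z t - \<xi>)"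
    and rem: "\<And>u v. 0 \<le> u \<Longrightarrow> u \<le> v \<Longrightarrow> v \<le> T \<Longrightarrow> norm (rem Z (A Z) u v) \<le> r * w u v powr (2 * \<beta>)"
  proof (rule exact_solution_exists)
    fix Z L r
    assume "holder_const L Z" "\<And>t. 0 \<le> t \<Longrightarrow> t \<le> T \<Longrightarrow> has_partition_limit (germ Z (A Z)) 0 t (Z t - \<xi>)"
      "\<And>u v. 0 \<le> u \<Longrightarrow> u \<le> v \<Longrightarrow> v \<le> T \<Longrightarrow> norm (rem Z (A Z) u v) \<le> r * w u v powr (2 * \<beta>)"
    then show thesis by (rule that)
  qed
  define Z' where "Z' = (\<lambda>t. \<sigma> (Z t, A Z t))"
  have ap: "approx_solution \<sigma> \<beta> \<theta> M F T w X XX {0..T} Z (A Z) (\<lambda>u v. var1 u v (A Z))"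
    by (rule exact_solution_approx[OF Z lim rem])
  note bounds = exact_solution_bounds[OF ap Z]
  have W: "0 \<le> w 0 T" using w_nonneg[of 0 T] T by auto
  have finite: "holder_norm \<omega> \<beta> 0 T y < top \<and> continuous_on {0..T} y"
    if K: "0 \<le> K" and y: "\<And>u v. 0 \<le> u \<Longrightarrow> u \<le> v \<Longrightarrow> v \<le> T \<Longrightarrow> norm (y v - y u) \<le> K * w u v powr \<beta>"
    for K and y :: "real \<Rightarrow> 'x::real_normed_vector"
  proof
    have "holder_norm \<omega> \<beta> 0 T y \<le> ennreal (K * N + 1)"
    proof (rule holder_norm_le)
      show "0 < K * N + 1" using K N by (intro add_nonneg_pos) auto
      show "norm (y v - y u) \<le> (K * N + 1) * \<omega> u v powr \<beta>" if "0 \<le> u" "u \<le> v" "v \<le> T" for u v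
        using y[OF that] by (simp add: w\<beta> algebra_simps add_increasing)
    qed
    then show "holder_norm \<omega> \<beta> 0 T y < top" using le_less_trans ennreal_less_top by blast
    show "continuous_on {0..T} y" by (rule holder_imp_continuous_on[OF K y])
  qed
  have gc: "0 \<le> global_const path_const * (1 + w 0 T)"
    "0 \<le> M * (global_const path_const + global_const A_const) * (1 + w 0 T)"
    using global_consts_pos M W by auto
  have "Z \<in> holder_space T \<omega> \<beta>"
    using finite[OF gc(1) bounds(1)] by (simp add: holder_space_def)
  moreover have "Z' \<in> holder_space T \<omega> \<beta>"
    using finite[OF gc(2), of Z'] bounds(3) by (simp add: holder_space_def Z'_def)
  moreover have "holder_norm2 \<omega> (2 * \<beta>) 0 T (remainder X Z Z') < top"
  proof -
    have "holder_norm2 \<omega> (2 * \<beta>) 0 T (remainder X Z Z') \<le> ennreal (rem_global_const * (1 + w 0 T) * N\<^sup>2)"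
    proof (rule holder_norm2_le)
      show "0 < rem_global_const * (1 + w 0 T) * N\<^sup>2" using global_consts_pos W N by simp
      show "norm (remainder X Z Z' u v) \<le> rem_global_const * (1 + w 0 T) * N\<^sup>2 * \<omega> u v powr (2 * \<beta>)"
        if "0 \<le> u" "u \<le> v" "v \<le> T" for u v
        using bounds(4)[OF that] by (simp add: remainder_def Z'_def rem_def w\<beta> mult.assoc)
    qed
    then show ?thesis using le_less_trans ennreal_less_top by blast
  qed
  ultimately have "(Z, Z') \<in> controlled_paths T \<omega> \<beta> X" by (simp add: controlled_paths_def)
  moreover have "has_rough_integral \<sigma> X XX Z Z' (A Z) 0 t (Z t - \<xi>)" if "t \<in> {0..T}" for t
    using has_rough_integral_iff[OF Z, of t Z'] lim[of t] that by (auto simp: Z'_def)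
  ultimately have "rde_solution T \<omega> \<beta> \<sigma> X XX \<xi> A Z Z'"
    unfolding rde_solution_def
    by (auto simp: Z'_def intro!: exI[of _ "Z _ - \<xi>"])
  then show ?thesis by blast
qed

text \<open>A controlled path has finite norms, and this qualitative information is enough to start
  the a priori estimate. Returning from \<open>w\<close> to \<omega> costs a factor N for each norm
  of exponent \<beta> and N^2 for that of exponent 2\<beta>.\<close>

lemma rde_solution_bound:
  fixes \<sigma> :: "(real^'n) \<times> (real^'n) \<Rightarrow> (real^'d) \<Rightarrow>\<^sub>L (real^'n)"
  assumes pm: "path_map \<sigma> \<beta> \<theta> M F T (\<lambda>s t. N powr (1 / \<beta>) * \<omega> s t) X XX \<xi> A" and N: "0 < N"
    and sol: "rde_solution T \<omega> \<beta> \<sigma> X XX \<xi> A Z Z'"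
  shows "holder_norm \<omega> \<beta> 0 T Z + holder_norm \<omega> \<beta> 0 T Z' + var_holder_norm \<omega> 1 \<beta> 0 T (A Z)
             + holder_norm2 \<omega> (2 * \<beta>) 0 T (remainder X Z Z')
    \<le> ennreal (rough_coefficient.total_const TYPE('d) \<beta> \<theta> M F * (1 + N powr (1 / \<beta>) * \<omega> 0 T) * (N + N\<^sup>2))"
proof -
  define w where "w = (\<lambda>s t. N powr (1 / \<beta>) * \<omega> s t)"
  interpret path_map \<sigma> \<beta> \<theta> M F T w X XX \<xi> A using pm by (simp add: w_def)
  have w\<beta>: "w s t powr \<beta> = N * \<omega> s t powr \<beta>" "w s t powr (2 * \<beta>) = N\<^sup>2 * \<omega> s t powr (2 * \<beta>)" for s t
    using N \<beta> by (simp_all add: w_def powr_mult powr_powr)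
  have ctrl: "Z \<in> holder_space T \<omega> \<beta>" "holder_norm2 \<omega> (2 * \<beta>) 0 T (remainder X Z Z') < top"
    and Z': "\<And>t. 0 \<le> t \<Longrightarrow> t \<le> T \<Longrightarrow> Z' t = \<sigma> (Z t, A Z t)"
    using sol unfolding rde_solution_def controlled_paths_def by auto
  have int: "has_rough_integral \<sigma> X XX Z Z' (A Z) 0 t (Z t - \<xi>)" if "0 \<le> t" "t \<le> T" for t
  proof -
    have "\<exists>I. has_rough_integral \<sigma> X XX Z Z' (A Z) 0 t I \<and> Z t = \<xi> + I"
      using sol that unfolding rde_solution_def by auto
    then show ?thesis by auto
  qed
  \<comment> \<open>The integral over [0, 0] is 0, as the one-point partition shows.\<close>
  have "Z 0 = \<xi>"
  proof -
    have "[0] \<in> partitions 0 (0::real)" by (simp add: partitions_def)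
    then have "norm (partition_sum (rough_germ \<sigma> X XX Z Z' (A Z)) [0] - (Z 0 - \<xi>)) < \<epsilon>" if "0 < \<epsilon>" for \<epsilon>
      using int[of 0] T that unfolding has_rough_integral_def has_partition_limit_def by force
    then have "norm (Z 0 - \<xi>) < \<epsilon>" if "0 < \<epsilon>" for \<epsilon>
      using that by (simp add: norm_minus_commute)
    then have "norm (Z 0 - \<xi>) \<le> 0" using not_le by blast
    then show ?thesis by simp
  qed
  then obtain L where Z: "holder_const L Z"
    using holder_space_fromD[OF _ N ctrl(1)] rough_driver_axioms unfolding w_def by blast
  define r where "r = enn2real (holder_norm2 \<omega> (2 * \<beta>) 0 T (remainder X Z Z'))"
  have rem_eq: "remainder X Z Z' u v = rem Z (A Z) u v" if "0 \<le> u" "u \<le> T" for u v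
    using Z'[OF that] by (simp add: remainder_def rem_def)
  have rem: "norm (rem Z (A Z) u v) \<le> r / N\<^sup>2 * w u v powr (2 * \<beta>)" if "0 \<le> u" "u \<le> v" "v \<le> T" for u v
    using norm_le_holder_norm2[OF ctrl(2) that] rem_eq[of u v] that N by (simp add: w\<beta> r_def)
  have lim: "has_partition_limit (germ Z (A Z)) 0 t (Z t - \<xi>)" if "0 \<le> t" "t \<le> T" for t
    using has_rough_integral_iff[OF Z that Z'] int[OF that] by blast
  have ap: "approx_solution \<sigma> \<beta> \<theta> M F T w X XX {0..T} Z (A Z) (\<lambda>u v. var1 u v (A Z))"
    by (rule exact_solution_approx[OF Z lim rem])
  note bounds = exact_solution_bounds[OF ap Z]
  define W where "W = 1 + w 0 T"
  have W: "0 < W" using w_nonneg[of 0 T] T by (simp add: W_def)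
  define c1 where "c1 = global_const path_const"
  define c2 where "c2 = M * (global_const path_const + global_const A_const)"
  define c3 where "c3 = global_const A_const"
  define c4 where "c4 = rem_global_const"
  have c: "0 < c1" "0 < c2" "0 < c3" "0 < c4"
    unfolding c1_def c2_def c3_def c4_def using global_consts_pos M by (auto intro!: mult_pos_pos add_pos_pos)
  have "holder_norm \<omega> \<beta> 0 T Z \<le> ennreal (c1 * W * N)"
    by (rule holder_norm_le) (use c W N bounds(1) in \<open>auto simp: w\<beta> c1_def W_def mult.assoc\<close>)
  moreover have "holder_norm \<omega> \<beta> 0 T Z' \<le> ennreal (c2 * W * N)"
  proof (rule holder_norm_le)
    show "norm (Z' v - Z' u) \<le> c2 * W * N * \<omega> u v powr \<beta>" if "0 \<le> u" "u \<le> v" "v \<le> T" for u v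
      using bounds(3)[OF that] that by (simp add: Z' w\<beta> c2_def W_def mult.assoc)
  qed (use c W N in auto)
  moreover have "var_holder_norm \<omega> 1 \<beta> 0 T (A Z) \<le> ennreal (c3 * W * N)"
  proof (rule var_holder_norm_1_le)
    show "p_var 1 u v (A Z) \<le> ennreal (c3 * W * N * \<omega> u v powr \<beta>)" if "0 \<le> u" "u \<le> v" "v \<le> T" for u v
      unfolding p_var_1_eq[OF A_p_var_finite[OF Z that]]
      using bounds(2)[OF that] by (intro ennreal_leI) (simp add: w\<beta> c3_def W_def mult.assoc)
  qed (use c W N in auto)
  moreover have "holder_norm2 \<omega> (2 * \<beta>) 0 T (remainder X Z Z') \<le> ennreal (c4 * W * N\<^sup>2)"
    by (rule holder_norm2_le) (use c W N bounds(4) rem_eq in \<open>auto simp: w\<beta> c4_def W_def mult.assoc\<close>)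
  ultimately have "holder_norm \<omega> \<beta> 0 T Z + holder_norm \<omega> \<beta> 0 T Z' + var_holder_norm \<omega> 1 \<beta> 0 T (A Z)
             + holder_norm2 \<omega> (2 * \<beta>) 0 T (remainder X Z Z')
    \<le> ennreal (c1 * W * N) + ennreal (c2 * W * N) + ennreal (c3 * W * N) + ennreal (c4 * W * N\<^sup>2)"
    by (intro add_mono)
  also have "\<dots> = ennreal (c1 * W * N + c2 * W * N + c3 * W * N + c4 * W * N\<^sup>2)"
    using c W N by (simp add: less_imp_le)
  also have "\<dots> \<le> ennreal (total_const * W * (N + N\<^sup>2))"
  proof (rule ennreal_leI)
    \<comment> \<open>The missing cross terms, all nonnegative, are added to turn the sum into a
      product.\<close>
    have "total_const * W * (N + N\<^sup>2) = (c1 * W * N + c2 * W * N + c3 * W * N + c4 * W * N\<^sup>2)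
       + (c4 * W * N + (c1 + c2 + c3) * W * N\<^sup>2)"
      by (simp add: total_const_def c1_def c2_def c3_def c4_def algebra_simps)
    moreover have "0 \<le> c4 * W * N + (c1 + c2 + c3) * W * N\<^sup>2" using c W N by simp
    ultimately show "c1 * W * N + c2 * W * N + c3 * W * N + c4 * W * N\<^sup>2 \<le> total_const * W * (N + N\<^sup>2)"
      by linarith
  qed
  finally show ?thesis by (simp add: W_def w_def)
qed

text \<open>The exponents are \<kappa>1 = 1/\<beta>, from rescaling the control by N^(1/\<beta>),
  and \<kappa>2 = \<kappa>3 = 1. The order of quantifiers expresses what the constants may depend
  on: they are chosen before the control, the rough path, \<xi> and \<open>A\<close>.\<close>

theorem theorem2p7:
  fixes \<beta> \<gamma> :: real
    and \<sigma> :: "(real^'n) \<times> (real^'n) \<Rightarrow> (real^'d) \<Rightarrow>\<^sub>L (real^'n)"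
    and F :: "real \<Rightarrow> real"
  assumes "1/3 < \<beta>" and "\<beta> \<le> 1/2" and "\<gamma> > 1 / \<beta>"
    and "lip_class (\<gamma> - 1) \<sigma>"
    and "mono_on {0..} F" and "continuous_on {0..} F" and "\<And>u. u \<ge> 0 \<Longrightarrow> F u > 0"
  shows
    "(\<forall>T \<omega> X XX \<xi> A.
        0 < T \<and> control_fun T \<omega> \<and> rough_path T \<omega> \<beta> X XX \<and> admissible_map T \<omega> \<beta> F \<xi> A \<longrightarrow>
        (\<exists>Z Z'. rde_solution T \<omega> \<beta> \<sigma> X XX \<xi> A Z Z')) \<and>
     (\<exists>K \<kappa>1 \<kappa>2 \<kappa>3. 0 < K \<and> 0 < \<kappa>1 \<and> 0 < \<kappa>2 \<and> 0 < \<kappa>3 \<and>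
        (\<forall>T \<omega> X XX \<xi> A Z Z'.
           0 < T \<and> control_fun T \<omega> \<and> rough_path T \<omega> \<beta> X XX \<and> admissible_map T \<omega> \<beta> F \<xi> A \<and>
           rde_solution T \<omega> \<beta> \<sigma> X XX \<xi> A Z Z' \<longrightarrow>
           holder_norm \<omega> \<beta> 0 T Z + holder_norm \<omega> \<beta> 0 T Z' + var_holder_norm \<omega> 1 \<beta> 0 T (A Z)
             + holder_norm2 \<omega> (2 * \<beta>) 0 T (remainder X Z Z')
           \<le> ennreal (K * (1 + (1 + rough_norm_tilde T \<omega> \<beta> X XX) powr \<kappa>1 * \<omega> 0 T) powr \<kappa>2
                        * rough_norm_tilde T \<omega> \<beta> X XX powr \<kappa>3)))"
proof -
  obtain \<theta> M where co: "rough_coefficient \<sigma> \<beta> \<theta> M F"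
    using lip_class_rough_coefficient[OF assms(1-5,7)] .
  have pm: "path_map \<sigma> \<beta> \<theta> M F T (\<lambda>s t. N powr (1 / \<beta>) * \<omega> s t) X XX \<xi> A"
    if "0 < T" "control_fun T \<omega>" "rough_path T \<omega> \<beta> X XX" "admissible_map T \<omega> \<beta> F \<xi> A"
      "0 < N" "rough_norm T \<omega> \<beta> X XX \<le> N" for T \<omega> X XX \<xi> A N
    using path_map_rescale[OF rough_driver_rescale[OF co that(1-3,5,6)] that(2,5,4)] .
  define K where "K = rough_coefficient.total_const TYPE('d) \<beta> \<theta> M F"
  have K: "0 < K" unfolding K_def by (rule rough_coefficient.global_consts_pos(4)[OF co])
  have \<beta>: "0 < \<beta>" using assms(1) by simp
  show ?thesis
  proof (intro conjI)
    show "\<forall>T \<omega> X XX \<xi> A. 0 < T \<and> control_fun T \<omega> \<and> rough_path T \<omega> \<beta> X XX \<and> admissible_map T \<omega> \<beta> F \<xi> A \<longrightarrow>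
        (\<exists>Z Z'. rde_solution T \<omega> \<beta> \<sigma> X XX \<xi> A Z Z')"
    proof (intro allI impI)
      fix T \<omega> and X :: "real \<Rightarrow> real \<Rightarrow> real^'d" and XX and \<xi> :: "real^'n" and A
      assume "0 < T \<and> control_fun T \<omega> \<and> rough_path T \<omega> \<beta> X XX \<and> admissible_map T \<omega> \<beta> F \<xi> A"
      then show "\<exists>Z Z'. rde_solution T \<omega> \<beta> \<sigma> X XX \<xi> A Z Z'"
        \<comment> \<open>Existence tolerates any \<open>N\<close> above the norm; adding 1 makes it
          positive even for a vanishing rough path.\<close>
        using rde_solution_of_exact[OF pm[of T \<omega> X XX \<xi> A "rough_norm T \<omega> \<beta> X XX + 1"]]
          rough_norm_nonneg[of T \<omega> \<beta> X XX] by auto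
    qed
  next
    show "\<exists>K \<kappa>1 \<kappa>2 \<kappa>3. 0 < K \<and> 0 < \<kappa>1 \<and> 0 < \<kappa>2 \<and> 0 < \<kappa>3 \<and>
        (\<forall>T \<omega> X XX \<xi> A Z Z'.
           0 < T \<and> control_fun T \<omega> \<and> rough_path T \<omega> \<beta> X XX \<and> admissible_map T \<omega> \<beta> F \<xi> A \<and>
           rde_solution T \<omega> \<beta> \<sigma> X XX \<xi> A Z Z' \<longrightarrow>
           holder_norm \<omega> \<beta> 0 T Z + holder_norm \<omega> \<beta> 0 T Z' + var_holder_norm \<omega> 1 \<beta> 0 T (A Z)
             + holder_norm2 \<omega> (2 * \<beta>) 0 T (remainder X Z Z')
           \<le> ennreal (K * (1 + (1 + rough_norm_tilde T \<omega> \<beta> X XX) powr \<kappa>1 * \<omega> 0 T) powr \<kappa>2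
                        * rough_norm_tilde T \<omega> \<beta> X XX powr \<kappa>3))"
    proof (rule exI[of _ K], rule exI[of _ "1 / \<beta>"], rule exI[of _ 1], rule exI[of _ 1], intro conjI allI impI)
      fix T \<omega> and X :: "real \<Rightarrow> real \<Rightarrow> real^'d" and XX and \<xi> :: "real^'n" and A
        and Z :: "real \<Rightarrow> real^'n" and Z'
      assume sol: "0 < T \<and> control_fun T \<omega> \<and> rough_path T \<omega> \<beta> X XX \<and> admissible_map T \<omega> \<beta> F \<xi> A \<and>
           rde_solution T \<omega> \<beta> \<sigma> X XX \<xi> A Z Z'"
      define R where "R = rough_norm T \<omega> \<beta> X XX"
      define R' where "R' = rough_norm_tilde T \<omega> \<beta> X XX"
      define S where "S = holder_norm \<omega> \<beta> 0 T Z + holder_norm \<omega> \<beta> 0 T Z' + var_holder_norm \<omega> 1 \<beta> 0 T (A Z)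
               + holder_norm2 \<omega> (2 * \<beta>) 0 T (remainder X Z Z')"
      have R: "0 \<le> R" unfolding R_def by (rule rough_norm_nonneg)
      have R': "R' = R + R\<^sup>2 + R ^ 3"
        by (simp add: R'_def R_def rough_norm_tilde_def numeral_eq_Suc)
      have \<omega>T: "0 \<le> \<omega> 0 T" using sol by (auto simp: control_fun_def)
      \<comment> \<open>Stated for every positive \<open>N\<close> above the norm: this freedom is
        used when the norm is 0, and otherwise \<open>N\<close> is the norm itself.\<close>
      have bound: "S \<le> ennreal (K * (1 + N powr (1 / \<beta>) * \<omega> 0 T) * (N + N\<^sup>2))" if N: "0 < N" "R \<le> N" for N
        unfolding S_def K_def using sol N by (intro rde_solution_bound[OF pm]) (auto simp: R_def)
      have "S \<le> ennreal (K * (1 + (1 + R') powr (1 / \<beta>) * \<omega> 0 T) powr 1 * R' powr 1)"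
      proof (cases "R = 0")
        case True
        \<comment> \<open>For R = 0 the right-hand side is 0, so all four norms have to vanish;
          letting \<open>N\<close> tend to 0 in \<open>bound\<close> gives this.\<close>
        have "S \<le> 0"
        proof (rule ennreal_le_epsilon)
          fix e :: real assume e: "0 < e"
          define c where "c = K * (1 + \<omega> 0 T) * 2"
          have c: "0 < c" using K \<omega>T by (simp add: c_def)
          define N where "N = min 1 (e / c)"
          have N: "0 < N" "N \<le> 1" "N \<le> e / c" using e c by (auto simp: N_def)
          have "K * (1 + N powr (1 / \<beta>) * \<omega> 0 T) * (N + N\<^sup>2) \<le> K * (1 + 1 * \<omega> 0 T) * (N + N)"
          proof (intro mult_mono mult_left_mono add_mono mult_right_mono)
            show "N powr (1 / \<beta>) \<le> 1" using N \<beta> by (intro powr_le1) auto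
            show "N\<^sup>2 \<le> N" using N by (simp add: power2_eq_square mult_left_le)
          qed (use K \<omega>T N in auto)
          also have "\<dots> = c * N" by (simp add: c_def)
          also have "\<dots> \<le> e" using N(3) c by (simp add: le_divide_eq mult.commute)
          finally have "S \<le> ennreal e"
            using bound[OF N(1)] True N(1) by (auto intro: order_trans ennreal_leI)
          then show "S \<le> 0 + ennreal e" by simp
        qed
        then show ?thesis by simp
      next
        case False
        then have R0: "0 < R" using R by simp
        have "K * (1 + R powr (1 / \<beta>) * \<omega> 0 T) * (R + R\<^sup>2) \<le> K * (1 + (1 + R') powr (1 / \<beta>) * \<omega> 0 T) * R'"
        proof (intro mult_mono mult_left_mono add_mono mult_right_mono powr_mono2)
          show "R \<le> 1 + R'" "R + R\<^sup>2 \<le> R'" using R by (auto simp: R')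
        qed (use K \<omega>T R \<beta> in auto)
        moreover have "0 \<le> 1 + (1 + R') powr (1 / \<beta>) * \<omega> 0 T" "0 \<le> R'"
          using \<omega>T R by (auto simp: R')
        ultimately have "K * (1 + R powr (1 / \<beta>) * \<omega> 0 T) * (R + R\<^sup>2)
           \<le> K * (1 + (1 + R') powr (1 / \<beta>) * \<omega> 0 T) powr 1 * R' powr 1"
          by simp
        then show ?thesis using bound[OF R0 order_refl] order_trans ennreal_leI by blast
      qed
      then show "holder_norm \<omega> \<beta> 0 T Z + holder_norm \<omega> \<beta> 0 T Z' + var_holder_norm \<omega> 1 \<beta> 0 T (A Z)
               + holder_norm2 \<omega> (2 * \<beta>) 0 T (remainder X Z Z')
             \<le> ennreal (K * (1 + (1 + rough_norm_tilde T \<omega> \<beta> X XX) powr (1 / \<beta>) * \<omega> 0 T) powr 1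
                          * rough_norm_tilde T \<omega> \<beta> X XX powr 1)"
        unfolding S_def R'_def .
    qed (use K \<beta> in auto)
  qed
qed

end
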